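(* Deciding whether a subcubic graph $G$ with $n$ vertices has a spanning tree with at least $k$ internal vertices can be done in time $2.7321^k n^{\mathcal{O}(1)}$.
   Context: Graphs are simple and undirected; a graph is subcubic if its maximum degree is at most three. An internal vertex of a tree is a vertex of degree at least $2$ in the tree. *)

theory Defs
  imports Complex_Main "HOL-Library.Landau_Symbols" "HOL-Library.Log_Nat"
begin

section \<open>Simple undirected graphs and spanning trees\<close>

text \<open>A graph is a vertex set together with a set of two-element sets of vertices.\<close>

definition simple_graph :: "'a set \<Rightarrow> 'a set set \<Rightarrow> bool" where
  "simple_graph V E \<longleftrightarrow> finite V \<and> (\<forall>e\<in>E. e \<subseteq> V \<and> card e = 2)"

definition degree :: "'a set set \<Rightarrow> 'a \<Rightarrow> nat" where
  "degree E v = card {e \<in> E. v \<in> e}"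

definition subcubic :: "'a set \<Rightarrow> 'a set set \<Rightarrow> bool" where
  "subcubic V E \<longleftrightarrow> (\<forall>v\<in>V. degree E v \<le> 3)"

definition connected_graph :: "'a set \<Rightarrow> 'a set set \<Rightarrow> bool" where
  "connected_graph V E \<longleftrightarrow>
     V \<noteq> {} \<and> (\<forall>u\<in>V. \<forall>v\<in>V. (u, v) \<in> {(x, y). {x, y} \<in> E}\<^sup>*)"

text \<open>A cycle is given by the list of its vertices, without repetition of the first one.\<close>

definition is_cycle :: "'a set set \<Rightarrow> 'a list \<Rightarrow> bool" where
  "is_cycle E vs \<longleftrightarrow> length vs \<ge> 3 \<and> distinct vs \<and>
     (\<forall>i. Suc i < length vs \<longrightarrow> {vs ! i, vs ! Suc i} \<in> E) \<and> {last vs, hd vs} \<in> E"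

definition tree :: "'a set \<Rightarrow> 'a set set \<Rightarrow> bool" where
  "tree V F \<longleftrightarrow> simple_graph V F \<and> connected_graph V F \<and> (\<nexists>vs. is_cycle F vs)"

definition spanning_tree :: "'a set \<Rightarrow> 'a set set \<Rightarrow> 'a set set \<Rightarrow> bool" where
  "spanning_tree V E F \<longleftrightarrow> F \<subseteq> E \<and> tree V F"

definition internal_vertices :: "'a set \<Rightarrow> 'a set set \<Rightarrow> 'a set" where
  "internal_vertices V F = {v \<in> V. degree F v \<ge> 2}"

definition has_internal_spanning_tree :: "'a set \<Rightarrow> 'a set set \<Rightarrow> nat \<Rightarrow> bool" where
  "has_internal_spanning_tree V E k \<longleftrightarrow>
     (\<exists>F. spanning_tree V E F \<and> card (internal_vertices V F) \<ge> k)"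


section \<open>Random access machine with logarithmic cost\<close>

text \<open>
  The machine model is the random access machine on natural numbers under the logarithmic cost
  criterion, with structured control flow. Its memory is divided into arrays of unbounded
  length; a program names only finitely many of them, so that interleaving them in a single
  memory changes the running time by a constant factor only. A scalar register is an
  array that is accessed at index \<open>0\<close> only.
\<close>

type_synonym state = "nat \<Rightarrow> nat \<Rightarrow> nat"

text \<open>Subtraction is truncated, and the quotient by \<open>0\<close> is \<open>0\<close>.\<close>

datatype aexp =
    Const nat
  | Read nat aexp  \<comment> \<open>array, index\<close>
  | Plus aexp aexp
  | Minus aexp aexp
  | Times aexp aexp
  | Quot aexp aexp

datatype com =
    Skip
  | Write nat aexp aexp  \<comment> \<open>array, index, new value\<close>
  | Seq com com
  | If aexp com com  \<comment> \<open>a condition holds if its value is not \<open>0\<close>\<close>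
  | While aexp com

fun aval :: "aexp \<Rightarrow> state \<Rightarrow> nat" where
  "aval (Const c) s = c"
| "aval (Read x a) s = s x (aval a s)"
| "aval (Plus a b) s = aval a s + aval b s"
| "aval (Minus a b) s = aval a s - aval b s"
| "aval (Times a b) s = aval a s * aval b s"
| "aval (Quot a b) s = aval a s div aval b s"

text \<open>The length of the binary representation, where \<open>0\<close> has length \<open>1\<close>.\<close>

definition len :: "nat \<Rightarrow> nat" where
  "len x = max 1 (floorlog 2 x)"

text \<open>
  Every operation is charged for the lengths of the numbers and addresses it handles;
  multiplication and division are charged as much as the schoolbook methods take.
\<close>

fun acost :: "aexp \<Rightarrow> state \<Rightarrow> nat" where
  "acost (Const c) s = len c"
| "acost (Read x a) s = acost a s + len (aval a s) + len (s x (aval a s))"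
| "acost (Plus a b) s = acost a s + acost b s + len (aval a s) + len (aval b s)"
| "acost (Minus a b) s = acost a s + acost b s + len (aval a s) + len (aval b s)"
| "acost (Times a b) s = acost a s + acost b s + len (aval a s) * len (aval b s)"
| "acost (Quot a b) s = acost a s + acost b s + len (aval a s) * len (aval b s)"

text \<open>\<open>exec c s t s'\<close>: started in state \<open>s\<close>, program \<open>c\<close> halts in state \<open>s'\<close> after time \<open>t\<close>.\<close>

inductive exec :: "com \<Rightarrow> state \<Rightarrow> nat \<Rightarrow> state \<Rightarrow> bool" where
  Skip: "exec Skip s 1 s"
| Write: "exec (Write x a b) s
     (acost a s + acost b s + len (aval a s) + len (aval b s))
     (s(x := (s x)(aval a s := aval b s)))"
| Seq: "exec c s t s' \<Longrightarrow> exec d s' u s'' \<Longrightarrow> exec (Seq c d) s (t + u) s''"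
| IfTrue: "aval b s \<noteq> 0 \<Longrightarrow> exec c s t s' \<Longrightarrow>
     exec (If b c d) s (acost b s + len (aval b s) + t) s'"
| IfFalse: "aval b s = 0 \<Longrightarrow> exec d s t s' \<Longrightarrow>
     exec (If b c d) s (acost b s + len (aval b s) + t) s'"
| WhileFalse: "aval b s = 0 \<Longrightarrow>
     exec (While b c) s (acost b s + len (aval b s)) s"
| WhileTrue: "aval b s \<noteq> 0 \<Longrightarrow> exec c s t s' \<Longrightarrow> exec (While b c) s' u s'' \<Longrightarrow>
     exec (While b c) s (acost b s + len (aval b s) + t + u) s''"

inductive_cases exec_SkipE: "exec Skip s t s'"
inductive_cases exec_WriteE: "exec (Write x a b) s t s'"
inductive_cases exec_SeqE: "exec (Seq c d) s t s'"
inductive_cases exec_IfE: "exec (If b c d) s t s'"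
inductive_cases exec_WhileE: "exec (While b c) s t s'"

lemma exec_deterministic:
  "exec c s t s' \<Longrightarrow> exec c s u s'' \<Longrightarrow> t = u \<and> s' = s''"
proof (induction arbitrary: u s'' rule: exec.induct)
  case (Seq c s t s' d u' s'' v r)
  from Seq.prems obtain t1 s1 u1 where
    "exec c s t1 s1" "exec d s1 u1 r" "v = t1 + u1" by (rule exec_SeqE)
  with Seq.IH(1)[of t1 s1] Seq.IH(2)[of u1 r] show ?case by simp
next
  case (IfTrue b s c t s' d v r)
  obtain t1 where "exec c s t1 r" "v = acost b s + len (aval b s) + t1"
    by (rule exec_IfE[OF IfTrue.prems]) (use IfTrue.hyps(1) in simp_all)
  with IfTrue.IH[of t1 r] show ?case by simp
next
  case (IfFalse b s d t s' c v r)
  obtain t1 where "exec d s t1 r" "v = acost b s + len (aval b s) + t1"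
    by (rule exec_IfE[OF IfFalse.prems]) (use IfFalse.hyps(1) in simp_all)
  with IfFalse.IH[of t1 r] show ?case by simp
next
  case (WhileFalse b s c v r)
  show ?case by (rule exec_WhileE[OF WhileFalse.prems]) (use WhileFalse.hyps in simp_all)
next
  case (WhileTrue b s c t s' u' s'' v r)
  obtain t1 s1 u1 where
    "exec c s t1 s1" "exec (While b c) s1 u1 r" "v = acost b s + len (aval b s) + t1 + u1"
    by (rule exec_WhileE[OF WhileTrue.prems]) (use WhileTrue.hyps(1) in simp_all)
  with WhileTrue.IH(1)[of t1 s1] WhileTrue.IH(2)[of u1 r] show ?case by simp
next
  case (Skip s)
  then show ?case by (rule exec_SkipE) simp
next
  case (Write x a b s)
  then show ?case by (rule exec_WriteE) simp
qed

text \<open>The answer is found at index \<open>0\<close> of array \<open>0\<close>: \<open>1\<close> for yes, \<open>0\<close> for no.\<close>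

definition answers_within :: "com \<Rightarrow> state \<Rightarrow> bool \<Rightarrow> real \<Rightarrow> bool" where
  "answers_within c s ans T \<longleftrightarrow>
     (\<exists>t s'. exec c s t s' \<and> s' 0 0 = (if ans then 1 else 0) \<and> real t \<le> T)"

text \<open>
  An instance is a graph with vertices \<open>0, \<dots>, n - 1\<close> and a number \<open>k\<close>. Array \<open>0\<close> initially holds
  \<open>n\<close> and \<open>k\<close>, and array \<open>1\<close> holds the adjacency matrix, row by row. All other cells are \<open>0\<close>.
\<close>

definition instance_state :: "nat \<Rightarrow> nat set set \<Rightarrow> nat \<Rightarrow> state" where
  "instance_state n E k = (\<lambda>x a.
     if x = 0 \<and> a = 0 then n
     else if x = 0 \<and> a = 1 then k
     else if x = 1 \<and> (\<exists>i<n. \<exists>j<n. a = i * n + j \<and> {i, j} \<in> E) then 1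
     else 0)"

end

theory Submission
  imports Defs
begin

text \<open>
  Let a tree \<open>T\<close> be given in the connected subcubic graph \<open>G\<close>. If a leaf \<open>v\<close> of \<open>T\<close> has a neighbour \<open>a\<close>
  outside \<open>T\<close>, then \<open>v\<close> may be assumed to be internal in a solution extending \<open>T\<close>: otherwise add the edge
  \<open>va\<close> and delete the last edge of the old path from \<open>v\<close> to \<open>a\<close>. So there are at most three ways to continue,
  according to which of the outer neighbours \<open>a\<close>, \<open>b\<close> become children of \<open>v\<close>, and each of them adds an internal
  vertex. If both do and \<open>va\<close> is not a bridge of the remaining graph, then \<open>a\<close> may be assumed to have
  degree \<open>2\<close> in the solution, since otherwise \<open>va\<close> can be exchanged for another edge without loss, which
  leads to the case where only \<open>b\<close> is a child. Hence in that case \<open>a\<close> is expanded next, in at most two ways, and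
  the search tree has size \<open>T(k) \<le> 2 T(k - 1) + 2 T(k - 2) + O(1)\<close>, that is \<open>O((1 + \<surd>3)\<^sup>k)\<close>.
  A tree with \<open>k\<close> internal vertices extends to a spanning tree.

  The search is run with a stack of configurations. Everything but its main loop consists of loops of bounded length.
\<close>

section \<open>Reachability and trees\<close>

text \<open>The exchange of \<open>va\<close> in the case of two children is free because both ends
  can spare the edge: \<open>v\<close> has degree 3 there, and \<open>a\<close> has degree 1 or 3.
  Degree 2 at \<open>a\<close> is the one obstacle, and it is turned into a promise: exactly one
  outer edge of \<open>a\<close> is taken when \<open>a\<close> is expanded. This allows the third
  branch only two grandchildren, whence the equation x^2 = 2x + 2, whose positive root 1 + sqrt 3
  lies just below 2.7321.

  Two demands shape the time bound. The polynomial factor may depend on \<open>n\<close> only,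
  although \<open>k\<close> is part of the input and arbitrarily large; so \<open>k > n\<close> is
  rejected by a single comparison, whose cost is quadratic in the length of \<open>k\<close>. And
  under logarithmic cost the numbers in memory have to be short. The values, among them the height
  of the stack, are bounded only through the number of assignments, which is exponential; but the
  cost sees their binary length, which is polynomial in \<open>n\<close>.\<close>

definition reach :: "'a set set \<Rightarrow> 'a \<Rightarrow> 'a \<Rightarrow> bool" where
  "reach F x y \<longleftrightarrow> (x, y) \<in> {(x, y). {x, y} \<in> F}\<^sup>*"

lemma reach_refl [simp]: "reach F x x"
  by (simp add: reach_def)

lemma reach_trans [trans]: "reach F x y \<Longrightarrow> reach F y z \<Longrightarrow> reach F x z"
  unfolding reach_def by (rule rtrancl_trans)

lemma reach_sym: "reach F x y \<Longrightarrow> reach F y x"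
proof -
  have "sym {(x, y). {x, y} \<in> F}"
    by (auto simp: sym_def insert_commute)
  then show "reach F x y \<Longrightarrow> reach F y x"
    unfolding reach_def by (meson sym_rtrancl symD)
qed

lemma reach_edge: "{x, y} \<in> F \<Longrightarrow> reach F x y"
  by (auto simp: reach_def)

lemma reach_mono: "reach F x y \<Longrightarrow> F \<subseteq> G \<Longrightarrow> reach G x y"
  unfolding reach_def by (rule subsetD[OF rtrancl_mono]) auto

lemma reach_induct [consumes 1, case_names refl step]:
  assumes "reach F x y" "P x"
    and "\<And>y z. reach F x y \<Longrightarrow> {y, z} \<in> F \<Longrightarrow> P y \<Longrightarrow> P z"
  shows "P y"
  using assms(1) unfolding reach_def
  by (induction rule: rtrancl_induct) (use assms(2,3) in \<open>auto simp: reach_def\<close>)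

text \<open>A walk that ends outside \<open>C\<close> has a first step out of it. The exchange
  arguments find their edges in this way, with \<open>C\<close> one side of a cut.\<close>

lemma reach_cross:
  assumes "reach F x y" "x \<in> C" "y \<notin> C"
  obtains u w where "{u, w} \<in> F" "u \<in> C" "w \<notin> C"
proof -
  have "(\<exists>u w. {u, w} \<in> F \<and> u \<in> C \<and> w \<notin> C) \<or> y \<in> C"
    using assms(1) by (induction rule: reach_induct) (use assms(2) in auto)
  then show ?thesis using assms(3) that by blast
qed

text \<open>A walk needs the new edge at most once, in one of its two directions. Connectivity and
  acyclicity after an insertion are thereby reduced to reachability by old edges.\<close>

lemma reach_insert:
  assumes "reach (insert {u, w} F) p q"
  shows "reach F p q \<or> reach F p u \<and> reach F w q \<or> reach F p w \<and> reach F u q"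
  using assms
proof (induction rule: reach_induct)
  case (step y z)
  show ?case
  proof (cases "{y, z} \<in> F")
    case True
    then show ?thesis using step.IH reach_trans[OF _ reach_edge[OF True]] by blast
  next
    case False
    then have "(y = u \<and> z = w) \<or> (y = w \<and> z = u)"
      using step.hyps(2) by (auto simp: doubleton_eq_iff)
    then show ?thesis using step.IH by auto
  qed
qed auto

lemma reach_in:
  assumes "reach F x y" "x \<in> V" "\<forall>e\<in>F. e \<subseteq> V"
  shows "y \<in> V"
  using assms(1) by (induction rule: reach_induct) (use assms in auto)

lemma reach_path:
  assumes "reach F x y"
  shows "\<exists>vs. vs \<noteq> [] \<and> hd vs = x \<and> last vs = y \<and> distinct vs \<and>
    (\<forall>i. Suc i < length vs \<longrightarrow> {vs ! i, vs ! Suc i} \<in> F)"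
  using assms
proof (induction rule: reach_induct)
  case refl
  show ?case by (rule exI[of _ "[x]"]) auto
next
  case (step y z)
  then obtain vs where vs: "vs \<noteq> []" "hd vs = x" "last vs = y" "distinct vs"
    "\<forall>i. Suc i < length vs \<longrightarrow> {vs ! i, vs ! Suc i} \<in> F" by blast
  show ?case
  proof (cases "z \<in> set vs")
    case True
    \<comment> \<open>\<open>z\<close> lies on the path already, which is cut back to end
      there.\<close>
    then obtain j where j: "j < length vs" "vs ! j = z" by (auto simp: in_set_conv_nth)
    have "hd (take (Suc j) vs) = x" using vs j by (cases vs) auto
    moreover have "last (take (Suc j) vs) = z" using j by (simp add: take_Suc_conv_app_nth)
    moreover have "\<forall>i. Suc i < length (take (Suc j) vs) \<longrightarrow>
        {take (Suc j) vs ! i, take (Suc j) vs ! Suc i} \<in> F"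
      using vs(5) by auto
    ultimately show ?thesis using vs j by (intro exI[of _ "take (Suc j) vs"]) auto
  next
    case False
    have "{(vs @ [z]) ! i, (vs @ [z]) ! Suc i} \<in> F" if "Suc i < length (vs @ [z])" for i
    proof (cases "Suc i < length vs")
      case True
      then show ?thesis using vs(5) by (auto simp: nth_append)
    next
      case False
      then have "Suc i = length vs" using that by auto
      then have "vs ! i = y" using vs(1,3) by (simp add: last_conv_nth flip: \<open>Suc i = length vs\<close>)
      then show ?thesis using \<open>Suc i = length vs\<close> step.hyps(2) by (simp add: nth_append)
    qed
    then show ?thesis using vs False by (intro exI[of _ "vs @ [z]"]) auto
  qed
qed

section \<open>Acyclicity, exchange of edges and extension of trees\<close>

text \<open>Acyclicity in a form that speaks of \<open>reach\<close> only, so that the exchange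
  arguments never handle lists of vertices.\<close>

definition bridged :: "'a set set \<Rightarrow> bool" where
  "bridged F \<longleftrightarrow> (\<forall>x y. {x, y} \<in> F \<longrightarrow> \<not> reach (F - {{x, y}}) x y)"

text \<open>A path that joins the ends of an edge and avoids it has at least three vertices, and the
  edge closes it to a cycle. A cycle without its closing edge still joins the ends of that
  edge.\<close>

lemma acyclic_iff_bridged: "(\<nexists>vs. is_cycle F vs) \<longleftrightarrow> bridged F" if sg: "simple_graph V F"
proof
  assume nc: "\<nexists>vs. is_cycle F vs"
  show "bridged F"
    unfolding bridged_def
  proof (intro allI impI notI)
    fix x y assume e: "{x, y} \<in> F" and r: "reach (F - {{x, y}}) x y"
    have "card {x, y} = 2" using sg e by (auto simp: simple_graph_def)
    then have ne: "x \<noteq> y" by auto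
    obtain vs where vs: "vs \<noteq> []" "hd vs = x" "last vs = y" "distinct vs"
      "\<forall>i. Suc i < length vs \<longrightarrow> {vs ! i, vs ! Suc i} \<in> F - {{x, y}}"
      using reach_path[OF r] by blast
    have "length vs \<noteq> 1" using vs(1-3) ne by (cases vs) auto
    moreover have "length vs \<noteq> 2"
    proof
      assume "length vs = 2"
      then obtain p q where "vs = [p, q]" by (cases vs; cases "tl vs") auto
      then show False using vs by auto
    qed
    ultimately have "length vs \<ge> 3" using vs(1) by (cases "length vs") auto
    then have "is_cycle F vs"
      using vs e by (auto simp: is_cycle_def insert_commute)
    then show False using nc by blast
  qed
next
  assume b: "bridged F"
  show "\<nexists>vs. is_cycle F vs"
  proof
    assume "\<exists>vs. is_cycle F vs"
    then obtain vs where vs: "length vs \<ge> 3" "distinct vs"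
      "\<forall>i. Suc i < length vs \<longrightarrow> {vs ! i, vs ! Suc i} \<in> F" "{last vs, hd vs} \<in> F"
      by (auto simp: is_cycle_def)
    have "vs \<noteq> []" using vs(1) by auto
    then have hl: "hd vs = vs ! 0" "last vs = vs ! (length vs - 1)"
      by (auto intro!: hd_conv_nth simp: last_conv_nth)
    have "reach (F - {{last vs, hd vs}}) (hd vs) (vs ! i)" if "i < length vs" for i
      using that
    proof (induction i)
      case 0
      then show ?case using hl by simp
    next
      case (Suc i)
      have "vs ! Suc i \<noteq> vs ! 0"
        using nth_eq_iff_index_eq[OF vs(2), of "Suc i" 0] Suc.prems \<open>vs \<noteq> []\<close> by simp
      \<comment> \<open>With at least three vertices no consecutive pair consists of the first and
        the last one, so the walk along the list avoids the closing edge.\<close>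
      moreover have "vs ! i \<noteq> vs ! 0 \<or> vs ! Suc i \<noteq> vs ! (length vs - 1)"
        using nth_eq_iff_index_eq[OF vs(2), of i 0] Suc.prems vs(1)
          nth_eq_iff_index_eq[OF vs(2), of "Suc i" "length vs - 1"] by linarith
      ultimately have "{vs ! i, vs ! Suc i} \<noteq> {last vs, hd vs}"
        unfolding hl doubleton_eq_iff by blast
      then have "{vs ! i, vs ! Suc i} \<in> F - {{last vs, hd vs}}"
        using vs(3) Suc.prems by auto
      moreover have "reach (F - {{last vs, hd vs}}) (hd vs) (vs ! i)"
        using Suc.IH Suc.prems by simp
      ultimately show ?case using reach_trans reach_edge by metis
    qed
    from this[of "length vs - 1"] have "reach (F - {{last vs, hd vs}}) (last vs) (hd vs)"
      using vs(1) hl(2) by (intro reach_sym[of _ "hd vs"]) simp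
    then show False using b vs(4) by (auto simp: bridged_def)
  qed
qed

lemma connected_graph_reach:
  "connected_graph V F \<longleftrightarrow> V \<noteq> {} \<and> (\<forall>u\<in>V. \<forall>v\<in>V. reach F u v)"
  by (simp add: connected_graph_def reach_def)

lemma tree_iff_bridged:
  "tree V F \<longleftrightarrow> simple_graph V F \<and> connected_graph V F \<and> bridged F"
  unfolding tree_def using acyclic_iff_bridged by blast

lemma simple_graph_subset: "simple_graph V F \<Longrightarrow> G \<subseteq> F \<Longrightarrow> simple_graph V G"
  by (auto simp: simple_graph_def)

lemma simple_graph_finite: "simple_graph V F \<Longrightarrow> finite F"
  by (rule finite_subset[of F "Pow V"]) (auto simp: simple_graph_def)

lemma simple_graph_edge:
  assumes "simple_graph V F" "{x, y} \<in> F" shows "x \<noteq> y" "x \<in> V" "y \<in> V"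
  using assms by (force simp: simple_graph_def)+

lemma simple_graph_edge_cases:
  assumes "simple_graph V F" "e \<in> F" "x \<in> e"
  obtains y where "e = {x, y}" "x \<noteq> y" "y \<in> V"
proof -
  have "card e = 2" "e \<subseteq> V" using assms by (auto simp: simple_graph_def)
  then show ?thesis using assms(3) that by (auto simp: card_2_iff)
qed

text \<open>Deleting \<open>{x, y}\<close> splits the tree into two sides. As \<open>u\<close> lies
  on one and \<open>w\<close> on the other, the new edge joins the sides again and closes no
  cycle.\<close>

lemma tree_exchange:
  assumes t: "tree V F" and e: "{x, y} \<in> F" and uw: "u \<in> V" "w \<in> V"
    and xu: "reach (F - {{x, y}}) x u" and yw: "reach (F - {{x, y}}) y w"
  shows "tree V (insert {u, w} (F - {{x, y}}))"
proof -
  let ?D = "F - {{x, y}}" and ?F = "insert {u, w} (F - {{x, y}})"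
  have F: "F = insert {x, y} ?D" using e by auto
  have sg: "simple_graph V F" and con: "connected_graph V F" and b: "bridged F"
    using t by (auto simp: tree_iff_bridged)
  have nxy: "\<not> reach ?D x y" using b e by (auto simp: bridged_def)
  have nuw: "\<not> reach ?D u w"
    using nxy reach_trans[OF reach_trans[OF xu] reach_sym[OF yw]] by blast
  then have "u \<noteq> w" by auto
  then have "simple_graph V ?F" using sg uw by (auto simp: simple_graph_def)
  moreover have "connected_graph V ?F"
    unfolding connected_graph_reach
  proof (intro conjI ballI)
    show "V \<noteq> {}" using uw by auto
    fix p q assume "p \<in> V" "q \<in> V"
    then have "reach (insert {x, y} ?D) p q"
      using con F by (auto simp: connected_graph_reach)
    moreover have m: "reach ?F p q" if "reach ?D p q" for p q
      using that by (rule reach_mono) auto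
    moreover have "reach ?F x y"
      by (rule reach_trans[OF m[OF xu] reach_trans[OF reach_edge reach_sym[OF m[OF yw]]]]) simp
    ultimately show "reach ?F p q"
      using reach_insert[of x y ?D p q] m[of p x] m[of y q] m[of p y] m[of x q]
        reach_trans[of ?F p x y] reach_trans[of ?F p y q] reach_trans[of ?F p y x]
        reach_trans[of ?F p x q] reach_sym[of ?F x y] m[of p q] by blast
  qed
  moreover have "bridged ?F"
    unfolding bridged_def
  proof (intro allI impI notI)
    fix p q assume pq: "{p, q} \<in> ?F" and r: "reach (?F - {{p, q}}) p q"
    show False
    proof (cases "{p, q} = {u, w}")
      case True
      then have "reach ?D p q" by (intro reach_mono[OF r]) auto
      then show False using nuw True reach_sym[of ?D p q] by (auto simp: doubleton_eq_iff)
    next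
      case False
      \<comment> \<open>A new cycle through an old edge must use \<open>{u, w}\<close>, because the
        old tree has no cycle. Its remaining part, together with \<open>{p, q}\<close>, would
        connect \<open>u\<close> with \<open>w\<close> by old edges.\<close>
      then have pq0: "{p, q} \<in> ?D" using pq by auto
      have "reach (insert {u, w} (?D - {{p, q}})) p q"
        by (rule reach_mono[OF r]) auto
      then consider "reach (?D - {{p, q}}) p q"
        | "reach (?D - {{p, q}}) p u" "reach (?D - {{p, q}}) w q"
        | "reach (?D - {{p, q}}) p w" "reach (?D - {{p, q}}) u q"
        using reach_insert[of u w "?D - {{p, q}}" p q] by blast
      then show False
      proof cases
        case 1
        then have "reach (F - {{p, q}}) p q" by (rule reach_mono) auto
        then show False using b pq0 by (auto simp: bridged_def)
      next
        case 2
        then have "reach ?D p u" "reach ?D w q" by (auto elim: reach_mono)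
        note this[THEN reach_sym]
        with nuw show False
          using reach_trans[OF _ reach_trans[OF reach_edge[OF pq0]], of u w] by blast
      next
        case 3
        then have "reach ?D p w" "reach ?D u q" by (auto elim: reach_mono)
        note this[THEN reach_sym]
        then have "reach ?D w u"
          using reach_trans[OF _ reach_trans[OF reach_edge[OF pq0]], of w u] by blast
        then show False using nuw reach_sym by metis
      qed
    qed
  qed
  ultimately show ?thesis by (simp add: tree_iff_bridged)
qed

text \<open>No edge of \<open>T\<close> reaches \<open>y\<close>, so the new edge lies on no
  cycle.\<close>

lemma tree_extend:
  assumes t: "tree X T" and x: "x \<in> X" and y: "y \<notin> X"
  shows "tree (insert y X) (insert {x, y} T)"
proof -
  let ?T = "insert {x, y} T"
  have sg: "simple_graph X T" and con: "connected_graph X T" and b: "bridged T"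
    using t by (auto simp: tree_iff_bridged)
  have TX: "\<forall>e\<in>T. e \<subseteq> X" using sg by (auto simp: simple_graph_def)
  have "x \<noteq> y" using x y by auto
  then have "simple_graph (insert y X) ?T" using sg x by (auto simp: simple_graph_def)
  moreover have "connected_graph (insert y X) ?T"
  proof -
    have "reach ?T x p" if "p \<in> insert y X" for p
    proof (cases "p = y")
      case True
      then show ?thesis by (auto intro: reach_edge)
    next
      case False
      then have "reach T x p" using con that x by (auto simp: connected_graph_reach)
      then show ?thesis by (rule reach_mono) auto
    qed
    then show ?thesis
      unfolding connected_graph_reach
      by (intro conjI ballI) (simp, rule reach_trans[OF reach_sym, of _ x])
  qed
  moreover have "bridged ?T"
    unfolding bridged_def
  proof (intro allI impI notI)
    fix p q assume pq: "{p, q} \<in> ?T" and r: "reach (?T - {{p, q}}) p q"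
    show False
    proof (cases "{p, q} = {x, y}")
      case True
      then have "reach T p q" by (intro reach_mono[OF r]) auto
      then have "reach T x y" using True reach_sym[of T p q] by (auto simp: doubleton_eq_iff)
      then show False using reach_in[OF _ x TX] y by auto
    next
      case False
      then have pqT: "{p, q} \<in> T" using pq by auto
      then have pqX: "p \<in> X" "q \<in> X" using TX by auto
      have "reach (insert {x, y} (T - {{p, q}})) p q"
        by (rule reach_mono[OF r]) auto
      then consider "reach (T - {{p, q}}) p q" | "reach (T - {{p, q}}) y q"
        | "reach (T - {{p, q}}) p y"
        using reach_insert[of x y "T - {{p, q}}" p q] by blast
      then show False
      proof cases
        case 1
        then show False using b pqT by (auto simp: bridged_def)
      next
        case 2
        then have "reach T q y" by (rule reach_sym[OF reach_mono]) auto
        then show False using reach_in[OF _ pqX(2) TX] y by auto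
      next
        case 3
        then have "reach T p y" by (rule reach_mono) auto
        then show False using reach_in[OF _ pqX(1) TX] y by auto
      qed
    qed
  qed
  ultimately show ?thesis by (simp add: tree_iff_bridged)
qed

text \<open>Any other edge would close a cycle with a path inside \<open>T\<close>. So the solution
  has no edges within \<open>X\<close> except those of \<open>T\<close>, and degrees in it can be
  computed from \<open>T\<close> and the edges that leave \<open>X\<close>.\<close>

lemma tree_induced_edge:
  assumes "tree V F" "T \<subseteq> F" "connected_graph X T" "{p, q} \<in> F" "p \<in> X" "q \<in> X"
  shows "{p, q} \<in> T"
proof (rule ccontr)
  assume "{p, q} \<notin> T"
  then have sub: "T \<subseteq> F - {{p, q}}" using assms(2) by auto
  have "reach T p q" using assms(3,5,6) by (auto simp: connected_graph_reach)
  then have "reach (F - {{p, q}}) p q" using sub by (rule reach_mono)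
  moreover have "bridged F" using assms(1) by (simp add: tree_iff_bridged)
  ultimately show False using assms(4) unfolding bridged_def by blast
qed

text \<open>Connectivity supplies one crossing edge after another. This is why a configuration with
  \<open>k\<close> internal vertices settles the question.\<close>

lemma tree_extends_to_spanning_tree:
  assumes "tree X T" "T \<subseteq> E" "simple_graph V E" "connected_graph V E" "X \<subseteq> V"
  shows "\<exists>F. spanning_tree V E F \<and> T \<subseteq> F"
  using assms
proof (induction "card (V - X)" arbitrary: X T rule: less_induct)
  case less
  have fin: "finite V" using less.prems by (auto simp: simple_graph_def)
  show ?case
  proof (cases "X = V")
    case True
    then show ?thesis using less.prems by (auto simp: spanning_tree_def)
  next
    case False
    then obtain y where y: "y \<in> V" "y \<notin> X" using less.prems by auto
    have "X \<noteq> {}" using less.prems by (auto simp: tree_def connected_graph_def)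
    then obtain x where x: "x \<in> X" by auto
    then have "reach E x y" using less.prems y by (auto simp: connected_graph_reach)
    then obtain u w where uw: "{u, w} \<in> E" "u \<in> X" "w \<notin> X"
      using reach_cross[of E x y X] x y by blast
    have w: "w \<in> V" using simple_graph_edge[OF less.prems(3) uw(1)] by auto
    have "card (V - insert w X) < card (V - X)"
      using fin w uw by (intro psubset_card_mono) auto
    moreover have "tree (insert w X) (insert {u, w} T)"
      using tree_extend less.prems uw by metis
    ultimately show ?thesis
      using less.hyps[of "insert w X" "insert {u, w} T"] less.prems uw w by auto
  qed
qed

lemma degree_mono: "finite F \<Longrightarrow> T \<subseteq> F \<Longrightarrow> degree T v \<le> degree F v"
  unfolding degree_def by (rule card_mono) auto

lemma internal_vertices_mono:
  assumes "finite F" "finite V" "T \<subseteq> F" "X \<subseteq> V"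
  shows "card (internal_vertices X T) \<le> card (internal_vertices V F)"
proof (rule card_mono)
  show "finite (internal_vertices V F)" using assms by (auto simp: internal_vertices_def)
  show "internal_vertices X T \<subseteq> internal_vertices V F"
    using assms(4) degree_mono[OF assms(1,3)]
    by (auto simp: internal_vertices_def) (meson order_trans)
qed

text \<open>The last edge of the tree path from \<open>v\<close> to \<open>a\<close>, found without
  paths: \<open>?C\<close> is what \<open>v\<close> reaches while avoiding \<open>a\<close>, and a
  tree edge that leaves \<open>?C\<close> can only end in \<open>a\<close>.\<close>

lemma tree_last_edge:
  assumes t: "tree V F" and va: "v \<in> V" "a \<in> V" "v \<noteq> a"
  obtains p where "{p, a} \<in> F" "reach (F - {{p, a}}) p v"
proof -
  let ?F = "{e \<in> F. a \<notin> e}"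
  let ?C = "{z. reach ?F v z}"
  have "a \<notin> ?C"
  proof
    assume "a \<in> ?C"
    then have "reach ?F v a" by simp
    then obtain u w where "{u, w} \<in> ?F" "u \<in> - {a}" "w \<notin> - {a}"
      by (rule reach_cross[of _ v a "- {a}"]) (use va in auto)
    then show False by auto
  qed
  moreover have "reach F v a" using t va by (auto simp: tree_def connected_graph_reach)
  ultimately obtain u w where uw: "{u, w} \<in> F" "u \<in> ?C" "w \<notin> ?C"
    using reach_cross[of F v a ?C] by auto
  have "u \<noteq> a" using uw(2) \<open>a \<notin> ?C\<close> by blast
  have "w = a"
  proof (rule ccontr)
    assume "w \<noteq> a"
    then have "{u, w} \<in> ?F" using uw(1) \<open>u \<noteq> a\<close> by auto
    then have "reach ?F v w" using uw(2) by (intro reach_trans[OF _ reach_edge, of _ v u w]) auto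
    then show False using uw by auto
  qed
  have "reach ?F v u" using uw(2) by simp
  then have "reach (F - {{u, a}}) v u" by (rule reach_mono) auto
  then have "reach (F - {{u, a}}) u v" by (rule reach_sym)
  then show ?thesis using that[of u] uw(1) \<open>w = a\<close> by simp
qed

section \<open>Partial trees and exchange arguments\<close>

lemma tree_singleton: "tree {r} {}"
  by (auto simp: tree_iff_bridged simple_graph_def connected_graph_reach bridged_def)

lemma tree_edges_subset: "tree X T \<Longrightarrow> e \<in> T \<Longrightarrow> e \<subseteq> X"
  by (auto simp: tree_def simple_graph_def)

lemma tree_add_star:
  assumes "finite A" "tree X T" "v \<in> X" "A \<inter> X = {}"
  shows "tree (X \<union> A) (T \<union> (\<lambda>a. {v, a}) ` A)"
  using assms
proof (induction A rule: finite_induct)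
  case (insert a A)
  then have "tree (X \<union> A) (T \<union> (\<lambda>a. {v, a}) ` A)" by auto
  then have "tree (insert a (X \<union> A)) (insert {v, a} (T \<union> (\<lambda>a. {v, a}) ` A))"
    by (rule tree_extend) (use insert in auto)
  then show ?case by simp
qed simp

lemma degree_add_ge: "finite F \<Longrightarrow> z \<in> f \<Longrightarrow> f \<notin> F \<Longrightarrow> Suc (degree F z) \<le> degree (insert f F) z"
proof -
  assume a: "finite F" "z \<in> f" "f \<notin> F"
  have "{e \<in> insert f F. z \<in> e} = insert f {e \<in> F. z \<in> e}" using a by auto
  then show ?thesis using a by (simp add: degree_def)
qed

lemma degree_remove: "finite F \<Longrightarrow> degree F z \<le> Suc (degree (F - {e}) z)"
proof -
  assume a: "finite F"
  have "card {e \<in> F. z \<in> e} \<le> card (insert e {e' \<in> F - {e}. z \<in> e'})"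
    by (rule card_mono) (use a in auto)
  also have "\<dots> \<le> Suc (card {e' \<in> F - {e}. z \<in> e'})" by (rule card_insert_le_m1) auto
  finally show ?thesis by (simp add: degree_def)
qed

lemma degree_remove_other: "z \<notin> e \<Longrightarrow> degree (F - {e}) z = degree F z"
  unfolding degree_def by (rule arg_cong[of _ _ card]) auto

text \<open>The last clause bounds the branching: a vertex that is open to the outside has a single
  tree edge, hence at most two outer ones. Expansion preserves the clause by removing from
  \<open>H\<close> the outer edges that are not taken.\<close>

definition partial_tree :: "'a set \<Rightarrow> 'a set set \<Rightarrow> 'a set \<Rightarrow> nat \<Rightarrow> 'a set set \<Rightarrow> bool" where
  "partial_tree V H X i T \<longleftrightarrow> tree X T \<and> T \<subseteq> H \<and> X \<subseteq> V \<and> card (internal_vertices X T) = i \<and>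
     (\<forall>v\<in>X. \<forall>u. u \<notin> X \<and> {v, u} \<in> H \<longrightarrow> degree T v = 1)"

lemma degree_1D:
  assumes "degree T v = 1"
  obtains e where "{e' \<in> T. v \<in> e'} = {e}" "e \<in> T" "v \<in> e"
proof -
  obtain e where "{e' \<in> T. v \<in> e'} = {e}" using assms by (auto simp: degree_def card_1_singleton_iff)
  then show ?thesis using that by blast
qed

text \<open>\<open>A\<close> consists of the new children, and \<open>H'\<close> lacks the rejected
  edges at \<open>v\<close>. So \<open>v\<close> is closed and has become internal, the children are
  leaves, and the other degrees are unchanged: exactly one internal vertex is gained.\<close>

lemma partial_tree_grow:
  assumes p: "partial_tree V H X i T" and sg: "simple_graph V H" and v: "v \<in> X"
    and A: "finite A" "A \<noteq> {}" "\<forall>a\<in>A. a \<notin> X \<and> {v, a} \<in> H'"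
    and H': "H' \<subseteq> H" "T \<subseteq> H'" "\<forall>u. {v, u} \<in> H' \<longrightarrow> u \<in> X \<union> A"
  shows "partial_tree V H' (X \<union> A) (Suc i) (T \<union> (\<lambda>a. {v, a}) ` A)" (is "partial_tree V H' ?X _ ?T")
    and "\<forall>a\<in>A. degree (T \<union> (\<lambda>a. {v, a}) ` A) a = 1"
proof -
  have t: "tree X T" and TH: "T \<subseteq> H" and XV: "X \<subseteq> V" and ci: "card (internal_vertices X T) = i"
    and open1: "\<And>x u. x \<in> X \<Longrightarrow> u \<notin> X \<Longrightarrow> {x, u} \<in> H \<Longrightarrow> degree T x = 1"
    using p by (auto simp: partial_tree_def)
  have finT: "finite T" using t by (auto simp: tree_def intro: simple_graph_finite)
  have TX: "e \<subseteq> X" if "e \<in> T" for e using tree_edges_subset[OF t that] .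
  have t': "tree ?X ?T" by (rule tree_add_star) (use A v t in auto)
  have degA: "degree ?T a = 1" if "a \<in> A" for a
  proof -
    have "{e \<in> ?T. a \<in> e} = {{v, a}}" using that A TX v by auto
    then show ?thesis by (simp add: degree_def)
  qed
  then show "\<forall>a\<in>A. degree ?T a = 1" by blast
  have degX: "degree ?T x = degree T x" if "x \<in> X" "x \<noteq> v" for x
  proof -
    have "{e \<in> ?T. x \<in> e} = {e \<in> T. x \<in> e}" using that A by auto
    then show ?thesis by (simp add: degree_def)
  qed
  obtain a where a: "a \<in> A" using A by auto
  have dv: "degree T v = 1" using open1[OF v, of a] a A H' by auto
  have "{v, a} \<notin> T" using TX a A by auto
  then have "2 \<le> degree (insert {v, a} T) v" using degree_add_ge[OF finT, of v "{v, a}"] dv by simp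
  also have "\<dots> \<le> degree ?T v" by (rule degree_mono) (use finT A a in auto)
  finally have dv': "2 \<le> degree ?T v" .
  have "x \<in> internal_vertices ?X ?T \<longleftrightarrow> x \<in> insert v (internal_vertices X T)" for x
    using degA[of x] degX[of x] dv' v by (cases "x = v") (auto simp: internal_vertices_def)
  then have int: "internal_vertices ?X ?T = insert v (internal_vertices X T)" by blast
  have "finite (internal_vertices X T)"
    using t by (auto simp: internal_vertices_def tree_def simple_graph_def)
  then have card: "card (internal_vertices ?X ?T) = Suc i"
    unfolding int using ci dv by (subst card_insert_disjoint) (auto simp: internal_vertices_def)
  have "a \<in> V" if "a \<in> A" for a
    using simple_graph_edge(3)[OF sg, of v a] A H' that by auto
  then have "?X \<subseteq> V" using XV by auto
  moreover have "degree ?T x = 1" if x: "x \<in> ?X" "u \<notin> ?X" "{x, u} \<in> H'" for x u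
  proof (cases "x \<in> X")
    case True
    then have "x \<noteq> v" using H' x by auto
    then show ?thesis using degX[OF True] open1[OF True, of u] x H' by auto
  next
    case False
    then show ?thesis using degA x by auto
  qed
  ultimately show "partial_tree V H' ?X (Suc i) ?T"
    unfolding partial_tree_def using t' card A H' by auto
qed

text \<open>By \<open>tree_induced_edge\<close> the only solution edge from \<open>v\<close> into
  \<open>X\<close> is its edge in \<open>T\<close>; all others lead outside.\<close>

lemma open_degree:
  assumes p: "partial_tree V H X i T" and sg: "simple_graph V H"
    and F: "tree V F" "T \<subseteq> F" "F \<subseteq> H" and v: "v \<in> X" "degree T v = 1"
  shows "degree F v = Suc (card {u. u \<notin> X \<and> {v, u} \<in> F})"
proof -
  have t: "tree X T" using p by (auto simp: partial_tree_def)
  obtain e where e: "{e' \<in> T. v \<in> e'} = {e}" "e \<in> T" "v \<in> e" using degree_1D[OF v(2)] .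
  let ?U = "{u. u \<notin> X \<and> {v, u} \<in> F}"
  have eq: "{e' \<in> F. v \<in> e'} = insert e ((\<lambda>u. {v, u}) ` ?U)"
  proof (intro equalityI subsetI)
    fix e' assume "e' \<in> {e' \<in> F. v \<in> e'}"
    then obtain y where y: "e' = {v, y}" "{v, y} \<in> F"
      using simple_graph_edge_cases[of V F e' v] F by (auto simp: tree_def)
    show "e' \<in> insert e ((\<lambda>u. {v, u}) ` ?U)"
    proof (cases "y \<in> X")
      case True
      then have "{v, y} \<in> T"
        using tree_induced_edge[OF F(1,2) _ y(2) v(1)] t by (auto simp: tree_def)
      then have "e' \<in> {e' \<in> T. v \<in> e'}" using y by auto
      then show ?thesis using e by auto
    qed (use y in auto)
  qed (use e F in auto)
  have "finite V" using sg by (auto simp: simple_graph_def)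
  moreover have "?U \<subseteq> V" using simple_graph_edge[OF sg] F by blast
  ultimately have "finite ?U" by (rule rev_finite_subset)
  moreover have "e \<notin> (\<lambda>u. {v, u}) ` ?U" using tree_edges_subset[OF t e(2)] by auto
  moreover have "inj_on (\<lambda>u. {v, u}) ?U" by (auto simp: inj_on_def doubleton_eq_iff)
  ultimately show ?thesis unfolding degree_def eq by (simp add: card_image)
qed

text \<open>The tree edge at \<open>v\<close> and three outer edges would give \<open>v\<close>
  degree 4.\<close>

lemma open_at_most_two:
  assumes p: "partial_tree V H X i T" and sg: "simple_graph V H" and sc: "subcubic V H"
    and v: "v \<in> X" and abc: "a \<notin> X" "b \<notin> X" "c \<notin> X" "{v, a} \<in> H" "{v, b} \<in> H" "{v, c} \<in> H"
    and ab: "a \<noteq> b"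
  shows "c = a \<or> c = b"
proof (rule ccontr)
  assume c: "\<not> (c = a \<or> c = b)"
  have "degree T v = 1" using p v abc by (auto simp: partial_tree_def)
  then obtain e where e: "{e' \<in> T. v \<in> e'} = {e}" "e \<in> T" "v \<in> e" by (rule degree_1D)
  have "e \<subseteq> X" using tree_edges_subset[of X T e] p e by (auto simp: partial_tree_def)
  then have "card {e, {v, a}, {v, b}, {v, c}} = 4"
    using c ab abc(1-3) by (auto simp: card_insert_if doubleton_eq_iff)
  moreover have "card {e, {v, a}, {v, b}, {v, c}} \<le> degree H v"
    unfolding degree_def by (rule card_mono)
      (use simple_graph_finite[OF sg] e abc p in \<open>auto simp: partial_tree_def\<close>)
  moreover have "degree H v \<le> 3" using sc v p by (auto simp: subcubic_def partial_tree_def)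
  ultimately show False by simp
qed

text \<open>Only the old neighbour of \<open>a\<close> loses an edge, so at most one internal vertex is lost in exchange for \<open>v\<close>.\<close>

lemma leaf_swap:
  assumes p: "partial_tree V H X i T" and sg: "simple_graph V H"
    and F: "tree V F" "T \<subseteq> F" "F \<subseteq> H" and v: "v \<in> X" "degree T v = 1"
    and a: "a \<notin> X" "{v, a} \<in> H" and leaf: "degree F v = 1"
  obtains F' where "tree V F'" "T \<subseteq> F'" "F' \<subseteq> insert {v, a} F" "{v, a} \<in> F'"
    "card (internal_vertices V F) \<le> card (internal_vertices V F')"
proof -
  have sgF: "simple_graph V F" using F by (auto simp: tree_def)
  have finF: "finite F" using simple_graph_finite[OF sgF] .
  have finV: "finite V" using sg by (auto simp: simple_graph_def)
  have va: "v \<in> V" "a \<in> V" "v \<noteq> a" using simple_graph_edge[OF sg a(2)] by auto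
  have "finite {u. u \<notin> X \<and> {v, u} \<in> F}"
    by (rule finite_subset[OF _ finV]) (use simple_graph_edge[OF sgF] in blast)
  \<comment> \<open>A leaf of the solution has spent its only edge inside \<open>T\<close>.\<close>
  then have "{u. u \<notin> X \<and> {v, u} \<in> F} = {}"
    using open_degree[OF p sg F v] leaf by auto
  then have nF: "{v, a} \<notin> F" using a by auto
  obtain z where z: "{z, a} \<in> F" "reach (F - {{z, a}}) z v"
    using tree_last_edge[OF F(1) va] .
  have "z \<noteq> v" using z nF by auto
  let ?D = "F - {{z, a}}"
  let ?F = "insert {v, a} ?D"
  have t': "tree V ?F" using tree_exchange[OF F(1) z(1) va(1,2) z(2)] by simp
  have nD: "{v, a} \<notin> ?D" using nF by auto
  have finD: "finite ?D" using finF by simp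
  have dv: "2 \<le> degree ?F v"
    using degree_add_ge[OF finD _ nD, of v] degree_remove_other[of v "{z, a}" F] leaf \<open>z \<noteq> v\<close> va(3)
    by auto
  have da: "degree F a \<le> degree ?F a"
    using degree_add_ge[OF finD _ nD, of a] degree_remove[OF finF, of a "{z, a}"] by auto
  have dx: "degree F x \<le> degree ?F x" if "x \<noteq> z" "x \<noteq> a" for x
    using degree_remove_other[of x "{z, a}" F] degree_mono[of ?F ?D x] finF that by auto
  have "insert v (internal_vertices V F - {z}) \<subseteq> internal_vertices V ?F"
  proof
    fix x assume x: "x \<in> insert v (internal_vertices V F - {z})"
    show "x \<in> internal_vertices V ?F"
    proof (cases "x = v")
      case True
      then show ?thesis using dv va by (simp add: internal_vertices_def)
    next
      case False
      then have "x \<in> V" "2 \<le> degree F x" "x \<noteq> z" using x by (auto simp: internal_vertices_def)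
      then show ?thesis using da dx[of x] by (cases "x = a") (auto simp: internal_vertices_def)
    qed
  qed
  then have "card (insert v (internal_vertices V F - {z})) \<le> card (internal_vertices V ?F)"
    by (rule card_mono[rotated]) (use finV in \<open>simp add: internal_vertices_def\<close>)
  moreover have "card (insert v (internal_vertices V F - {z})) = Suc (card (internal_vertices V F - {z}))"
    by (rule card_insert_disjoint) (use finV leaf in \<open>auto simp: internal_vertices_def\<close>)
  moreover have "card (internal_vertices V F) \<le> Suc (card (internal_vertices V F - {z}))"
    using card_Diff1_le[of "internal_vertices V F" z]
    by (cases "z \<in> internal_vertices V F") (auto simp: card_Diff_singleton_if)
  ultimately have "card (internal_vertices V F) \<le> card (internal_vertices V ?F)" by simp
  moreover have "T \<subseteq> ?F" using F(2) a(1) p tree_edges_subset[of X T] by (auto simp: partial_tree_def)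
  ultimately show ?thesis using that[of ?F] t' by auto
qed

text \<open>The degree conditions say that neither end of the edge depends on it for being internal.\<close>

lemma bridge_swap:
  assumes sg: "simple_graph V H" and F: "tree V F" "F \<subseteq> H" and va: "{v, a} \<in> F"
    and dv: "3 \<le> degree F v" and da: "degree F a \<noteq> 2" and con: "connected_graph V (H - {{v, a}})"
  obtains F' where "tree V F'" "F - {{v, a}} \<subseteq> F'" "F' \<subseteq> H - {{v, a}}"
    "card (internal_vertices V F) \<le> card (internal_vertices V F')"
proof -
  have sgF: "simple_graph V F" using F by (auto simp: tree_def)
  have finF: "finite F" using simple_graph_finite[OF sgF] .
  have finV: "finite V" using sg by (auto simp: simple_graph_def)
  have vV: "v \<in> V" "a \<in> V" "v \<noteq> a" using simple_graph_edge[OF sgF va] by auto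
  let ?D = "F - {{v, a}}"
  let ?C = "{z. reach ?D v z}"
  have "a \<notin> ?C" using F va by (auto simp: tree_iff_bridged bridged_def)
  moreover have "reach (H - {{v, a}}) v a" using con vV by (auto simp: connected_graph_reach)
  \<comment> \<open>Since \<open>{v, a}\<close> is not a bridge of the remaining graph, another edge
    crosses between the two sides of the solution.\<close>
  ultimately obtain u w where uw: "{u, w} \<in> H - {{v, a}}" "u \<in> ?C" "w \<notin> ?C"
    using reach_cross[of "H - {{v, a}}" v a ?C] by auto
  have uwV: "u \<in> V" "w \<in> V" using simple_graph_edge[OF sg, of u w] uw by auto
  have "reach F v w" using F uwV vV by (auto simp: tree_iff_bridged connected_graph_reach)
  moreover have "F = insert {v, a} ?D" using va by auto
  ultimately have "reach (insert {v, a} ?D) v w" by simp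
  then have aw: "reach ?D a w" using reach_insert[of v a ?D v w] uw \<open>a \<notin> ?C\<close> by auto
  let ?F = "insert {u, w} ?D"
  have t': "tree V ?F" using tree_exchange[OF F(1) va uwV _ aw] uw by simp
  have finE: "finite ?F" using finF by simp
  have sub: "degree ?D x \<le> degree ?F x" for x by (rule degree_mono[OF finE]) auto
  have "internal_vertices V F \<subseteq> internal_vertices V ?F"
  proof
    fix x assume x: "x \<in> internal_vertices V F"
    then have x': "x \<in> V" "2 \<le> degree F x" by (auto simp: internal_vertices_def)
    have "2 \<le> degree ?D x"
    proof (cases "x \<in> {v, a}")
      case True
      then have "3 \<le> degree F x" using x' dv da by auto
      then show ?thesis using degree_remove[OF finF, of x "{v, a}"] by simp
    next
      case False
      then show ?thesis using degree_remove_other[of x "{v, a}" F] x' by simp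
    qed
    then show "x \<in> internal_vertices V ?F" using x' sub[of x] by (simp add: internal_vertices_def)
  qed
  then have "card (internal_vertices V F) \<le> card (internal_vertices V ?F)"
    by (rule card_mono[rotated]) (use finV in \<open>simp add: internal_vertices_def\<close>)
  moreover have "?F \<subseteq> H - {{v, a}}" using F(2) uw by auto
  ultimately show ?thesis using that[of ?F] t' by auto
qed

section \<open>Branching\<close>

text \<open>
  A configuration \<open>(H, X, i, q)\<close> consists of the edges that are not yet forbidden, the vertices
  of the tree built so far, the number of its internal vertices, and possibly a leaf of the tree
  that must have degree \<open>2\<close> in the solution.
\<close>

type_synonym 'a config = "'a set set \<times> 'a set \<times> nat \<times> 'a option"

text \<open>The edges of the tree are never stored. Branching looks only at the vertex set, the
  count and the remaining edges, so it is enough that some \<open>T\<close> fits them.\<close>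

fun config_valid :: "'a set \<Rightarrow> 'a set set \<Rightarrow> 'a config \<Rightarrow> bool" where
  "config_valid V E (H, X, i, q) \<longleftrightarrow> H \<subseteq> E \<and> (\<exists>T. partial_tree V H X i T)"

text \<open>The restricted leaf is a condition on the solution \<open>F\<close>: it narrows what has
  to be found below the configuration, and plays its part in completeness. Soundness rests on
  \<open>config_valid\<close>.\<close>

fun config_solvable :: "'a set \<Rightarrow> nat \<Rightarrow> 'a config \<Rightarrow> bool" where
  "config_solvable V k (H, X, i, q) \<longleftrightarrow> (\<exists>T F. partial_tree V H X i T \<and> spanning_tree V H F \<and> T \<subseteq> F \<and>
     k \<le> card (internal_vertices V F) \<and> (\<forall>v. q = Some v \<longrightarrow> v \<in> X \<and> degree T v = 1 \<and> degree F v = 2))"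

text \<open>A relation, because the choice of \<open>v\<close>, \<open>a\<close> and
  \<open>b\<close> is left to the program. In \<open>forced\<close> there is no configuration with
  \<open>b\<close> as the only child, since a bridge lies in every spanning tree; in
  \<open>restricted\<close> there is none with both children, since \<open>v\<close> would get
  degree 3. The first entry of \<open>free\<close> carries the promise that \<open>a\<close> has
  degree 2.\<close>

inductive branch :: "'a set \<Rightarrow> 'a config \<Rightarrow> 'a config list \<Rightarrow> bool" for V where
  dead: "(\<And>v a. v \<in> X \<Longrightarrow> a \<notin> X \<Longrightarrow> {v, a} \<in> H \<Longrightarrow> q \<noteq> None \<and> q \<noteq> Some v) \<Longrightarrow> branch V (H, X, i, q) []"
| one: "v \<in> X \<Longrightarrow> a \<notin> X \<Longrightarrow> {v, a} \<in> H \<Longrightarrow> q = None \<or> q = Some v \<Longrightarrow>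
    (\<And>b. b \<notin> X \<Longrightarrow> {v, b} \<in> H \<Longrightarrow> b = a) \<Longrightarrow>
    branch V (H, X, i, q) [(H, insert a X, Suc i, None)]"
| restricted: "v \<in> X \<Longrightarrow> a \<notin> X \<Longrightarrow> b \<notin> X \<Longrightarrow> a \<noteq> b \<Longrightarrow> {v, a} \<in> H \<Longrightarrow> {v, b} \<in> H \<Longrightarrow> q = Some v \<Longrightarrow>
    branch V (H, X, i, q)
      [(H - {{v, a}}, insert b X, Suc i, None), (H - {{v, b}}, insert a X, Suc i, None)]"
| free: "v \<in> X \<Longrightarrow> a \<notin> X \<Longrightarrow> b \<notin> X \<Longrightarrow> a \<noteq> b \<Longrightarrow> {v, a} \<in> H \<Longrightarrow> {v, b} \<in> H \<Longrightarrow> q = None \<Longrightarrow>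
    connected_graph V (H - {{v, a}}) \<Longrightarrow>
    branch V (H, X, i, q)
      [(H, insert a (insert b X), Suc i, Some a),
       (H - {{v, a}}, insert b X, Suc i, None), (H - {{v, b}}, insert a X, Suc i, None)]"
| forced: "v \<in> X \<Longrightarrow> a \<notin> X \<Longrightarrow> b \<notin> X \<Longrightarrow> a \<noteq> b \<Longrightarrow> {v, a} \<in> H \<Longrightarrow> {v, b} \<in> H \<Longrightarrow> q = None \<Longrightarrow>
    \<not> connected_graph V (H - {{v, a}}) \<Longrightarrow>
    branch V (H, X, i, q)
      [(H, insert a (insert b X), Suc i, None), (H - {{v, b}}, insert a X, Suc i, None)]"

lemma config_solvableI:
  assumes "partial_tree V H X i T" "tree V F" "F \<subseteq> H" "T \<subseteq> F" "k \<le> card (internal_vertices V F)"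
    and "\<And>v. q = Some v \<Longrightarrow> v \<in> X \<and> degree T v = 1 \<and> degree F v = 2"
  shows "config_solvable V k (H, X, i, q)"
  unfolding config_solvable.simps spanning_tree_def using assms by blast

declare config_solvable.simps [simp del]

lemma subcubic_subset:
  assumes "subcubic V E" "simple_graph V E" "H \<subseteq> E"
  shows "subcubic V H"
  unfolding subcubic_def
proof
  fix v assume "v \<in> V"
  then have "degree E v \<le> 3" using assms(1) by (simp add: subcubic_def)
  then show "degree H v \<le> 3"
    using degree_mono[OF simple_graph_finite[OF assms(2)] assms(3), of v] by simp
qed

context
  fixes V :: "'a set" and E H :: "'a set set" and X :: "'a set" and i :: nat
  assumes sgE: "simple_graph V E" and scE: "subcubic V E" and HE: "H \<subseteq> E"
begin

lemma sgH: "simple_graph V H" and scH: "subcubic V H"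
  using simple_graph_subset[OF sgE HE] subcubic_subset[OF scE sgE HE] .

lemma grow_single:
  assumes "partial_tree V H X i T" "v \<in> X" "a \<notin> X" "{v, a} \<in> H"
    "\<And>u. u \<notin> X \<Longrightarrow> {v, u} \<in> H \<Longrightarrow> u = a"
  shows "partial_tree V H (insert a X) (Suc i) (insert {v, a} T)"
proof -
  have "\<forall>u. {v, u} \<in> H \<longrightarrow> u \<in> X \<union> {a}" using assms(5) by blast
  moreover have "T \<subseteq> H" using assms(1) by (simp add: partial_tree_def)
  ultimately show ?thesis
    using partial_tree_grow(1)[OF assms(1) sgH assms(2), of "{a}" H] assms(3,4) by simp
qed

text \<open>Removing \<open>{v, b}\<close> closes \<open>v\<close>, which has no third outer
  neighbour.\<close>

lemma grow_choose:
  assumes p: "partial_tree V H X i T" and v: "v \<in> X"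
    and ab: "a \<notin> X" "b \<notin> X" "a \<noteq> b" "{v, a} \<in> H" "{v, b} \<in> H"
  shows "partial_tree V (H - {{v, b}}) (insert a X) (Suc i) (insert {v, a} T)"
proof -
  have "T \<subseteq> H - {{v, b}}" using p ab tree_edges_subset[of X T] by (auto simp: partial_tree_def)
  moreover have "u \<in> X \<union> {a}" if "{v, u} \<in> H - {{v, b}}" for u
    using open_at_most_two[OF p sgH scH v ab(1,2) _ ab(4,5) _ ab(3), of u] that by auto
  ultimately show ?thesis
    using partial_tree_grow(1)[OF p sgH v, of "{a}" "H - {{v, b}}"] ab
    by (simp add: doubleton_eq_iff Diff_subset)
qed

lemma grow_both:
  assumes p: "partial_tree V H X i T" and v: "v \<in> X"
    and ab: "a \<notin> X" "b \<notin> X" "a \<noteq> b" "{v, a} \<in> H" "{v, b} \<in> H"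
  shows "partial_tree V H (insert a (insert b X)) (Suc i) (insert {v, a} (insert {v, b} T))"
    and "degree (insert {v, a} (insert {v, b} T)) a = 1"
proof -
  have "T \<subseteq> H" using p by (auto simp: partial_tree_def)
  moreover have "u \<in> X \<union> {a, b}" if "{v, u} \<in> H" for u
    using open_at_most_two[OF p sgH scH v ab(1,2) _ ab(4,5) _ ab(3), of u] that by auto
  ultimately show "partial_tree V H (insert a (insert b X)) (Suc i) (insert {v, a} (insert {v, b} T))"
    "degree (insert {v, a} (insert {v, b} T)) a = 1"
    using partial_tree_grow[OF p sgH v, of "{a, b}" H] ab by (auto simp: insert_commute)
qed

text \<open>Translates the number of children of \<open>v\<close> in the solution into its degree
  there: 3 for both, 2 for one, 1 for none.\<close>

lemma open_degree_two:
  assumes p: "partial_tree V H X i T" and F: "tree V F" "T \<subseteq> F" "F \<subseteq> H" and v: "v \<in> X"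
    and ab: "a \<notin> X" "b \<notin> X" "a \<noteq> b" "{v, a} \<in> H" "{v, b} \<in> H"
  shows "degree F v = 1 + of_bool ({v, a} \<in> F) + of_bool ({v, b} \<in> F)"
proof -
  have dv: "degree T v = 1" using p v ab by (auto simp: partial_tree_def)
  have "{u. u \<notin> X \<and> {v, u} \<in> F} \<subseteq> {a, b}"
    using open_at_most_two[OF p sgH scH v ab(1,2) _ ab(4,5) _ ab(3)] F(3) by (auto dest: subsetD)
  then have eq: "{u. u \<notin> X \<and> {v, u} \<in> F} =
      (if {v, a} \<in> F then {a} else {}) \<union> (if {v, b} \<in> F then {b} else {})"
    using ab by auto
  show ?thesis
    unfolding open_degree[OF p sgH F v dv] eq using ab by auto
qed

lemma solve_choose:
  assumes p: "partial_tree V H X i T" and v: "v \<in> X"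
    and ab: "a \<notin> X" "b \<notin> X" "a \<noteq> b" "{v, a} \<in> H" "{v, b} \<in> H"
    and F: "tree V F" "T \<subseteq> F" "F \<subseteq> H" "k \<le> card (internal_vertices V F)"
    and ins: "{v, a} \<in> F" "{v, b} \<notin> F"
  shows "config_solvable V k (H - {{v, b}}, insert a X, Suc i, None)"
  by (rule config_solvableI[OF grow_choose[OF p v ab] F(1)]) (use F ins in auto)

text \<open>In each case the given solution, after at most one exchange, solves one of the listed
  configurations. The assumption \<open>i < k\<close> makes a tree without outgoing edges
  hopeless.\<close>

lemma branch_complete:
  assumes br: "branch V (H, X, i, q) cs" and good: "config_solvable V k (H, X, i, q)" and ik: "i < k"
  shows "\<exists>c\<in>set cs. config_solvable V k c"
proof -
  obtain T F where p: "partial_tree V H X i T" and "spanning_tree V H F" and TF: "T \<subseteq> F"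
    and k: "k \<le> card (internal_vertices V F)"
    and q: "\<And>v. q = Some v \<Longrightarrow> v \<in> X \<and> degree T v = 1 \<and> degree F v = 2"
    using good by (auto simp: config_solvable.simps)
  then have F: "tree V F" "T \<subseteq> F" "F \<subseteq> H" by (auto simp: spanning_tree_def)
  have t: "tree X T" "X \<subseteq> V" using p by (auto simp: partial_tree_def)
  have finV: "finite V" using sgE by (auto simp: simple_graph_def)
  show ?thesis
    using br
  proof (cases rule: branch.cases)
    case dead
    show ?thesis
    proof (cases q)
      case None
      \<comment> \<open>No edge of the solution leaves \<open>X\<close>; hence the tree spans the
        graph and is itself the solution, with only \<open>i\<close> internal vertices.\<close>
      have no: "{x, u} \<notin> F" if "x \<in> X" "u \<notin> X" for x u using dead(2)[of x u] None that F by auto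
      have "X \<noteq> {}" using t by (auto simp: tree_def connected_graph_def)
      then obtain x where x: "x \<in> X" by auto
      have "X = V"
      proof (rule ccontr)
        assume "X \<noteq> V"
        then obtain y where y: "y \<in> V" "y \<notin> X" using t by auto
        have "reach F x y" using F x y t by (auto simp: tree_iff_bridged connected_graph_reach)
        then show False using reach_cross[of F x y X] x y no by blast
      qed
      have "F \<subseteq> T"
      proof
        fix e assume e: "e \<in> F"
        then obtain y z where yz: "e = {y, z}"
          using F(1) by (auto simp: tree_def simple_graph_def card_2_iff)
        have sgF: "simple_graph V F" using F by (auto simp: tree_def)
        have "connected_graph X T" using t by (auto simp: tree_def)
        then have "{y, z} \<in> T"
          using tree_induced_edge[OF F(1,2) _ e[unfolded yz]] simple_graph_edge[OF sgF e[unfolded yz]]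
            \<open>X = V\<close> by auto
        then show "e \<in> T" using yz by simp
      qed
      then have "F = T" using F by auto
      then have "card (internal_vertices V F) = i" using p \<open>X = V\<close> by (auto simp: partial_tree_def)
      then show ?thesis using k ik by simp
    next
      case (Some v)
      then have v: "v \<in> X" "degree T v = 1" "degree F v = 2" using q by auto
      \<comment> \<open>Without outer edges the restricted leaf cannot attain its promised degree
        2.\<close>
      have "{u. u \<notin> X \<and> {v, u} \<in> F} = {}" using dead(2)[OF v(1)] Some F by auto
      then have "degree F v = 1" using open_degree[OF p sgH F v(1,2)] by (simp only: card.empty One_nat_def)
      then show ?thesis using v(3) by simp
    qed
  next
    case (one v a)
    have dv: "degree T v = 1" using p one(2-4) by (auto simp: partial_tree_def)
    have only: "u = a" if "u \<notin> X" "{v, u} \<in> H" for u using one(6) that by blast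
    have p': "partial_tree V H (insert a X) (Suc i) (insert {v, a} T)"
      by (rule grow_single[OF p one(2-4) only])
    have "\<exists>F. tree V F \<and> F \<subseteq> H \<and> insert {v, a} T \<subseteq> F \<and> k \<le> card (internal_vertices V F)"
    proof (cases "{v, a} \<in> F")
      case True
      then show ?thesis using F k by auto
    next
      case False
      then have "{u. u \<notin> X \<and> {v, u} \<in> F} = {}" using only F by blast
      then have "degree F v = 1" using open_degree[OF p sgH F one(2) dv] by (simp only: card.empty One_nat_def)
      obtain F' where F': "tree V F'" "T \<subseteq> F'" "F' \<subseteq> insert {v, a} F" "{v, a} \<in> F'"
        "card (internal_vertices V F) \<le> card (internal_vertices V F')"
        by (rule leaf_swap[OF p sgH F one(2) dv one(3,4) \<open>degree F v = 1\<close>])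
      moreover have "F' \<subseteq> H" using F'(3) F(3) one(4) by blast
      ultimately show ?thesis using k by (intro exI[of _ F']) simp
    qed
    then have "config_solvable V k (H, insert a X, Suc i, None)"
      using config_solvableI[OF p', of _ k None] by auto
    then show ?thesis using one(1) by simp
  next
    case (restricted v a b)
    have "degree F v = 2" using q[OF restricted(8)] by simp
    then consider "{v, a} \<in> F" "{v, b} \<notin> F" | "{v, b} \<in> F" "{v, a} \<notin> F"
      using open_degree_two[OF p F restricted(2-7)] by (cases "{v, a} \<in> F"; cases "{v, b} \<in> F") simp_all
    then show ?thesis
    proof cases
      case 1
      show ?thesis
        using solve_choose[OF p restricted(2-7) F k 1] restricted(1) by simp
    next
      case 2
      have "b \<noteq> a" using restricted(5) by simp
      from solve_choose[OF p restricted(2,4,3) this restricted(7,6) F k 2] restricted(1)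
      show ?thesis by simp
    qed
  next
    case (free v a b)
    note fr = free(2-7)
    note sa = solve_choose[OF p fr] and sb = solve_choose[OF p fr(1,3,2) not_sym[OF fr(4)] fr(6,5)]
    have dv: "degree T v = 1" using p fr by (auto simp: partial_tree_def)
    have "config_solvable V k (H, insert a (insert b X), Suc i, Some a) \<or>
      config_solvable V k (H - {{v, a}}, insert b X, Suc i, None) \<or>
      config_solvable V k (H - {{v, b}}, insert a X, Suc i, None)"
    proof (cases "{v, a} \<in> F"; cases "{v, b} \<in> F")
      assume vab: "{v, a} \<in> F" "{v, b} \<in> F"
      then have d3: "3 \<le> degree F v" using open_degree_two[OF p F fr] by simp
      \<comment> \<open>Degree 2 at \<open>a\<close> is what the first configuration promises. With
        any other degree \<open>{v, a}\<close> can be swapped out while \<open>{v, b}\<close> stays,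
        which leaves \<open>b\<close> as the only child.\<close>
      show ?thesis
      proof (cases "degree F a = 2")
        case True
        have "config_solvable V k (H, insert a (insert b X), Suc i, Some a)"
          by (rule config_solvableI[OF grow_both(1)[OF p fr] F(1,3)])
            (use grow_both(2)[OF p fr] F vab k True in auto)
        then show ?thesis by blast
      next
        case False
        obtain F' where F': "tree V F'" "F - {{v, a}} \<subseteq> F'" "F' \<subseteq> H - {{v, a}}"
          "card (internal_vertices V F) \<le> card (internal_vertices V F')"
          using bridge_swap[OF sgH F(1,3) vab(1) d3 False free(9)] .
        have "{v, a} \<notin> T" using p fr tree_edges_subset[of X T] by (auto simp: partial_tree_def)
        then have "T \<subseteq> F'" using TF F' by auto
        moreover have "{v, b} \<in> F'" using vab F' fr by (auto simp: doubleton_eq_iff)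
        ultimately show ?thesis using sb[of F' k] F' k fr(4) by (simp add: subset_Diff_insert)
      qed
    next
      \<comment> \<open>Here \<open>v\<close> is a leaf of the solution. The leaf swap brings in
        \<open>{v, a}\<close> and no other new edge, so \<open>a\<close> becomes the only
        child.\<close>
      assume n: "{v, a} \<notin> F" "{v, b} \<notin> F"
      then have "degree F v = 1" using open_degree_two[OF p F fr] by simp
      obtain F' where F': "tree V F'" "T \<subseteq> F'" "F' \<subseteq> insert {v, a} F" "{v, a} \<in> F'"
        "card (internal_vertices V F) \<le> card (internal_vertices V F')"
        by (rule leaf_swap[OF p sgH F _ dv _ _ \<open>degree F v = 1\<close>, of a]) (use fr in auto)
      moreover have "{v, b} \<notin> F'" using F'(3) n fr by (auto simp: doubleton_eq_iff)
      moreover have "F' \<subseteq> H" using F'(3) F(3) fr(5) by blast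
      ultimately show ?thesis using sa[of F' k] k by simp
    qed (use sa[OF F k] sb[OF F k] in blast)+
    then show ?thesis using free(1) by auto
  next
    case (forced v a b)
    note fr = forced(2-7)
    note sa = solve_choose[OF p fr]
    have dv: "degree T v = 1" using p fr by (auto simp: partial_tree_def)
    have va: "{v, a} \<in> F"
    proof (rule ccontr)
      assume "{v, a} \<notin> F"
      then have "F \<subseteq> H - {{v, a}}" using F by auto
      then have "connected_graph V (H - {{v, a}})"
        using F(1) reach_mono[of F _ _ "H - {{v, a}}"] by (auto simp: tree_iff_bridged connected_graph_reach)
      then show False using forced by blast
    qed
    have "config_solvable V k (H, insert a (insert b X), Suc i, None) \<or>
      config_solvable V k (H - {{v, b}}, insert a X, Suc i, None)"
    proof (cases "{v, b} \<in> F")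
      case True
      have "config_solvable V k (H, insert a (insert b X), Suc i, None)"
        by (rule config_solvableI[OF grow_both(1)[OF p fr] F(1,3)]) (use F va k True in auto)
      then show ?thesis by blast
    qed (use sa[OF F k va] in blast)
    then show ?thesis using forced(1) by auto
  qed
qed

lemma branch_valid:
  assumes br: "branch V (H, X, i, q) cs" and ok: "config_valid V E (H, X, i, q)" and c: "c \<in> set cs"
  shows "config_valid V E c"
proof -
  obtain T where p: "partial_tree V H X i T" using ok by auto
  show ?thesis
    using br
  proof (cases rule: branch.cases)
    case dead
    show ?thesis using c dead(1) by simp
  next
    case (one v a)
    have "partial_tree V H (insert a X) (Suc i) (insert {v, a} T)"
      by (rule grow_single[OF p one(2-4)]) (use one(6) in blast)
    then show ?thesis using one(1) c HE by auto
  next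
    case (restricted v a b)
    have "b \<noteq> a" using restricted(5) by simp
    note g = grow_choose[OF p restricted(2-7)] grow_choose[OF p restricted(2,4,3) this restricted(7,6)]
    show ?thesis using g restricted(1) c HE by auto
  next
    case (free v a b)
    have "b \<noteq> a" using free(5) by simp
    note g = grow_choose[OF p free(2-7)] grow_choose[OF p free(2,4,3) this free(7,6)]
      grow_both(1)[OF p free(2-7)]
    show ?thesis using g free(1) c HE by auto
  next
    case (forced v a b)
    note g = grow_choose[OF p forced(2-7)] grow_both(1)[OF p forced(2-7)]
    show ?thesis using g forced(1) c HE by auto
  qed
qed

end

section \<open>Soundness and starting configurations\<close>

lemma config_valid_reached:
  assumes "simple_graph V E" "connected_graph V E" "config_valid V E (H, X, i, q)" "k \<le> i"
  shows "has_internal_spanning_tree V E k"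
proof -
  obtain T where p: "partial_tree V H X i T" and HE: "H \<subseteq> E" using assms(3) by auto
  obtain F where F: "spanning_tree V E F" "T \<subseteq> F"
    using tree_extends_to_spanning_tree[OF _ _ assms(1,2), of X T] p HE by (auto simp: partial_tree_def)
  have "finite V" "finite F"
    using assms(1) F simple_graph_finite[of V F] by (auto simp: simple_graph_def spanning_tree_def tree_def)
  then have "card (internal_vertices X T) \<le> card (internal_vertices V F)"
    using F p by (intro internal_vertices_mono) (auto simp: partial_tree_def)
  then show ?thesis using F p assms(4) by (auto simp: has_internal_spanning_tree_def partial_tree_def)
qed

lemma config_solvable_sound:
  assumes "H \<subseteq> E" "config_solvable V k (H, X, i, q)"
  shows "has_internal_spanning_tree V E k"
  using assms by (auto simp: config_solvable.simps has_internal_spanning_tree_def spanning_tree_def)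

text \<open>The start is an edge and not a vertex: both ends have degree 1 in the tree, as
  \<open>partial_tree\<close> demands of open vertices, whereas a lone root would have degree 0 and
  up to three outer edges.\<close>

definition start_config :: "'a set set \<Rightarrow> 'a \<Rightarrow> 'a \<Rightarrow> 'a config" where
  "start_config E r y = (E, {r, y}, 0, None)"

lemma start_partial_tree:
  assumes sg: "simple_graph V E" and ry: "{r, y} \<in> E"
  shows "partial_tree V E {r, y} 0 {{r, y}}"
proof -
  have V: "r \<in> V" "y \<in> V" "r \<noteq> y" using simple_graph_edge[OF sg ry] by auto
  have "tree (insert y {r}) (insert {r, y} {})"
    by (rule tree_extend[OF tree_singleton]) (use V in auto)
  then have "tree {r, y} {{r, y}}" by (simp add: insert_commute)
  moreover have d: "degree {{r, y}} v = 1" if "v \<in> {r, y}" for v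
  proof -
    have "{e \<in> {{r, y}}. v \<in> e} = {{r, y}}" using that by auto
    then show ?thesis by (simp add: degree_def)
  qed
  moreover have "internal_vertices {r, y} {{r, y}} = {}"
    using d by (auto simp: internal_vertices_def)
  ultimately show ?thesis using V ry by (auto simp: partial_tree_def)
qed

lemma start_config_valid:
  "simple_graph V E \<Longrightarrow> {r, y} \<in> E \<Longrightarrow> config_valid V E (start_config E r y)"
  using start_partial_tree[of V E r y] by (auto simp: start_config_def)

text \<open>Every spanning tree on more than one vertex has an edge at \<open>r\<close>, so it is
  enough to try the neighbours of one fixed vertex.\<close>

lemma start_config_solvable:
  assumes sg: "simple_graph V E" and r: "r \<in> V" "V \<noteq> {r}" and has: "has_internal_spanning_tree V E k"
  shows "\<exists>y. {r, y} \<in> E \<and> config_solvable V k (start_config E r y)"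
proof -
  obtain F where F: "spanning_tree V E F" "k \<le> card (internal_vertices V F)"
    using has by (auto simp: has_internal_spanning_tree_def)
  obtain z where z: "z \<in> V" "z \<noteq> r" using r by auto
  have "reach F r z" using F r z by (auto simp: spanning_tree_def tree_iff_bridged connected_graph_reach)
  then obtain u y where "{u, y} \<in> F" "u \<in> {r}" "y \<notin> {r}" using reach_cross[of F r z "{r}"] z by auto
  then have ry: "{r, y} \<in> F" by simp
  then have "{r, y} \<in> E" using F by (auto simp: spanning_tree_def)
  then show ?thesis
    unfolding start_config_def
    by (intro exI[of _ y] conjI config_solvableI[OF start_partial_tree[OF sg], of r y F])
      (use F ry in \<open>auto simp: spanning_tree_def\<close>)
qed

section \<open>Size of the search tree\<close>

text \<open>The worst case is \<open>free\<close>: the configuration itself, two children that miss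
  one internal vertex less, and the restricted child, which adds itself and two children of its own.
  This gives the summand 2. The value 4 counts a configuration and three finished children.\<close>

fun search_size :: "nat \<Rightarrow> nat" where
  "search_size 0 = 1"
| "search_size (Suc 0) = 4"
| "search_size (Suc (Suc m)) = 2 + 2 * search_size (Suc m) + 2 * search_size m"

fun config_size :: "nat \<Rightarrow> 'a config \<Rightarrow> nat" where
  "config_size k (H, X, i, None) = search_size (k - i)"
| "config_size k (H, X, i, Some _) = (case k - i of 0 \<Rightarrow> 1 | Suc m \<Rightarrow> 1 + 2 * search_size m)"

text \<open>Settles the steps that produce at most two unrestricted children from an unrestricted
  configuration.\<close>

lemma search_size_Suc: "1 + 2 * search_size m \<le> search_size (Suc m)"
  by (cases m) auto

text \<open>The \<open>Suc\<close> pays for the configuration that is popped, so the total size on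
  the stack drops in every step.\<close>

lemma branch_size:
  assumes "branch V (H, X, i, q) cs" "i < k"
  shows "Suc (\<Sum>c\<leftarrow>cs. config_size k c) \<le> config_size k (H, X, i, q)"
proof -
  obtain m where m: "k - i = Suc m" "k - Suc i = m" using assms(2) by (metis Suc_diff_Suc)
  note S = search_size_Suc[of m]
  show ?thesis
    using assms(1)
  proof (cases rule: branch.cases)
    case dead
    show ?thesis using dead(1) m S by (cases q) auto
  next
    case (one v a)
    show ?thesis using one(1) m S by (cases q) auto
  next
    case (restricted v a b)
    show ?thesis using restricted(1,8) m S by auto
  next
    case (free v a b)
    show ?thesis using free(1,8) m by (cases m) auto
  next
    case (forced v a b)
    show ?thesis using forced(1,8) m S by auto
  qed
qed

text \<open>The shift by 2/3 makes the recurrence homogeneous, because 2 + 2/3 = 2 * 2/3 + 2 * 2/3.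
  The base works since 2.7321^2 \<ge> 2 * 2.7321 + 2, and the factor 2 fits the initial values 1 and
  4.\<close>

lemma search_size_bound: "real (search_size m) + 2/3 \<le> 2 * 2.7321 ^ m"
proof (induction m rule: search_size.induct)
  case (3 m)
  have "real (search_size (Suc (Suc m))) + 2/3 =
      2 * (real (search_size (Suc m)) + 2/3) + 2 * (real (search_size m) + 2/3)" by simp
  also have "\<dots> \<le> 2 * (2 * 2.7321 ^ Suc m) + 2 * (2 * 2.7321 ^ m)"
    using 3 by (intro add_mono mult_left_mono) auto
  also have "\<dots> = 2 * ((2 * 2.7321 + 2) * 2.7321 ^ m)" by simp
  also have "\<dots> \<le> 2 * (2.7321 * 2.7321 * 2.7321 ^ m)"
    by (intro mult_left_mono mult_right_mono) auto
  finally show ?case by simp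
qed auto

section \<open>Loop programs\<close>

lemma len_le_iff: "0 < w \<Longrightarrow> len x \<le> w \<longleftrightarrow> x < 2 ^ w"
  unfolding len_def using floorlog_leD[of 2 x w] floorlog_leI[of x 2 w] by auto

lemma len_pos: "1 \<le> len x"
  by (simp add: len_def)

lemma less_two_power_len: "x < 2 ^ len x"
  using len_le_iff[of "len x" x] len_pos[of x] by simp

lemma len_mono: "x \<le> y \<Longrightarrow> len x \<le> len y"
  using len_le_iff[of "len y" x] less_two_power_len[of y] len_pos[of y] by simp

text \<open>Two powers of 2 that are at least 2 have a sum at most their product. The bound has the
  same form as that for products, so \<open>len_factor\<close> treats both alike.\<close>

lemma len_add: "len (x + y) \<le> len x + len y"
proof -
  have "x + y < 2 ^ len x + 2 ^ len y" by (rule add_strict_mono[OF less_two_power_len less_two_power_len])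
  also have "(2::nat) ^ len x + 2 ^ len y \<le> 2 ^ len x * 2 ^ len y"
  proof -
    have a: "(2::nat) \<le> 2 ^ len x" "(2::nat) \<le> 2 ^ len y"
      using self_le_power[of "2::nat" "len x"] self_le_power[of "2::nat" "len y"] len_pos[of x] len_pos[of y]
      by auto
    have "p + q \<le> p * q" if pq: "2 \<le> p" "2 \<le> q" for p q :: nat
    proof -
      obtain p' q' where "p = 2 + p'" "q = 2 + q'" using pq le_Suc_ex[of 2 p] le_Suc_ex[of 2 q] by blast
      then show ?thesis by simp
    qed
    then show ?thesis using a by blast
  qed
  finally show ?thesis using len_le_iff[of "len x + len y" "x + y"] len_pos[of x]
    by (simp add: power_add)
qed

lemma len_mult: "len (x * y) \<le> len x + len y"
  using len_le_iff[of "len x + len y" "x * y"] len_pos[of x]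
    mult_strict_mono'[OF less_two_power_len[of x] less_two_power_len[of y]]
  by (simp add: power_add)

lemma len_le_Suc: "len x \<le> Suc x"
proof -
  have "x < 2 ^ Suc x" using less_exp[of "Suc x"] by linarith
  then show ?thesis using len_le_iff[of "Suc x" x] by blast
qed

definition bounded :: "state \<Rightarrow> nat \<Rightarrow> bool" where
  "bounded s B \<longleftrightarrow> (\<forall>x a. s x a \<le> B)"

lemma boundedD: "bounded s B \<Longrightarrow> s x a \<le> B"
  by (simp add: bounded_def)

lemma bounded_mono: "bounded s B \<Longrightarrow> B \<le> B' \<Longrightarrow> bounded s B'"
  unfolding bounded_def using le_trans by blast

text \<open>A value that is read has length at most \<open>len B\<close> whatever its address, so a
  read resets the factor to 1.\<close>

fun len_factor :: "aexp \<Rightarrow> nat" where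
  "len_factor (Const c) = len c"
| "len_factor (Read x a) = 1"
| "len_factor (Plus a b) = len_factor a + len_factor b"
| "len_factor (Minus a b) = len_factor a"
| "len_factor (Times a b) = len_factor a + len_factor b"
| "len_factor (Quot a b) = len_factor a"

text \<open>To be multiplied by the square of \<open>len B\<close>, the order of a schoolbook
  multiplication; linear costs are absorbed.\<close>

fun cost_factor :: "aexp \<Rightarrow> nat" where
  "cost_factor (Const c) = len c"
| "cost_factor (Read x a) = cost_factor a + len_factor a + 1"
| "cost_factor (Plus a b) = cost_factor a + cost_factor b + len_factor a + len_factor b"
| "cost_factor (Minus a b) = cost_factor a + cost_factor b + len_factor a + len_factor b"
| "cost_factor (Times a b) = cost_factor a + cost_factor b + len_factor a * len_factor b"
| "cost_factor (Quot a b) = cost_factor a + cost_factor b + len_factor a * len_factor b"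

lemma len_aval: "bounded s B \<Longrightarrow> len (aval e s) \<le> len_factor e * len B"
proof (induction e)
  case (Const c)
  then show ?case using len_pos[of B] by simp
next
  case (Read x e)
  then show ?case using len_mono[OF boundedD] by simp
next
  case (Plus a b)
  then show ?case using len_add[of "aval a s" "aval b s"] by (simp add: algebra_simps)
next
  case (Minus a b)
  then show ?case using len_mono[of "aval a s - aval b s" "aval a s"] by simp
next
  case (Times a b)
  then show ?case using len_mult[of "aval a s" "aval b s"] by (simp add: algebra_simps)
next
  case (Quot a b)
  then show ?case using len_mono[of "aval a s div aval b s" "aval a s"] by simp
qed

lemma le_len_square: "len B \<le> (len B)\<^sup>2"
  using mult_le_mono2[OF len_pos, of B "len B"] by (simp add: power2_eq_square)

lemma acost_le: "bounded s B \<Longrightarrow> acost e s \<le> cost_factor e * (len B)\<^sup>2"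
proof (induction e)
  case (Const c)
  then show ?case using le_len_square[of B] len_pos[of B] by simp
next
  case (Read x e)
  have "len (aval e s) \<le> len_factor e * (len B)\<^sup>2"
    by (rule order_trans[OF len_aval[OF Read.prems] mult_le_mono2[OF le_len_square]])
  moreover have "len (s x (aval e s)) \<le> (len B)\<^sup>2"
    by (rule order_trans[OF len_mono[OF boundedD[OF Read.prems]] le_len_square])
  ultimately show ?case using Read by (simp add: algebra_simps)
next
  case (Plus a b)
  have "len (aval e s) \<le> len_factor e * (len B)\<^sup>2" for e
    by (rule order_trans[OF len_aval[OF Plus.prems] mult_le_mono2[OF le_len_square]])
  from this[of a] this[of b] show ?case using Plus by (simp add: algebra_simps)
next
  case (Minus a b)
  have "len (aval e s) \<le> len_factor e * (len B)\<^sup>2" for e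
    by (rule order_trans[OF len_aval[OF Minus.prems] mult_le_mono2[OF le_len_square]])
  from this[of a] this[of b] show ?case using Minus by (simp add: algebra_simps)
next
  case (Times a b)
  have "len (aval a s) * len (aval b s) \<le> (len_factor a * len B) * (len_factor b * len B)"
    by (intro mult_le_mono len_aval Times.prems)
  then show ?case using Times by (simp add: algebra_simps power2_eq_square)
next
  case (Quot a b)
  have "len (aval a s) * len (aval b s) \<le> (len_factor a * len B) * (len_factor b * len B)"
    by (intro mult_le_mono len_aval Quot.prems)
  then show ?case using Quot by (simp add: algebra_simps power2_eq_square)
qed

definition charge :: "aexp \<Rightarrow> nat" where
  "charge e = cost_factor e + len_factor e"

lemma charge_le: "bounded s B \<Longrightarrow> acost e s + len (aval e s) \<le> charge e * (len B)\<^sup>2"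
  using acost_le[of s B e] order_trans[OF len_aval mult_le_mono2[OF le_len_square], of s B e]
  by (simp add: charge_def algebra_simps)

text \<open>
  Loop programs: the bound of a loop is held in a register that the program does not change, and
  every assignment exceeds the values in memory by at most \<open>1\<close>.
  The running time is then polynomial for reasons of syntax alone.
\<close>

datatype prog =
    Nop
  | Assign nat aexp aexp
  | Then prog prog
  | Cond aexp prog prog
  | For nat nat prog  \<comment> \<open>counter, bound\<close>

abbreviation reg :: "nat \<Rightarrow> aexp" where
  "reg x \<equiv> Read x (Const 0)"

abbreviation set_reg :: "nat \<Rightarrow> nat \<Rightarrow> state \<Rightarrow> state" where
  "set_reg x v s \<equiv> s(x := (s x)(0 := v))"

text \<open>After \<open>j\<close> rounds the counter is set to \<open>j\<close> outright. The
  compiled increment agrees with this because a well-formed body does not assign the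
  counter.\<close>

fun iter :: "(state \<Rightarrow> state) \<Rightarrow> nat \<Rightarrow> nat \<Rightarrow> state \<Rightarrow> state" where
  "iter g i 0 s = set_reg i 0 s"
| "iter g i (Suc j) s = set_reg i (Suc j) (g (iter g i j s))"

fun run :: "prog \<Rightarrow> state \<Rightarrow> state" where
  "run Nop s = s"
| "run (Assign x a b) s = s(x := (s x)(aval a s := aval b s))"
| "run (Then p q) s = run q (run p s)"
| "run (Cond b p q) s = (if aval b s \<noteq> 0 then run p s else run q s)"
| "run (For i r p) s = iter (run p) i (s r 0) s"

abbreviation loop_guard :: "nat \<Rightarrow> nat \<Rightarrow> aexp" where
  "loop_guard i r \<equiv> Minus (reg r) (reg i)"

fun compile :: "prog \<Rightarrow> com" where
  "compile Nop = Skip"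
| "compile (Assign x a b) = Write x a b"
| "compile (Then p q) = Seq (compile p) (compile q)"
| "compile (Cond b p q) = If b (compile p) (compile q)"
| "compile (For i r p) = Seq (Write i (Const 0) (Const 0))
     (While (loop_guard i r) (Seq (compile p) (Write i (Const 0) (Plus (reg i) (Const 1)))))"

fun assigned :: "prog \<Rightarrow> nat set" where
  "assigned Nop = {}"
| "assigned (Assign x a b) = {x}"
| "assigned (Then p q) = assigned p \<union> assigned q"
| "assigned (Cond b p q) = assigned p \<union> assigned q"
| "assigned (For i r p) = insert i (assigned p)"

fun bounds :: "prog \<Rightarrow> nat set" where
  "bounds Nop = {}"
| "bounds (Assign x a b) = {}"
| "bounds (Then p q) = bounds p \<union> bounds q"
| "bounds (Cond b p q) = bounds p \<union> bounds q"
| "bounds (For i r p) = insert r (bounds p)"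

text \<open>Products may stand in subtrahends, as in \<open>mod_exp\<close>, in divisors, addresses
  and conditions, but are never themselves the stored value.\<close>

fun slow :: "aexp \<Rightarrow> bool" where
  "slow (Const c) \<longleftrightarrow> c \<le> 1"
| "slow (Read x a) \<longleftrightarrow> True"
| "slow (Plus (Read x a) (Const c)) \<longleftrightarrow> c \<le> 1"
| "slow (Plus a b) \<longleftrightarrow> False"
| "slow (Minus a b) \<longleftrightarrow> slow a"
| "slow (Times a b) \<longleftrightarrow> False"
| "slow (Quot a b) \<longleftrightarrow> slow a"

fun well_formed :: "prog \<Rightarrow> bool" where
  "well_formed Nop \<longleftrightarrow> True"
| "well_formed (Assign x a b) \<longleftrightarrow> slow b"
| "well_formed (Then p q) \<longleftrightarrow> well_formed p \<and> well_formed q"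
| "well_formed (Cond b p q) \<longleftrightarrow> well_formed p \<and> well_formed q"
| "well_formed (For i r p) \<longleftrightarrow> i \<notin> assigned p \<and> well_formed p"

text \<open>Bounds the assignments that may raise the largest value in memory, if all loop bounds
  are at most \<open>m\<close>. The \<open>+ 1\<close> is the increment of a counter; its reset to 0
  raises nothing.\<close>

fun writes :: "prog \<Rightarrow> nat \<Rightarrow> nat" where
  "writes Nop m = 0"
| "writes (Assign x a b) m = 1"
| "writes (Then p q) m = writes p m + writes q m"
| "writes (Cond b p q) m = writes p m + writes q m"
| "writes (For i r p) m = m * (writes p m + 1)"

fun run_time :: "prog \<Rightarrow> nat \<Rightarrow> nat \<Rightarrow> nat" where
  "run_time Nop m L = 1"
| "run_time (Assign x a b) m L = (charge a + charge b) * L\<^sup>2"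
| "run_time (Then p q) m L = run_time p m L + run_time q m L"
| "run_time (Cond b p q) m L = charge b * L\<^sup>2 + run_time p m L + run_time q m L"
| "run_time (For i r p) m L = (2 * charge (Const 0) + charge (loop_guard i r)) * L\<^sup>2 +
     m * (run_time p m L + (charge (loop_guard i r) + charge (Const 0) + charge (Plus (reg i) (Const 1))) * L\<^sup>2)"

section \<open>Effect, memory growth and compilation of loop programs\<close>

lemma iter_frame:
  assumes "\<And>s. g s x = s x" "x \<noteq> i"
  shows "iter g i j s x = s x"
  using assms by (induction j) auto

lemma run_frame: "x \<notin> assigned p \<Longrightarrow> run p s x = s x"
  by (induction p arbitrary: s) (auto intro: iter_frame)

lemma iter_counter: "iter g i j s i 0 = j"
  by (cases j) auto

lemma iter_induct [case_names init step]:
  assumes "P 0 (set_reg i 0 s)"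
    and "\<And>j s. j < m \<Longrightarrow> P j s \<Longrightarrow> s i 0 = j \<Longrightarrow> P (Suc j) (set_reg i (Suc j) (g s))"
  shows "P m (iter g i m s)"
proof -
  have "j \<le> m \<Longrightarrow> P j (iter g i j s)" for j
    by (induction j) (use assms iter_counter[of g i _ s] in auto)
  then show ?thesis by simp
qed

lemma slow_le: "bounded s B \<Longrightarrow> slow e \<Longrightarrow> aval e s \<le> Suc B"
proof (induction e)
  case (Plus a b)
  then obtain x e c where "a = Read x e" "b = Const c" "c \<le> 1" by (cases a; cases b) auto
  then show ?case using boundedD[OF Plus.prems(1), of x "aval e s"] by simp
next
  case (Minus a b)
  then show ?case using diff_le_self[of "aval a s" "aval b s"] by simp
next
  case (Quot a b)
  then show ?case using le_trans[OF div_le_dividend[of "aval a s" "aval b s"]] by simp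
qed (use boundedD[of s B] in \<open>auto intro: le_SucI\<close>)

lemma bounded_set_reg: "bounded s B \<Longrightarrow> v \<le> B \<Longrightarrow> bounded (set_reg i v s) B"
  by (simp add: bounded_def)

text \<open>Stored values are \<open>slow\<close>, so each assignment raises the bound by at most 1,
  and the registers that hold loop bounds keep their values throughout.\<close>

lemma run_bounded:
  assumes "well_formed p" "bounds p \<inter> assigned p = {}" "bounded s B" "\<forall>r\<in>bounds p. s r 0 \<le> m"
  shows "bounded (run p s) (B + writes p m)"
  using assms
proof (induction p arbitrary: s B)
  case (Assign x a b)
  then show ?case using slow_le[of s B b] by (auto simp: bounded_def intro: le_SucI)
next
  case (Then p q)
  have "bounded (run p s) (B + writes p m)"
    by (rule Then.IH(1)) (use Then.prems in auto)
  moreover have "\<forall>r\<in>bounds q. run p s r 0 \<le> m"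
    using run_frame[of _ p s] Then.prems by (auto simp: disjoint_iff)
  ultimately have "bounded (run q (run p s)) (B + writes p m + writes q m)"
    by (intro Then.IH(2)) (use Then.prems in auto)
  then show ?case by (simp add: add.assoc)
next
  case (Cond b p q)
  have "bounded (run p s) (B + writes p m)" "bounded (run q s) (B + writes q m)"
    by (rule Cond.IH; use Cond.prems in auto)+
  then show ?case by (auto elim: bounded_mono)
next
  case (For i r p)
  have "bounded (iter (run p) i j s) (B + j * (writes p m + 1))" if "j \<le> s r 0" for j
    using that
  proof (induction j)
    case 0
    show ?case unfolding iter.simps mult_0 add_0_right by (rule bounded_set_reg[OF For.prems(3)]) simp
  next
    case (Suc j)
    have "\<forall>r'\<in>bounds p. iter (run p) i j s r' 0 \<le> m"
    proof
      fix r' assume r': "r' \<in> bounds p"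
      then have "r' \<notin> assigned p" "r' \<noteq> i" using For.prems(2) by auto
      then have "iter (run p) i j s r' = s r'"
        by (intro iter_frame run_frame)
      then show "iter (run p) i j s r' 0 \<le> m" using For.prems(4) r' by simp
    qed
    then have "bounded (run p (iter (run p) i j s)) (B + j * (writes p m + 1) + writes p m)"
      by (intro For.IH) (use Suc For.prems in auto)
    then have "bounded (run p (iter (run p) i j s)) (B + Suc j * (writes p m + 1))"
      by (rule bounded_mono) simp
    then show ?case unfolding iter.simps by (rule bounded_set_reg) simp
  qed
  moreover have nm: "s r 0 \<le> m" using For.prems(4) by simp
  ultimately have "bounded (run (For i r p) s) (B + s r 0 * (writes p m + 1))" by (simp only: run.simps)
  then show ?case
    by (rule bounded_mono) (simp only: writes.simps add_le_cancel_left mult_le_mono1 nm)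
qed auto

text \<open>\<open>B'\<close> bounds every value that occurs during the run, so the single length
  \<open>len B'\<close> prices all operations.\<close>

lemma compile_exec:
  assumes "well_formed p" "bounds p \<inter> assigned p = {}" "bounded s B" "\<forall>r\<in>bounds p. s r 0 \<le> m"
    and "B + writes p m \<le> B'"
  shows "\<exists>t. exec (compile p) s t (run p s) \<and> t \<le> run_time p m (len B')"
  using assms
proof (induction p arbitrary: s B)
  case Nop
  then show ?case using exec.Skip by auto
next
  case (Assign x a b)
  have "bounded s B'" using Assign.prems by (auto elim: bounded_mono)
  from charge_le[OF this, of a] charge_le[OF this, of b] show ?case
    using exec.Write[of x a b s] unfolding compile.simps run.simps run_time.simps
    by (intro exI conjI) (assumption, simp add: algebra_simps)
next
  case (Then p q)
  obtain t where t: "exec (compile p) s t (run p s)" "t \<le> run_time p m (len B')"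
    using Then.IH(1)[of s B] Then.prems by auto
  have "bounded (run p s) (B + writes p m)"
    by (rule run_bounded) (use Then.prems in auto)
  moreover have "\<forall>r\<in>bounds q. run p s r 0 \<le> m"
    using run_frame[of _ p s] Then.prems by (auto simp: disjoint_iff)
  ultimately obtain u where u: "exec (compile q) (run p s) u (run q (run p s))" "u \<le> run_time q m (len B')"
    using Then.IH(2)[of "run p s" "B + writes p m"] Then.prems by (auto simp: add.assoc)
  show ?case using exec.Seq[OF t(1) u(1)] t(2) u(2) by (intro exI[of _ "t + u"]) simp
next
  case (Cond b p q)
  have "bounded s B'" using Cond.prems by (auto elim: bounded_mono)
  note c = charge_le[OF this, of b]
  show ?case
  proof (cases "aval b s = 0")
    case True
    obtain t where t: "exec (compile q) s t (run q s)" "t \<le> run_time q m (len B')"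
      using Cond.IH(2)[of s B] Cond.prems by auto
    show ?thesis using exec.IfFalse[OF True t(1), of "compile p"] t(2) c True
      by (intro exI[of _ "acost b s + len (aval b s) + t"]) auto
  next
    case False
    obtain t where t: "exec (compile p) s t (run p s)" "t \<le> run_time p m (len B')"
      using Cond.IH(1)[of s B] Cond.prems by auto
    show ?thesis using exec.IfTrue[OF False t(1), of "compile q"] t(2) c False
      by (intro exI[of _ "acost b s + len (aval b s) + t"]) auto
  qed
next
  case (For i r p)
  let ?n = "s r 0" and ?st = "\<lambda>j. iter (run p) i j s"
  let ?L = "len B'"
  let ?g = "loop_guard i r" and ?inc = "Write i (Const 0) (Plus (reg i) (Const 1))"
  let ?W = "While ?g (Seq (compile p) ?inc)"
  let ?one = "run_time p m ?L + (charge ?g + charge (Const 0) + charge (Plus (reg i) (Const 1))) * ?L\<^sup>2"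
  have fr: "?st j x = s x" if "x \<notin> assigned p" "x \<noteq> i" for j x
    using that by (intro iter_frame run_frame)
  have str: "?st j r 0 = ?n" for j using fr[of r j] For.prems by auto
  have nm: "?n \<le> m" using For.prems by auto
  have fb: "\<forall>r'\<in>bounds p. ?st j r' 0 \<le> m" for j
  proof
    fix r' assume r': "r' \<in> bounds p"
    have "r' \<notin> assigned p" "r' \<noteq> i" using For.prems(2) r' by auto
    then show "?st j r' 0 \<le> m" using fr[of r' j] For.prems(4) r' by simp
  qed
  have bd: "bounded (?st j) (B + j * (writes p m + 1))" if "j \<le> ?n" for j
  proof -
    have "bounded (run p (?st j')) (b + writes p m)" if "bounded (?st j') b" for j' b
      by (rule run_bounded[OF _ _ that]) (use For.prems fb in auto)
    note step = this
    show ?thesis using that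
    proof (induction j)
      case 0
      show ?case unfolding iter.simps mult_0 add_0_right by (rule bounded_set_reg[OF For.prems(3)]) simp
    next
      case (Suc j)
      then have "bounded (run p (?st j)) (B + j * (writes p m + 1) + writes p m)" by (intro step) simp
      then have "bounded (run p (?st j)) (B + Suc j * (writes p m + 1))"
        by (rule bounded_mono) simp
      then show ?case unfolding iter.simps by (rule bounded_set_reg) simp
    qed
  qed
  have cap: "B + j * (writes p m + 1) \<le> B'" if "j \<le> ?n" for j
  proof -
    have "j * (writes p m + 1) \<le> m * (writes p m + 1)" using that nm by (intro mult_le_mono) auto
    then show ?thesis using For.prems(5) by simp
  qed
  have bd': "bounded (?st j) B'" if "j \<le> ?n" for j
    using bounded_mono[OF bd cap] that by blast
  \<comment> \<open>Induction on the number \<open>d\<close> of rounds still to come, because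
    \<open>exec\<close> unfolds a loop from its first test.\<close>
  have loop: "\<exists>t. exec ?W (?st (?n - d)) t (?st ?n) \<and> t \<le> charge ?g * ?L\<^sup>2 + d * ?one" if "d \<le> ?n" for d
    using that
  proof (induction d)
    case 0
    have z: "aval ?g (?st ?n) = 0" using str[of ?n] iter_counter[of "run p" i ?n s] by simp
    show ?case using exec.WhileFalse[OF z] charge_le[OF bd'[of ?n], of ?g]
      by (intro exI[of _ "acost ?g (?st ?n) + len (aval ?g (?st ?n))"]) simp
  next
    case (Suc d)
    define j where "j = ?n - Suc d"
    have j: "j < ?n" "?n - d = Suc j" using Suc.prems by (auto simp: j_def)
    have nz: "aval ?g (?st j) \<noteq> 0" using str[of j] iter_counter[of "run p" i j s] j by simp
    have capj: "B + j * (writes p m + 1) + writes p m \<le> B'" using cap[of "Suc j"] j by simp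
    obtain t where t: "exec (compile p) (?st j) t (run p (?st j))" "t \<le> run_time p m ?L"
      using For.IH[OF _ _ bd[of j] fb capj] For.prems(1,2) j by auto
    have cj: "run p (?st j) i 0 = j"
      using run_frame[of i p "?st j"] iter_counter[of "run p" i j s] For.prems by simp
    have eq: "(run p (?st j))(i := (run p (?st j) i)
        (aval (Const 0) (run p (?st j)) := aval (Plus (reg i) (Const 1)) (run p (?st j)))) = ?st (Suc j)"
      using cj by simp
    have "bounded (run p (?st j)) (B + j * (writes p m + 1) + writes p m)"
      by (rule run_bounded) (use For.prems(1,2) fb bd[of j] j in auto)
    then have br: "bounded (run p (?st j)) B'" using capj by (rule bounded_mono)
    obtain u where u: "exec ?inc (run p (?st j)) u (?st (Suc j))"
      "u \<le> (charge (Const 0) + charge (Plus (reg i) (Const 1))) * ?L\<^sup>2"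
      using exec.Write[of i "Const 0" "Plus (reg i) (Const 1)" "run p (?st j)", unfolded eq]
        charge_le[OF br, of "Const 0"] charge_le[OF br, of "Plus (reg i) (Const 1)"]
      by (auto simp: algebra_simps simp del: acost.simps aval.simps iter.simps intro!: that)
    have "d \<le> ?n" using Suc.prems by simp
    from Suc.IH[OF this, unfolded j(2)]
    obtain w where w: "exec ?W (?st (Suc j)) w (?st ?n)" "w \<le> charge ?g * ?L\<^sup>2 + d * ?one"
      by blast
    have "exec ?W (?st j) (acost ?g (?st j) + len (aval ?g (?st j)) + (t + u) + w) (?st ?n)"
      by (rule exec.WhileTrue[OF nz exec.Seq[OF t(1) u(1)] w(1)])
    moreover have "acost ?g (?st j) + len (aval ?g (?st j)) \<le> charge ?g * ?L\<^sup>2"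
      using charge_le[OF bd'[of j], of ?g] j by simp
    ultimately show ?case
      unfolding j_def[symmetric] using t(2) u(2) w(2)
      by (intro exI conjI) (assumption, simp add: algebra_simps)
  qed
  obtain t where t: "exec ?W (?st 0) t (?st ?n)" "t \<le> charge ?g * ?L\<^sup>2 + ?n * ?one"
    using loop[of ?n] by auto
  have "bounded s B'" using For.prems by (auto elim: bounded_mono)
  note c = charge_le[OF this, of "Const 0"]
  have "exec (Write i (Const 0) (Const 0)) s (acost (Const 0) s + acost (Const 0) s +
      len (aval (Const 0) s) + len (aval (Const 0) s)) (?st 0)"
    using exec.Write[of i "Const 0" "Const 0" s] by simp
  from exec.Seq[OF this t(1)] have "exec (compile (For i r p)) s (acost (Const 0) s + acost (Const 0) s +
      len (aval (Const 0) s) + len (aval (Const 0) s) + t) (run (For i r p) s)" by simp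
  moreover have "?n * ?one \<le> m * ?one" using nm by (intro mult_le_mono) auto
  ultimately show ?case
    using t(2) c unfolding run_time.simps
    by (intro exI conjI) (assumption, simp add: algebra_simps)
qed

text \<open>\<open>N\<close> is a variant and a budget at once: it bounds the rounds,
  \<open>Suc N\<close> bounds the tests of the guard, and \<open>N * writes p m\<close> the growth
  of the values.\<close>

lemma while_exec:
  assumes wf: "well_formed p" "bounds p \<inter> assigned p = {}"
    and step: "\<And>s N. I s N \<Longrightarrow> aval b s \<noteq> 0 \<Longrightarrow> \<exists>N'<N. I (run p s) N'"
    and "I s N" "bounded s B" "\<forall>r\<in>bounds p. s r 0 \<le> m" "B + N * writes p m \<le> B'"
  shows "\<exists>t s' N'. exec (While b (compile p)) s t s' \<and> I s' N' \<and> aval b s' = 0 \<and> bounded s' B' \<and>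
    t \<le> Suc N * (charge b * (len B')\<^sup>2 + run_time p m (len B'))"
  using assms(4-)
proof (induction N arbitrary: s B rule: less_induct)
  case (less N)
  have c: "acost b s + len (aval b s) \<le> charge b * (len B')\<^sup>2"
    by (rule charge_le[OF bounded_mono[OF less.prems(2)]]) (use less.prems(4) in simp)
  show ?case
  proof (cases "aval b s = 0")
    case True
    have "bounded s B'" by (rule bounded_mono[OF less.prems(2)]) (use less.prems(4) in simp)
    then show ?thesis
      using exec.WhileFalse[OF True] less.prems(1) True c
      by (intro exI[of _ "acost b s + len (aval b s)"] exI[of _ s] exI[of _ N]) auto
  next
    case False
    obtain N' where N': "N' < N" "I (run p s) N'" using step[OF less.prems(1) False] by blast
    have "Suc N' * writes p m \<le> N * writes p m" using N' by (intro mult_le_mono) auto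
    then have cap: "B + writes p m + N' * writes p m \<le> B'" using less.prems(4) by simp
    obtain t where t: "exec (compile p) s t (run p s)" "t \<le> run_time p m (len B')"
      using compile_exec[OF wf less.prems(2,3)] cap by (meson add_leD1)
    have "\<forall>r\<in>bounds p. run p s r 0 \<le> m"
      using run_frame[of _ p s] wf less.prems(3) by (auto simp: disjoint_iff)
    then obtain u s' N'' where u: "exec (While b (compile p)) (run p s) u s'" "I s' N''" "aval b s' = 0"
      "bounded s' B'" "u \<le> Suc N' * (charge b * (len B')\<^sup>2 + run_time p m (len B'))"
      using less.IH[OF N' run_bounded[OF wf less.prems(2,3)] _ cap] by blast
    have "Suc (Suc N') * (charge b * (len B')\<^sup>2 + run_time p m (len B')) \<le>
        Suc N * (charge b * (len B')\<^sup>2 + run_time p m (len B'))"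
      using N' by (intro mult_le_mono) auto
    then have "acost b s + len (aval b s) + t + u \<le> Suc N * (charge b * (len B')\<^sup>2 + run_time p m (len B'))"
      using c t(2) u(5) by simp
    then show ?thesis using exec.WhileTrue[OF False t(1) u(1)] u by blast
  qed
qed

section \<open>Polynomial bounds read off from the syntax\<close>

text \<open>Constant and degree depend on the program text only. The base \<open>m + 1\<close> is
  positive, so exponents may be enlarged freely when two bounds are added.\<close>

lemma writes_polynomial: "\<exists>C d. \<forall>m. writes p m \<le> C * (m + 1) ^ d"
proof (induction p)
  case Nop
  show ?case by (rule exI[of _ 0]) simp
next
  case (Assign x a b)
  show ?case by (rule exI[of _ 1], rule exI[of _ 0]) simp
next
  case (For i r p)
  then obtain C d where C: "\<And>m. writes p m \<le> C * (m + 1) ^ d" by blast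
  have "writes (For i r p) m \<le> (C + 1) * (m + 1) ^ Suc d" for m
  proof -
    have "m * (writes p m + 1) \<le> (m + 1) * (C * (m + 1) ^ d + 1 * (m + 1) ^ d)"
      using C[of m] by (intro mult_le_mono add_le_mono) auto
    then show ?thesis by (simp add: algebra_simps)
  qed
  then show ?case by blast
next
  have two: "\<exists>C d. \<forall>m. f m + g m \<le> C * (m + 1) ^ d"
    if f: "\<exists>C d. \<forall>m. f m \<le> C * (m + 1) ^ d" and g: "\<exists>C d. \<forall>m. g m \<le> C * (m + 1) ^ d"
    for f g :: "nat \<Rightarrow> nat"
  proof -
    obtain C d C' d' where C: "\<And>m. f m \<le> C * (m + 1) ^ d" "\<And>m. g m \<le> C' * (m + 1) ^ d'"
      using f g by blast
    have "f m + g m \<le> (C + C') * (m + 1) ^ (d + d')" for m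
    proof -
      have "f m + g m \<le> C * (m + 1) ^ d + C' * (m + 1) ^ d'" using C[of m] by simp
      also have "\<dots> \<le> C * (m + 1) ^ (d + d') + C' * (m + 1) ^ (d + d')"
        by (intro add_le_mono mult_le_mono power_increasing) auto
      finally show ?thesis by (simp add: algebra_simps)
    qed
    then show ?thesis by blast
  qed
  {
    case (Then p q)
    then show ?case using two by simp
  next
    case (Cond b p q)
    then show ?case using two by simp
  }
qed

lemma run_time_polynomial: "\<exists>C d. \<forall>m L. 1 \<le> L \<longrightarrow> run_time p m L \<le> C * (m + 1) ^ d * L\<^sup>2"
proof (induction p)
  case Nop
  show ?case by (rule exI[of _ 1], rule exI[of _ 0]) auto
next
  case (Assign x a b)
  show ?case by (rule exI[of _ "charge a + charge b"], rule exI[of _ 0]) auto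
next
  have two: "C * (m + 1) ^ d * L + C' * (m + 1) ^ d' * L \<le> (C + C') * (m + 1) ^ (d + d') * L"
    for C C' d d' m L :: nat
  proof -
    have "C * (m + 1) ^ d + C' * (m + 1) ^ d' \<le> C * (m + 1) ^ (d + d') + C' * (m + 1) ^ (d + d')"
      by (intro add_le_mono mult_le_mono power_increasing) auto
    also have "\<dots> = (C + C') * (m + 1) ^ (d + d')" by (simp add: algebra_simps)
    finally show ?thesis unfolding distrib_right[symmetric] by (rule mult_le_mono1)
  qed
  {
    case (Then p q)
    then obtain C d C' d' where
      "\<And>m L. 1 \<le> L \<Longrightarrow> run_time p m L \<le> C * (m + 1) ^ d * L\<^sup>2"
      "\<And>m L. 1 \<le> L \<Longrightarrow> run_time q m L \<le> C' * (m + 1) ^ d' * L\<^sup>2" by blast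
    then have "\<forall>m L. 1 \<le> L \<longrightarrow> run_time (Then p q) m L \<le> (C + C') * (m + 1) ^ (d + d') * L\<^sup>2"
      using order_trans[OF add_le_mono two] by simp
    then show ?case by blast
  next
    case (Cond b p q)
    then obtain C d C' d' where C:
      "\<And>m L. 1 \<le> L \<Longrightarrow> run_time p m L \<le> C * (m + 1) ^ d * L\<^sup>2"
      "\<And>m L. 1 \<le> L \<Longrightarrow> run_time q m L \<le> C' * (m + 1) ^ d' * L\<^sup>2" by blast
    have "run_time (Cond b p q) m L \<le> (charge b + (C + C')) * (m + 1) ^ (0 + (d + d')) * L\<^sup>2"
      if "1 \<le> L" for m L
    proof -
      have "run_time p m L + run_time q m L \<le> (C + C') * (m + 1) ^ (d + d') * L\<^sup>2"
        by (rule order_trans[OF add_le_mono[OF C(1)[OF that] C(2)[OF that]] two])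
      then show ?thesis
        using two[of "charge b" m 0 "L\<^sup>2" "C + C'" "d + d'"] by simp
    qed
    then show ?case by blast
  next
    case (For i r p)
    then obtain C d where C: "\<And>m L. 1 \<le> L \<Longrightarrow> run_time p m L \<le> C * (m + 1) ^ d * L\<^sup>2" by blast
    define A where "A = 2 * charge (Const 0) + charge (loop_guard i r)"
    define D where "D = charge (loop_guard i r) + charge (Const 0) + charge (Plus (reg i) (Const 1))"
    have "run_time (For i r p) m L \<le> (A + (C + D)) * (m + 1) ^ (0 + (Suc d)) * L\<^sup>2" if "1 \<le> L" for m L
    proof -
      have "m * (run_time p m L + D * L\<^sup>2) \<le> (m + 1) * (C * (m + 1) ^ d * L\<^sup>2 + D * (m + 1) ^ d * L\<^sup>2)"
        using C[OF that, of m] by (intro mult_le_mono add_le_mono) auto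
      also have "\<dots> = (C + D) * (m + 1) ^ Suc d * L\<^sup>2" by (simp add: algebra_simps)
      finally show ?thesis
        using two[of A m 0 "L\<^sup>2" "C + D" "Suc d"] by (simp add: A_def D_def)
    qed
    then show ?case by blast
  }
qed

section \<open>The program\<close>

definition not_exp :: "aexp \<Rightarrow> aexp" where
  "not_exp e = Minus (Const 1) e"

text \<open>One of the two truncated differences is always 0, and their sum is 0 only for equal
  values.\<close>

definition eq_exp :: "aexp \<Rightarrow> aexp \<Rightarrow> aexp" where
  "eq_exp e f = not_exp (Plus (Minus e f) (Minus f e))"

definition mod_exp :: "aexp \<Rightarrow> aexp \<Rightarrow> aexp" where
  "mod_exp e f = Minus e (Times (Quot e f) f)"

lemma aval_not_exp [simp]: "aval (not_exp e) s = of_bool (aval e s = 0)"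
  by (simp add: not_exp_def)

lemma aval_eq_exp [simp]: "aval (eq_exp e f) s = of_bool (aval e s = aval f s)"
  by (auto simp: eq_exp_def)

lemma aval_mod_exp [simp]: "aval (mod_exp e f) s = aval e s mod aval f s"
  by (simp add: mod_exp_def minus_div_mult_eq_mod)

text \<open>
  Registers: 2 \<open>n\<close>, 3 \<open>k\<close>, 4 height of the stack, 6 \<open>n * n\<close>, 7 size of a stack frame, 8 answer,
  10--12 the vertices \<open>v\<close>, \<open>a\<close>, \<open>b\<close> of a branching step, 14 result of the connectivity test,
  15 the restricted leaf, 16--18 loop counters.
  Arrays: 5 stack, 9 current configuration, 13 vertices reached.
  A configuration is stored as the matrix of \<open>H\<close>, followed by the characteristic vector of \<open>X\<close>, by \<open>i\<close>,
  and by \<open>q\<close>, where \<open>n\<close> stands for \<open>None\<close>.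
\<close>

abbreviation mark_addr :: "aexp \<Rightarrow> aexp" where
  "mark_addr e \<equiv> Plus (reg 6) e"

abbreviation count_addr :: aexp where
  "count_addr \<equiv> Plus (reg 6) (reg 2)"

abbreviation leaf_addr :: aexp where
  "leaf_addr \<equiv> Plus (Plus (reg 6) (reg 2)) (Const 1)"

abbreviation edge_addr :: "nat \<Rightarrow> nat \<Rightarrow> aexp" where
  "edge_addr u v \<equiv> Plus (Times (reg u) (reg 2)) (reg v)"

abbreviation frame_addr :: aexp where
  "frame_addr \<equiv> Plus (Times (reg 4) (reg 7)) (reg 17)"

definition push :: prog where
  "push = Then (For 17 7 (Assign 5 frame_addr (Read 9 (reg 17)))) (Assign 4 (Const 0) (Plus (reg 4) (Const 1)))"

definition pop :: prog where
  "pop = Then (Assign 4 (Const 0) (Minus (reg 4) (Const 1))) (For 17 7 (Assign 9 (reg 17) (Read 5 frame_addr)))"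

definition set_edge :: "nat \<Rightarrow> nat \<Rightarrow> nat \<Rightarrow> prog" where
  "set_edge u v b = Then (Assign 9 (edge_addr u v) (Const b)) (Assign 9 (edge_addr v u) (Const b))"

definition set_mark :: "nat \<Rightarrow> nat \<Rightarrow> prog" where
  "set_mark v b = Assign 9 (mark_addr (reg v)) (Const b)"

definition set_leaf :: "nat \<Rightarrow> prog" where
  "set_leaf v = Assign 9 leaf_addr (reg v)"

text \<open>Position \<open>z\<close> of the matrix is the ordered pair of \<open>z div n\<close>
  and \<open>z mod n\<close>, so one loop visits all pairs. The value \<open>n\<close> in register
  10 means that no pair was found. Products of tests are conjunctions, the sum is a
  disjunction.\<close>

definition find_edge :: prog where
  "find_edge = Then (Assign 10 (Const 0) (reg 2))
     (For 17 6 (Cond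
       (Times (Times (Read 9 (reg 17)) (Read 9 (mark_addr (Quot (reg 17) (reg 2)))))
         (Times (not_exp (Read 9 (mark_addr (mod_exp (reg 17) (reg 2)))))
           (Plus (eq_exp (Read 9 leaf_addr) (reg 2)) (eq_exp (Read 9 leaf_addr) (Quot (reg 17) (reg 2))))))
       (Then (Assign 10 (Const 0) (Quot (reg 17) (reg 2))) (Assign 11 (Const 0) (mod_exp (reg 17) (reg 2))))
       Nop))"

definition find_second :: prog where
  "find_second = Then (Assign 12 (Const 0) (reg 2))
     (For 16 2 (Cond
       (Times (Times (Read 9 (edge_addr 10 16)) (not_exp (Read 9 (mark_addr (reg 16)))))
         (not_exp (eq_exp (reg 16) (reg 11))))
       (Assign 12 (Const 0) (reg 16))
       Nop))"

definition sweep :: prog where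
  "sweep = For 17 6 (Cond (Times (Read 9 (reg 17)) (Read 13 (Quot (reg 17) (reg 2))))
     (Assign 13 (mod_exp (reg 17) (reg 2)) (Const 1)) Nop)"

text \<open>The number of sweeps is the trivial bound \<open>n * n\<close> on the size of the
  adjacency relation, which register 6 holds.\<close>

definition test_connected :: prog where
  "test_connected =
     Then (For 16 2 (Assign 13 (reg 16) (Const 0)))
    (Then (Assign 13 (Const 0) (Const 1))
    (Then (For 18 6 sweep)
    (Then (Assign 14 (Const 0) (Const 1))
          (For 16 2 (Cond (Read 13 (reg 16)) Nop (Assign 14 (Const 0) (Const 0)))))))"

definition expand_one :: prog where
  "expand_one = Then (set_mark 11 1) (Then (set_leaf 2) push)"

text \<open>One working copy is edited in place, and edges and marks are put back after a push. The
  old leaf is saved in register 15 before it is overwritten. The connectivity test runs while the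
  copy holds \<open>H - {{v, a}}\<close>.\<close>

definition expand_two :: prog where
  "expand_two =
     Then (Assign 15 (Const 0) (Read 9 leaf_addr))
    (Then (set_leaf 2)
    (Then (set_edge 10 12 0)
    (Then (set_mark 11 1)
    (Then push
    (Then (set_edge 10 12 1)
    (Then (set_mark 11 0)
    (Then (set_edge 10 11 0)
    (Then (set_mark 12 1)
    (Cond (Minus (reg 2) (reg 15))
       push
      (Then test_connected
      (Cond (reg 14)
        (Then push (Then (set_edge 10 11 1) (Then (set_mark 11 1) (Then (set_leaf 11) push))))
        (Then (set_edge 10 11 1) (Then (set_mark 11 1) push)))))))))))))"

text \<open>A success only sets the answer; the search goes on until the stack is empty, as the time
  bound covers the whole search tree.\<close>

definition step :: prog where
  "step = Then pop (Cond (Minus (reg 3) (Read 9 count_addr))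
     (Then find_edge (Cond (Minus (reg 2) (reg 10))
       (Then find_second (Then (Assign 9 count_addr (Plus (Read 9 count_addr) (Const 1)))
         (Cond (Minus (reg 2) (reg 12)) expand_two expand_one)))
       Nop))
     (Assign 8 (Const 0) (Const 1)))"

definition start :: prog where
  "start = Then (set_mark 16 1) (Then push (set_mark 16 0))"

text \<open>The test result is multiplied by \<open>n\<close> because the empty graph passes the
  test but is not connected. For \<open>k = 0\<close> the answer is set at once, since a graph with
  one vertex has no edge to start from.\<close>

definition init :: prog where
  "init =
     Then (For 17 6 (Assign 9 (reg 17) (Read 1 (reg 17))))
    (Then (For 16 2 (Assign 9 (mark_addr (reg 16)) (Const 0)))
    (Then (Assign 9 count_addr (Const 0))
    (Then (set_leaf 2)
    (Then test_connected
    (Cond (Times (reg 2) (reg 14))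
      (Then (Cond (reg 3) Nop (Assign 8 (Const 0) (Const 1)))
      (Then (Assign 9 (mark_addr (Const 0)) (Const 1))
        (For 16 2 (Cond (Read 9 (reg 16)) start Nop))))
      Nop)))))"

lemmas prog_defs = push_def pop_def set_edge_def set_mark_def set_leaf_def find_edge_def find_second_def
  sweep_def test_connected_def expand_one_def expand_two_def step_def start_def init_def

lemma assigned_simps [simp]:
  "assigned push = {4, 5, 17}" "assigned pop = {4, 9, 17}" "assigned (set_edge u v b) = {9}"
  "assigned (set_mark v b) = {9}" "assigned (set_leaf v) = {9}" "assigned find_edge = {10, 11, 17}"
  "assigned find_second = {12, 16}" "assigned sweep = {13, 17}"
  "assigned test_connected = {13, 14, 16, 17, 18}"
  by (auto simp: prog_defs)

text \<open>The loop bounds are \<open>n\<close>, \<open>n * n\<close> and the frame size. All are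
  at most \<open>n * n + n + 2\<close>, which therefore serves as \<open>m\<close>.\<close>

lemma step_syntax: "well_formed step" "bounds step \<inter> assigned step = {}" "bounds step \<subseteq> {2, 6, 7}"
  by (simp_all add: prog_defs not_exp_def eq_exp_def mod_exp_def)

lemma init_syntax: "well_formed init" "bounds init \<inter> assigned init = {}" "bounds init \<subseteq> {2, 6, 7}"
  by (simp_all add: prog_defs not_exp_def eq_exp_def mod_exp_def)

section \<open>Configurations and the stack in memory\<close>

definition matrix_rep :: "nat \<Rightarrow> (nat \<Rightarrow> nat) \<Rightarrow> nat set set \<Rightarrow> bool" where
  "matrix_rep n w H \<longleftrightarrow> (\<forall>x<n. \<forall>y<n. w (x * n + y) \<noteq> 0 \<longleftrightarrow> {x, y} \<in> H)"

text \<open>The condition \<open>v < n\<close> keeps the code of a leaf apart from the code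
  \<open>n\<close> of \<open>None\<close>.\<close>

fun config_rep :: "nat \<Rightarrow> (nat \<Rightarrow> nat) \<Rightarrow> nat config \<Rightarrow> bool" where
  "config_rep n w (H, X, i, q) \<longleftrightarrow> matrix_rep n w H \<and> (\<forall>x<n. w (n * n + x) \<noteq> 0 \<longleftrightarrow> x \<in> X) \<and>
     w (n * n + n) = i \<and> w (n * n + n + 1) = (case q of None \<Rightarrow> n | Some v \<Rightarrow> v) \<and>
     (\<forall>v. q = Some v \<longrightarrow> v < n)"

lemma cell_bound: "x < n \<Longrightarrow> y < n \<Longrightarrow> x * n + y < n * (n::nat)"
proof -
  assume a: "x < n" "y < n"
  have "x * n + y < Suc x * n" using a by simp
  also have "\<dots> \<le> n * n" using a by (intro mult_le_mono) auto
  finally show ?thesis .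
qed

lemma cell_inj: "y < n \<Longrightarrow> y' < n \<Longrightarrow> x * n + y = x' * n + (y'::nat) \<longleftrightarrow> x = x' \<and> y = y'"
proof
  assume a: "y < n" "y' < n" and e: "x * n + y = x' * n + y'"
  have "(x * n + y) div n = x" "(x' * n + y') div n = x'" "(x * n + y) mod n = y" "(x' * n + y') mod n = y'"
    using a by auto
  then show "x = x' \<and> y = y'" using e by metis
qed auto

lemma config_rep_cong:
  assumes "config_rep n w c" "\<And>z. z < n * n + n + 2 \<Longrightarrow> w' z = w z"
  shows "config_rep n w' c"
proof -
  obtain H X i q where c: "c = (H, X, i, q)" by (cases c)
  have "w' (x * n + y) = w (x * n + y)" if "x < n" "y < n" for x y
    using assms(2) cell_bound[OF that] by simp
  then show ?thesis using assms unfolding c by (simp add: matrix_rep_def)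
qed

text \<open>The head of the list is the topmost frame, hence \<open>rev\<close>. Cells above the
  height are unspecified, so popping need not clear them.\<close>

definition stack_rep :: "nat \<Rightarrow> state \<Rightarrow> nat config list \<Rightarrow> bool" where
  "stack_rep n s cs \<longleftrightarrow> s 4 0 = length cs \<and>
     (\<forall>j<length cs. config_rep n (\<lambda>z. s 5 (j * (n * n + n + 2) + z)) (rev cs ! j))"

definition regs :: "nat \<Rightarrow> nat \<Rightarrow> state \<Rightarrow> bool" where
  "regs n k s \<longleftrightarrow> s 2 0 = n \<and> s 3 0 = k \<and> s 6 0 = n * n \<and> s 7 0 = n * n + n + 2"

lemma regs_run: "regs n k s \<Longrightarrow> {2, 3, 6, 7} \<inter> assigned p = {} \<Longrightarrow> regs n k (run p s)"
  by (simp add: regs_def run_frame)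

lemma push_spec:
  assumes r: "regs n k s" and st: "stack_rep n s cs" and c: "config_rep n (s 9) c"
  shows "stack_rep n (run push s) (c # cs)"
proof -
  define M where "M = n * n + n + 2"
  define h where "h = s 4 0"
  have sM: "s 7 0 = M" using r by (simp add: regs_def M_def)
  let ?p = "Assign 5 frame_addr (Read 9 (reg 17))"
  \<comment> \<open>The last clause protects the frames below the new one.\<close>
  define P where "P j t \<longleftrightarrow> (\<forall>x. x \<noteq> 5 \<and> x \<noteq> 17 \<longrightarrow> t x = s x) \<and> (\<forall>z<j. t 5 (h * M + z) = s 9 z) \<and>
    (\<forall>a<h * M. t 5 a = s 5 a)" for j :: nat and t :: state
  have "P M (iter (run ?p) 17 M s)"
    by (rule iter_induct[where P = P]) (auto simp: P_def h_def sM less_Suc_eq)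
  then have P: "P M (run (For 17 7 ?p) s)" using sM by simp
  have s5: "run push s 5 = run (For 17 7 ?p) s 5" and s4: "run push s 4 0 = Suc h"
    using P by (auto simp: push_def P_def h_def)
  have h: "h = length cs" using st by (simp add: stack_rep_def h_def)
  have "config_rep n (\<lambda>z. run push s 5 (j * M + z)) (rev (c # cs) ! j)" if j: "j < length (c # cs)" for j
  proof (cases "j = h")
    case True
    have "config_rep n (\<lambda>z. run push s 5 (h * M + z)) c"
      using c by (rule config_rep_cong) (use P s5 in \<open>auto simp: P_def M_def\<close>)
    then show ?thesis using True h by (simp add: nth_append)
  next
    case False
    then have jh: "j < h" using j h by simp
    have "config_rep n (\<lambda>z. s 5 (j * M + z)) (rev cs ! j)"
      using st jh h by (simp add: stack_rep_def M_def)
    moreover have "run push s 5 (j * M + z) = s 5 (j * M + z)" if "z < M" for z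
    proof -
      have "j * M + z < Suc j * M" using that by simp
      also have "\<dots> \<le> h * M" using jh by (intro mult_le_mono) auto
      finally show ?thesis using P s5 by (simp add: P_def)
    qed
    ultimately have "config_rep n (\<lambda>z. run push s 5 (j * M + z)) (rev cs ! j)"
      by (rule config_rep_cong) (simp add: M_def)
    then show ?thesis using jh h by (simp add: nth_append)
  qed
  then show ?thesis using s4 h by (simp add: stack_rep_def M_def)
qed

lemma pop_spec:
  assumes r: "regs n k s" and st: "stack_rep n s (c # cs)"
  shows "stack_rep n (run pop s) cs" "config_rep n (run pop s 9) c"
proof -
  define M where "M = n * n + n + 2"
  define h where "h = length cs"
  let ?p = "Assign 9 (reg 17) (Read 5 frame_addr)"
  let ?s = "set_reg 4 h s"
  have s4: "s 4 0 = Suc h" using st by (simp add: stack_rep_def h_def)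
  have sM: "?s 7 0 = M" using r by (simp add: regs_def M_def)
  define P where "P j t \<longleftrightarrow> (\<forall>x. x \<noteq> 9 \<and> x \<noteq> 17 \<longrightarrow> t x = ?s x) \<and> (\<forall>z<j. t 9 z = s 5 (h * M + z))"
    for j :: nat and t :: state
  have "P M (iter (run ?p) 17 M ?s)"
    by (rule iter_induct[where P = P]) (use sM in \<open>auto simp: P_def less_Suc_eq\<close>)
  moreover have "run pop s = iter (run ?p) 17 M ?s" using sM s4 by (simp add: pop_def)
  ultimately have P: "P M (run pop s)" by simp
  have top: "config_rep n (\<lambda>z. s 5 (h * M + z)) c"
    using st by (auto simp: stack_rep_def M_def h_def nth_append dest!: spec[of _ "length cs"])
  show "config_rep n (run pop s 9) c"
    using top by (rule config_rep_cong) (use P in \<open>auto simp: P_def M_def\<close>)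
  have "run pop s 5 = s 5" "run pop s 4 0 = h" using P by (auto simp: P_def)
  moreover have "config_rep n (\<lambda>z. s 5 (j * M + z)) (rev cs ! j)" if "j < h" for j
  proof -
    have "config_rep n (\<lambda>z. s 5 (j * M + z)) (rev (c # cs) ! j)"
      using st that unfolding stack_rep_def M_def h_def by (metis less_Suc_eq length_Cons)
    then show ?thesis using that by (simp add: nth_append h_def)
  qed
  ultimately show "stack_rep n (run pop s) cs" by (simp add: stack_rep_def M_def h_def)
qed

definition can_grow :: "nat config \<Rightarrow> nat \<Rightarrow> nat \<Rightarrow> bool" where
  "can_grow c v a \<longleftrightarrow> (case c of (H, X, i, q) \<Rightarrow> v \<in> X \<and> a \<notin> X \<and> {v, a} \<in> H \<and> (q = None \<or> q = Some v))"

lemma find_edge_spec: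
  assumes r: "regs n k s" and c: "config_rep n (s 9) c"
  defines "t \<equiv> run find_edge s"
  shows "t 10 0 = n \<and> (\<forall>v<n. \<forall>a<n. \<not> can_grow c v a) \<or>
    t 10 0 < n \<and> t 11 0 < n \<and> can_grow c (t 10 0) (t 11 0)"
proof -
  obtain H X i q where ceq: "c = (H, X, i, q)" by (cases c)
  let ?s = "set_reg 10 n s"
  let ?C = "\<lambda>z. s 9 z \<noteq> 0 \<and> s 9 (n * n + z div n) \<noteq> 0 \<and> s 9 (n * n + z mod n) = 0 \<and>
    (s 9 (n * n + n + 1) = n \<or> s 9 (n * n + n + 1) = z div n)"
  obtain p where p: "find_edge = Then (Assign 10 (Const 0) (reg 2)) (For 17 6 p)"
    by (simp add: find_edge_def)
  define P where "P j t \<longleftrightarrow> (\<forall>x. x \<notin> {10, 11, 17} \<longrightarrow> t x = s x) \<and>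
    (t 10 0 = n \<and> (\<forall>z<j. \<not> ?C z) \<or> (\<exists>z<n * n. ?C z \<and> t 10 0 = z div n \<and> t 11 0 = z mod n))"
    for j :: nat and t :: state
  have "P (n * n) (iter (run p) 17 (n * n) ?s)"
  proof (rule iter_induct[where P = P])
    show "P 0 (set_reg 17 0 ?s)" by (simp add: P_def)
  next
    fix j u assume j: "j < n * n" and u: "P j u" "u 17 0 = j"
    have fr: "u x = s x" if "x \<notin> {10, 11, 17}" for x using u that by (simp add: P_def)
    have rg: "u 2 0 = n" "u 6 0 = n * n" using fr r by (simp_all add: regs_def)
    have pu: "run p u = (if ?C j then set_reg 11 (j mod n) (set_reg 10 (j div n) u) else u)"
      using p u(2) rg fr[of 9] by (auto simp: find_edge_def)
    show "P (Suc j) (set_reg 17 (Suc j) (run p u))"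
    proof (cases "?C j")
      case True
      have e: "run p u = set_reg 11 (j mod n) (set_reg 10 (j div n) u)"
        unfolding pu using True by (rule if_P)
      have "\<exists>z<n * n. ?C z \<and> j div n = z div n \<and> j mod n = z mod n" using j True by blast
      then show ?thesis unfolding P_def e using fr by simp
    next
      case False
      have e: "run p u = u" unfolding pu using False by (rule if_not_P)
      have "(\<forall>z<Suc j. \<not> ?C z) \<longleftrightarrow> (\<forall>z<j. \<not> ?C z)" using False less_Suc_eq by auto
      then show ?thesis using u(1) fr unfolding P_def e by simp
    qed
  qed
  moreover have "t = iter (run p) 17 (n * n) ?s" using r unfolding t_def p by (simp add: regs_def)
  ultimately have "P (n * n) t" by simp
  then consider (none) "t 10 0 = n" "\<forall>z<n * n. \<not> ?C z"
    | (some) z where "z < n * n" "?C z" "t 10 0 = z div n" "t 11 0 = z mod n"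
    unfolding P_def by blast
  then show ?thesis
  proof cases
    case none
    have "\<not> can_grow c v a" if "v < n" "a < n" for v a
    proof
      assume g: "can_grow c v a"
      have "(v * n + a) div n = v" "(v * n + a) mod n = a" using that by auto
      then have "?C (v * n + a)"
        using g c that by (auto simp: ceq can_grow_def matrix_rep_def)
      then show False using none(2) cell_bound[OF that] by blast
    qed
    then show ?thesis using none by blast
  next
    case some
    have vn: "z div n < n" "z mod n < n" using some(1) by (cases "n = 0"; simp add: less_mult_imp_div_less)+
    have "s 9 ((z div n) * n + z mod n) \<noteq> 0" using some(2) by simp
    then have "{z div n, z mod n} \<in> H"
      using c vn unfolding ceq config_rep.simps matrix_rep_def by blast
    moreover have "z div n \<in> X" "z mod n \<notin> X" using c vn some(2) unfolding ceq config_rep.simps by blast+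
    moreover have "q = None \<or> q = Some (z div n)"
      using c some(2) by (cases q) (auto simp: ceq)
    ultimately have "can_grow c (z div n) (z mod n)" by (auto simp: ceq can_grow_def)
    then show ?thesis using some vn by simp
  qed
qed

lemma find_second_spec:
  assumes r: "regs n k s" and c: "config_rep n (s 9) (H, X, i, q)" and v: "s 10 0 = v" "v < n"
  defines "b \<equiv> run find_second s 12 0"
  shows "b = n \<and> (\<forall>y<n. y \<notin> X \<and> {v, y} \<in> H \<longrightarrow> y = s 11 0) \<or> b < n \<and> b \<notin> X \<and> {v, b} \<in> H \<and> b \<noteq> s 11 0"
proof -
  let ?s = "set_reg 12 n s"
  let ?C = "\<lambda>y. s 9 (v * n + y) \<noteq> 0 \<and> s 9 (n * n + y) = 0 \<and> y \<noteq> s 11 0"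
  obtain p where p: "find_second = Then (Assign 12 (Const 0) (reg 2)) (For 16 2 p)"
    by (simp add: find_second_def)
  define P where "P j t \<longleftrightarrow> (\<forall>x. x \<notin> {12, 16} \<longrightarrow> t x = s x) \<and>
    (t 12 0 = n \<and> (\<forall>y<j. \<not> ?C y) \<or> t 12 0 < n \<and> ?C (t 12 0))" for j :: nat and t :: state
  have "P n (iter (run p) 16 n ?s)"
  proof (rule iter_induct[where P = P])
    show "P 0 (set_reg 16 0 ?s)" by (simp add: P_def)
  next
    fix j u assume j: "j < n" and u: "P j u" "u 16 0 = j"
    have fr: "u x = s x" if "x \<notin> {12, 16}" for x using u that by (simp add: P_def)
    have rg: "u 2 0 = n" "u 6 0 = n * n" "u 10 0 = v" using fr r v by (simp_all add: regs_def)
    have pu: "run p u = (if ?C j then set_reg 12 j u else u)"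
      using p u(2) rg fr[of 9] fr[of 11] by (auto simp: find_second_def)
    show "P (Suc j) (set_reg 16 (Suc j) (run p u))"
    proof (cases "?C j")
      case True
      have e: "run p u = set_reg 12 j u" unfolding pu using True by (rule if_P)
      show ?thesis unfolding P_def e using fr j True by simp
    next
      case False
      have e: "run p u = u" unfolding pu using False by (rule if_not_P)
      have "(\<forall>z<Suc j. \<not> ?C z) \<longleftrightarrow> (\<forall>z<j. \<not> ?C z)" using False less_Suc_eq by auto
      then show ?thesis using u(1) fr unfolding P_def e by simp
    qed
  qed
  moreover have "run find_second s = iter (run p) 16 n ?s" using r unfolding p by (simp add: regs_def)
  ultimately have "P n (run find_second s)" by simp
  moreover have "?C y \<longleftrightarrow> y \<notin> X \<and> {v, y} \<in> H \<and> y \<noteq> s 11 0" if "y < n" for y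
    using c that v by (auto simp: matrix_rep_def)
  ultimately show ?thesis unfolding P_def b_def by blast
qed

section \<open>The connectivity test\<close>

lemma connected_graph_from_zero:
  assumes "0 < n"
  shows "connected_graph {..<n} H \<longleftrightarrow> (\<forall>y<n. reach H 0 y)"
proof
  assume "connected_graph {..<n} H"
  then show "\<forall>y<n. reach H 0 y" using assms by (simp add: connected_graph_reach)
next
  assume a: "\<forall>y<n. reach H 0 y"
  have "reach H u v" if "u < n" "v < n" for u v
    using reach_trans[OF reach_sym[OF a[rule_format, OF that(1)]] a[rule_format, OF that(2)]] .
  then show "connected_graph {..<n} H" using assms by (auto simp: connected_graph_reach lessThan_empty_iff)
qed

text \<open>A finite relation reaches everything in at most as many steps as it has pairs; this
  justifies the number of sweeps.\<close>

lemma reach_relpow: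
  assumes "simple_graph {..<n} H" "reach H 0 y"
  shows "\<exists>r\<le>n * n. (0, y) \<in> {(x, y). {x, y} \<in> H} ^^ r"
proof -
  let ?R = "{(x, y). {x, y} \<in> H}"
  have sub: "?R \<subseteq> {..<n} \<times> {..<n}" using simple_graph_edge[OF assms(1)] by auto
  then have fin: "finite ?R" by (rule finite_subset) simp
  have "card ?R \<le> card ({..<n} \<times> {..<n})" by (rule card_mono[OF _ sub]) simp
  then have "card ?R \<le> n * n" by (simp add: card_cartesian_product)
  moreover obtain r where "r \<le> card ?R" "(0, y) \<in> ?R ^^ r"
    using assms(2) unfolding reach_def rtrancl_finite_eq_relpow[OF fin] by auto
  ultimately show ?thesis by (intro exI[of _ r]) simp
qed

text \<open>Completeness refers to the marks before the sweep, whereas the loop tests the current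
  ones. Marks that spread further within one sweep are covered by soundness.\<close>

lemma sweep_spec:
  assumes r: "s 2 0 = n" "s 6 0 = n * n" and H: "matrix_rep n (s 9) H"
    and sound: "\<forall>y<n. s 13 y \<noteq> 0 \<longrightarrow> reach H 0 y"
  defines "t \<equiv> run sweep s"
  shows "\<forall>y<n. t 13 y \<noteq> 0 \<longrightarrow> reach H 0 y" "\<forall>y. s 13 y \<noteq> 0 \<longrightarrow> t 13 y \<noteq> 0"
    "\<forall>x<n. \<forall>y<n. s 13 x \<noteq> 0 \<and> {x, y} \<in> H \<longrightarrow> t 13 y \<noteq> 0"
proof -
  obtain p where p: "sweep = For 17 6 p" by (simp add: sweep_def)
  define P where "P j t \<longleftrightarrow> (\<forall>x. x \<notin> {13, 17} \<longrightarrow> t x = s x) \<and>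
    (\<forall>y<n. t 13 y \<noteq> 0 \<longrightarrow> reach H 0 y) \<and> (\<forall>y. s 13 y \<noteq> 0 \<longrightarrow> t 13 y \<noteq> 0) \<and>
    (\<forall>z<j. s 9 z \<noteq> 0 \<and> s 13 (z div n) \<noteq> 0 \<longrightarrow> t 13 (z mod n) \<noteq> 0)" for j :: nat and t :: state
  have "P (n * n) (iter (run p) 17 (n * n) s)"
  proof (rule iter_induct[where P = P])
    show "P 0 (set_reg 17 0 s)" using sound by (simp add: P_def)
  next
    fix j u assume j: "j < n * n" and u: "P j u" "u 17 0 = j"
    have fr: "u x = s x" if "x \<notin> {13, 17}" for x using u that by (simp add: P_def)
    have snd: "\<forall>y<n. u 13 y \<noteq> 0 \<longrightarrow> reach H 0 y" and mono: "\<forall>y. s 13 y \<noteq> 0 \<longrightarrow> u 13 y \<noteq> 0"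
      and cov: "\<forall>z<j. s 9 z \<noteq> 0 \<and> s 13 (z div n) \<noteq> 0 \<longrightarrow> u 13 (z mod n) \<noteq> 0"
      using u(1) unfolding P_def by blast+
    have rg: "u 2 0 = n" using fr r by simp
    let ?C = "s 9 j \<noteq> 0 \<and> u 13 (j div n) \<noteq> 0"
    have pu: "run p u = (if ?C then u(13 := (u 13)(j mod n := 1)) else u)"
      using p u(2) rg fr[of 9] by (auto simp: sweep_def)
    have dm: "j div n < n" "j mod n < n" using j by (cases "n = 0"; simp add: less_mult_imp_div_less)+
    show "P (Suc j) (set_reg 17 (Suc j) (run p u))"
    proof (cases ?C)
      case True
      have e: "run p u = u(13 := (u 13)(j mod n := 1))" unfolding pu using True by (rule if_P)
      have "s 9 ((j div n) * n + j mod n) \<noteq> 0" using True by simp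
      then have "{j div n, j mod n} \<in> H" using H dm unfolding matrix_rep_def by blast
      moreover have "reach H 0 (j div n)" using snd True dm by blast
      ultimately have "reach H 0 (j mod n)" by (rule reach_trans[OF _ reach_edge, rotated])
      then show ?thesis unfolding P_def e using fr snd mono cov by (simp add: less_Suc_eq)
    next
      case False
      have e: "run p u = u" unfolding pu using False by (rule if_not_P)
      have "s 9 j = 0 \<or> s 13 (j div n) = 0" using False mono by blast
      then have "\<forall>z<Suc j. s 9 z \<noteq> 0 \<and> s 13 (z div n) \<noteq> 0 \<longrightarrow> u 13 (z mod n) \<noteq> 0"
        using cov less_Suc_eq by auto
      then show ?thesis unfolding P_def e using fr snd mono by simp
    qed
  qed
  moreover have "t = iter (run p) 17 (n * n) s" using r unfolding t_def p by simp
  ultimately have "P (n * n) t" by simp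
  then have t: "\<forall>y<n. t 13 y \<noteq> 0 \<longrightarrow> reach H 0 y" "\<forall>y. s 13 y \<noteq> 0 \<longrightarrow> t 13 y \<noteq> 0"
    "\<forall>z<n * n. s 9 z \<noteq> 0 \<and> s 13 (z div n) \<noteq> 0 \<longrightarrow> t 13 (z mod n) \<noteq> 0" unfolding P_def by blast+
  show "\<forall>y<n. t 13 y \<noteq> 0 \<longrightarrow> reach H 0 y" "\<forall>y. s 13 y \<noteq> 0 \<longrightarrow> t 13 y \<noteq> 0" using t by blast+
  show "\<forall>x<n. \<forall>y<n. s 13 x \<noteq> 0 \<and> {x, y} \<in> H \<longrightarrow> t 13 y \<noteq> 0"
  proof (intro allI impI)
    fix x y assume a: "x < n" "y < n" "s 13 x \<noteq> 0 \<and> {x, y} \<in> H"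
    have dm: "(x * n + y) div n = x" "(x * n + y) mod n = y" using a by auto
    have "s 9 (x * n + y) \<noteq> 0" using H a unfolding matrix_rep_def by blast
    then show "t 13 y \<noteq> 0" using t(3)[rule_format, OF cell_bound[OF a(1,2)]] a dm by simp
  qed
qed

text \<open>After \<open>j\<close> sweeps the ends of all walks of at most \<open>j\<close> edges
  from vertex 0 are marked, and only reachable vertices are.\<close>

lemma test_connected_spec:
  assumes r: "regs n k s" and H: "matrix_rep n (s 9) H" and sg: "simple_graph {..<n} H" and n: "0 < n"
  shows "run test_connected s 14 0 \<noteq> 0 \<longleftrightarrow> connected_graph {..<n} H"
proof -
  let ?R = "{(x, y). {x, y} \<in> H}"
  let ?p1 = "Assign 13 (reg 16) (Const 0)" and ?p5 = "Cond (Read 13 (reg 16)) Nop (Assign 14 (Const 0) (Const 0))"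
  define s1 where "s1 = run (For 16 2 ?p1) s"
  define s2 where "s2 = set_reg 13 1 s1"
  define s3 where "s3 = run (For 18 6 sweep) s2"
  define s4 where "s4 = set_reg 14 1 s3"
  have rg: "s 2 0 = n" "s 6 0 = n * n" using r by (auto simp: regs_def)
  define P1 where "P1 j t \<longleftrightarrow> (\<forall>y<j. t 13 y = 0)" for j :: nat and t :: state
  have "P1 n (iter (run ?p1) 16 n s)"
    by (rule iter_induct[where P = P1]) (auto simp: P1_def less_Suc_eq)
  then have s1: "\<forall>y<n. s1 13 y = 0" using rg by (simp add: s1_def P1_def)
  have f1: "s1 x = s x" if "x \<notin> {13, 16}" for x
    unfolding s1_def using that by (intro run_frame) auto
  have s2: "\<forall>y<n. s2 13 y = of_bool (y = 0)" using s1 by (simp add: s2_def)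
  have f2: "s2 x = s x" if "x \<notin> {13, 16}" for x using f1 that by (simp add: s2_def)
  define P3 where "P3 j t \<longleftrightarrow> (\<forall>x. x \<notin> {13, 16, 17, 18} \<longrightarrow> t x = s x) \<and>
    (\<forall>y<n. t 13 y \<noteq> 0 \<longrightarrow> reach H 0 y) \<and> (\<forall>r\<le>j. \<forall>y<n. (0, y) \<in> ?R ^^ r \<longrightarrow> t 13 y \<noteq> 0)"
    for j :: nat and t :: state
  have "P3 (n * n) (iter (run sweep) 18 (n * n) s2)"
  proof (rule iter_induct[where P = P3])
    show "P3 0 (set_reg 18 0 s2)" using s2 f2 by (auto simp: P3_def)
  next
    fix j u assume u: "P3 j u"
    have fr: "u x = s x" if "x \<notin> {13, 16, 17, 18}" for x using u that by (simp add: P3_def)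
    have snd: "\<forall>y<n. u 13 y \<noteq> 0 \<longrightarrow> reach H 0 y"
      and cov: "\<forall>r\<le>j. \<forall>y<n. (0, y) \<in> ?R ^^ r \<longrightarrow> u 13 y \<noteq> 0"
      using u unfolding P3_def by blast+
    have "u 2 0 = n" "u 6 0 = n * n" "matrix_rep n (u 9) H" using fr rg H by simp_all
    note sw = sweep_spec[OF this snd]
    have "run sweep u 13 y \<noteq> 0" if ry: "r \<le> Suc j" "y < n" "(0, y) \<in> ?R ^^ r" for r y
    proof (cases "r \<le> j")
      case True
      then show ?thesis using cov ry sw(2) by blast
    next
      case False
      then have "(0, y) \<in> ?R ^^ Suc j" using ry by (simp add: le_Suc_eq)
      then obtain x where x: "(0, x) \<in> ?R ^^ j" "{x, y} \<in> H" by auto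
      have "x < n" using simple_graph_edge[OF sg x(2)] by simp
      then have "u 13 x \<noteq> 0" using cov x by blast
      then show ?thesis using sw(3) x \<open>x < n\<close> ry by blast
    qed
    moreover have "run sweep u x = s x" if "x \<notin> {13, 16, 17, 18}" for x
      using run_frame[of x sweep u] fr that by simp
    ultimately show "P3 (Suc j) (set_reg 18 (Suc j) (run sweep u))"
      using sw(1) unfolding P3_def by simp
  qed
  moreover have "s2 6 0 = n * n" using f2 rg by simp
  ultimately have P3: "P3 (n * n) s3" by (simp add: s3_def)
  have s3: "s3 13 y \<noteq> 0 \<longleftrightarrow> reach H 0 y" if "y < n" for y
    using P3 reach_relpow[OF sg, of y] that unfolding P3_def by blast
  have s3n: "s3 2 0 = n" using P3 rg by (simp add: P3_def)
  define P5 where "P5 j t \<longleftrightarrow> t 13 = s3 13 \<and> (t 14 0 \<noteq> 0 \<longleftrightarrow> (\<forall>y<j. s3 13 y \<noteq> 0))" for j :: nat and t :: state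
  have "P5 n (iter (run ?p5) 16 n s4)"
    by (rule iter_induct[where P = P5]) (auto simp: P5_def s4_def less_Suc_eq)
  then have P5: "P5 n (run (For 16 2 ?p5) s4)" using s3n by (simp add: s4_def)
  have "run test_connected s = run (For 16 2 ?p5) s4"
    by (simp add: test_connected_def s1_def s2_def s3_def s4_def)
  then show ?thesis using P5 s3 connected_graph_from_zero[OF n] by (simp add: P5_def)
qed

section \<open>Updates of the working copy\<close>

lemma matrix_rep_remove:
  assumes "matrix_rep n w H" "u < n" "v < n"
  shows "matrix_rep n (w(u * n + v := 0, v * n + u := 0)) (H - {{u, v}})"
  using assms unfolding matrix_rep_def by (auto simp: cell_inj doubleton_eq_iff)

lemma matrix_rep_insert:
  assumes "matrix_rep n w H" "u < n" "v < n"
  shows "matrix_rep n (w(u * n + v := 1, v * n + u := 1)) (insert {u, v} H)"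
  using assms unfolding matrix_rep_def by (auto simp: cell_inj doubleton_eq_iff)

lemma matrix_rep_upd: "matrix_rep n w H \<Longrightarrow> n * n \<le> z \<Longrightarrow> matrix_rep n (w(z := b)) H"
  unfolding matrix_rep_def using cell_bound[of _ n] by (auto dest: leD)

lemma config_rep_remove:
  assumes "config_rep n w (H, X, i, q)" "u < n" "v < n"
  shows "config_rep n (w(u * n + v := 0, v * n + u := 0)) (H - {{u, v}}, X, i, q)"
  using assms matrix_rep_remove[of n w H u v] cell_bound[of u n v] cell_bound[of v n u] by simp

lemma config_rep_insert:
  assumes "config_rep n w (H, X, i, q)" "u < n" "v < n"
  shows "config_rep n (w(u * n + v := 1, v * n + u := 1)) (insert {u, v} H, X, i, q)"
  using assms matrix_rep_insert[of n w H u v] cell_bound[of u n v] cell_bound[of v n u] by simp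

lemma config_rep_mark:
  assumes "config_rep n w (H, X, i, q)" "v < n"
  shows "config_rep n (w(n * n + v := 1)) (H, insert v X, i, q)"
  using assms matrix_rep_upd[of n w H "n * n + v" 1] by simp

lemma config_rep_unmark:
  assumes "config_rep n w (H, X, i, q)" "v < n"
  shows "config_rep n (w(n * n + v := 0)) (H, X - {v}, i, q)"
  using assms matrix_rep_upd[of n w H "n * n + v" 0] by simp

text \<open>The situation within a step: \<open>c\<close> is in the working array and
  \<open>cs\<close> is on the stack.\<close>

definition loaded :: "nat \<Rightarrow> nat \<Rightarrow> state \<Rightarrow> nat config list \<Rightarrow> nat config \<Rightarrow> bool" where
  "loaded n k s cs c \<longleftrightarrow> regs n k s \<and> stack_rep n s cs \<and> config_rep n (s 9) c"

lemma loaded_run: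
  assumes "loaded n k s cs c" "assigned p \<inter> {2, 3, 4, 5, 6, 7, 9} = {}"
  shows "loaded n k (run p s) cs c"
proof -
  have "run p s x = s x" if "x \<in> {2, 3, 4, 5, 6, 7, 9}" for x
    using assms(2) that by (intro run_frame) blast
  then show ?thesis using assms(1) by (simp add: loaded_def regs_def stack_rep_def)
qed

lemma loaded_array:
  "loaded n k s cs c \<Longrightarrow> config_rep n w c' \<Longrightarrow> loaded n k (s(9 := w)) cs c'"
  by (simp add: loaded_def regs_def stack_rep_def)

lemma loaded_push: "loaded n k s cs c \<Longrightarrow> loaded n k (run push s) (c # cs) c"
  using push_spec[of n k s cs c] run_frame[of 9 push s] regs_run[of n k s push]
  by (simp add: loaded_def)

lemma loaded_remove:
  assumes "loaded n k s cs (H, X, i, q)" "s u 0 < n" "s v 0 < n" "u \<noteq> 9" "v \<noteq> 9"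
  shows "loaded n k (run (set_edge u v 0) s) cs (H - {{s u 0, s v 0}}, X, i, q)"
proof -
  have "s 2 0 = n" using assms(1) by (simp add: loaded_def regs_def)
  then have e: "run (set_edge u v 0) s = s(9 := (s 9)(s u 0 * n + s v 0 := 0, s v 0 * n + s u 0 := 0))"
    using assms(4,5) by (simp add: set_edge_def)
  have c: "config_rep n (s 9) (H, X, i, q)" using assms(1) by (simp add: loaded_def)
  show ?thesis unfolding e by (rule loaded_array[OF assms(1) config_rep_remove[OF c assms(2,3)]])
qed

text \<open>Undoes a removal. The edge set before the update is written as a difference so that
  afterwards it is \<open>H\<close> itself.\<close>

lemma loaded_insert:
  assumes "loaded n k s cs (H - {{s u 0, s v 0}}, X, i, q)" "{s u 0, s v 0} \<in> H"
    "s u 0 < n" "s v 0 < n" "u \<noteq> 9" "v \<noteq> 9"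
  shows "loaded n k (run (set_edge u v 1) s) cs (H, X, i, q)"
proof -
  have "s 2 0 = n" using assms(1) by (simp add: loaded_def regs_def)
  then have e: "run (set_edge u v 1) s = s(9 := (s 9)(s u 0 * n + s v 0 := 1, s v 0 * n + s u 0 := 1))"
    using assms(5,6) by (simp add: set_edge_def)
  have c: "config_rep n (s 9) (H - {{s u 0, s v 0}}, X, i, q)" using assms(1) by (simp add: loaded_def)
  have i: "insert {s u 0, s v 0} (H - {{s u 0, s v 0}}) = H" using assms(2) by auto
  show ?thesis
    using loaded_array[OF assms(1) config_rep_insert[OF c assms(3,4)]] unfolding e i .
qed

lemma loaded_mark:
  assumes "loaded n k s cs (H, X, i, q)" "s v 0 < n"
  shows "loaded n k (run (set_mark v 1) s) cs (H, insert (s v 0) X, i, q)"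
proof -
  have e: "run (set_mark v 1) s = s(9 := (s 9)(n * n + s v 0 := 1))"
    using assms(1) by (simp add: set_mark_def loaded_def regs_def)
  have c: "config_rep n (s 9) (H, X, i, q)" using assms(1) by (simp add: loaded_def)
  show ?thesis unfolding e by (rule loaded_array[OF assms(1) config_rep_mark[OF c assms(2)]])
qed

lemma loaded_unmark:
  assumes "loaded n k s cs (H, insert (s v 0) X, i, q)" "s v 0 < n" "s v 0 \<notin> X"
  shows "loaded n k (run (set_mark v 0) s) cs (H, X, i, q)"
proof -
  have e: "run (set_mark v 0) s = s(9 := (s 9)(n * n + s v 0 := 0))"
    using assms(1) by (simp add: set_mark_def loaded_def regs_def)
  have c: "config_rep n (s 9) (H, insert (s v 0) X, i, q)" using assms(1) by (simp add: loaded_def)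
  have i: "insert (s v 0) X - {s v 0} = X" using assms(3) by auto
  show ?thesis
    using loaded_array[OF assms(1) config_rep_unmark[OF c assms(2)]] unfolding e i .
qed

lemma loaded_leaf:
  assumes "loaded n k s cs (H, X, i, q)" "s v 0 \<le> n"
  shows "loaded n k (run (set_leaf v) s) cs (H, X, i, if s v 0 = n then None else Some (s v 0))"
proof -
  have e: "run (set_leaf v) s = s(9 := (s 9)(n * n + n + 1 := s v 0))"
    using assms(1) by (simp add: set_leaf_def loaded_def regs_def)
  have c: "config_rep n ((s 9)(n * n + n + 1 := s v 0)) (H, X, i, if s v 0 = n then None else Some (s v 0))"
    using assms matrix_rep_upd[of n "s 9" H "n * n + n + 1" "s v 0"] by (auto simp: loaded_def)
  show ?thesis unfolding e by (rule loaded_array[OF assms(1) c])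
qed

lemma loaded_count:
  assumes "loaded n k s cs (H, X, i, q)"
  shows "loaded n k (run (Assign 9 count_addr (Plus (Read 9 count_addr) (Const 1))) s) cs (H, X, Suc i, q)"
proof -
  have e: "run (Assign 9 count_addr (Plus (Read 9 count_addr) (Const 1))) s = s(9 := (s 9)(n * n + n := Suc i))"
    using assms by (simp add: loaded_def regs_def)
  have c: "config_rep n ((s 9)(n * n + n := Suc i)) (H, X, Suc i, q)"
    using assms matrix_rep_upd[of n "s 9" H "n * n + n" "Suc i"] by (simp add: loaded_def)
  show ?thesis unfolding e by (rule loaded_array[OF assms c])
qed

section \<open>Correctness of the search\<close>

lemma loaded_regs: "loaded n k s cs c \<Longrightarrow> s 2 0 = n \<and> s 3 0 = k \<and> s 6 0 = n * n \<and> s 7 0 = n * n + n + 2"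
  by (simp add: loaded_def regs_def)

lemma expand_one_spec:
  assumes "loaded n k s cs (H, X, i, q)" "s 11 0 < n"
  shows "stack_rep n (run expand_one s) ((H, insert (s 11 0) X, i, None) # cs)"
proof -
  define s1 where "s1 = run (set_mark 11 1) s"
  define s2 where "s2 = run (set_leaf 2) s1"
  have "loaded n k s1 cs (H, insert (s 11 0) X, i, q)"
    unfolding s1_def by (rule loaded_mark[OF assms])
  from loaded_leaf[OF this, of 2] loaded_regs[OF this]
  have "loaded n k s2 cs (H, insert (s 11 0) X, i, None)" by (simp add: s2_def)
  from loaded_push[OF this] show ?thesis
    by (simp add: loaded_def expand_one_def s1_def s2_def)
qed

text \<open>The count \<open>i\<close> has been raised already when this program starts. The list
  shows the pushes in reverse order.\<close>

lemma expand_two_spec: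
  assumes ld: "loaded n k s cs (H, X, i, q)" and reg: "s 10 0 = v" "s 11 0 = a" "s 12 0 = b"
    and lt: "v < n" "a < n" "b < n" and edges: "{v, a} \<in> H" "{v, b} \<in> H"
    and out: "a \<notin> X" "b \<notin> X" and sg: "simple_graph {..<n} H"
  shows "stack_rep n (run expand_two s)
    ((if q \<noteq> None then [(H - {{v, a}}, insert b X, i, None), (H - {{v, b}}, insert a X, i, None)]
      else if connected_graph {..<n} (H - {{v, a}}) then
        [(H, insert a (insert b X), i, Some a),
         (H - {{v, a}}, insert b X, i, None), (H - {{v, b}}, insert a X, i, None)]
      else [(H, insert a (insert b X), i, None), (H - {{v, b}}, insert a X, i, None)]) @ cs)"
proof -
  let ?ca = "(H - {{v, b}}, insert a X, i, None)" and ?cb = "(H - {{v, a}}, insert b X, i, None)"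
  define s1 where "s1 = run (Assign 15 (Const 0) (Read 9 leaf_addr)) s"
  define s2 where "s2 = run (set_leaf 2) s1"
  define s3 where "s3 = run (set_edge 10 12 0) s2"
  define s4 where "s4 = run (set_mark 11 1) s3"
  define s5 where "s5 = run push s4"
  define s6 where "s6 = run (set_edge 10 12 1) s5"
  define s7 where "s7 = run (set_mark 11 0) s6"
  define s8 where "s8 = run (set_edge 10 11 0) s7"
  define s9 where "s9 = run (set_mark 12 1) s8"
  define s10 where "s10 = run test_connected s9"
  note defs = s1_def s2_def s3_def s4_def s5_def s6_def s7_def s8_def s9_def s10_def
  have fr: "s1 x = s x" if "x \<noteq> 15" for x using that by (simp add: s1_def)
  have r2: "s2 10 0 = v" "s2 12 0 = b" "s3 11 0 = a" "s5 10 0 = v" "s5 12 0 = b" "s6 11 0 = a"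
    "s7 10 0 = v" "s7 11 0 = a" "s8 12 0 = b" "s10 10 0 = v" "s10 11 0 = a" "s9 10 0 = v" "s9 11 0 = a"
    unfolding s2_def s3_def s4_def s5_def s6_def s7_def s8_def s9_def s10_def
    using fr reg by (simp_all add: run_frame)
  \<comment> \<open>The saved field is \<open>n\<close> exactly if no leaf was restricted, and this
    decides the branch taken after \<open>s9\<close>.\<close>
  have s15: "s9 15 0 = (case q of None \<Rightarrow> n | Some v \<Rightarrow> v)"
    using ld unfolding s2_def s3_def s4_def s5_def s6_def s7_def s8_def s9_def
    by (simp add: run_frame s1_def loaded_def regs_def)
  have l1: "loaded n k s1 cs (H, X, i, q)" unfolding s1_def by (rule loaded_run[OF ld]) simp
  have l2: "loaded n k s2 cs (H, X, i, None)"
    using loaded_leaf[OF l1, of 2] loaded_regs[OF l1] by (simp add: s2_def)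
  have l3: "loaded n k s3 cs (H - {{v, b}}, X, i, None)"
    using loaded_remove[OF l2, of 10 12] lt by (simp add: s3_def r2)
  have l4: "loaded n k s4 cs ?ca"
    using loaded_mark[OF l3, of 11] lt by (simp add: s4_def r2)
  have l5: "loaded n k s5 (?ca # cs) ?ca"
    unfolding s5_def by (rule loaded_push[OF l4])
  have l6: "loaded n k s6 (?ca # cs) (H, insert a X, i, None)"
    unfolding s6_def by (rule loaded_insert) (use l5 r2 lt edges in simp_all)
  have l7: "loaded n k s7 (?ca # cs) (H, X, i, None)"
    unfolding s7_def by (rule loaded_unmark) (use l6 r2 lt out in simp_all)
  have l8: "loaded n k s8 (?ca # cs) (H - {{v, a}}, X, i, None)"
    using loaded_remove[OF l7, of 10 11] lt by (simp add: s8_def r2)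
  have l9: "loaded n k s9 (?ca # cs) ?cb"
    using loaded_mark[OF l8, of 12] lt by (simp add: s9_def r2)
  have s9n: "s9 2 0 = n" using loaded_regs[OF l9] by simp
  have l10: "loaded n k s10 (?ca # cs) ?cb" unfolding s10_def by (rule loaded_run[OF l9]) simp
  have conn: "s10 14 0 \<noteq> 0 \<longleftrightarrow> connected_graph {..<n} (H - {{v, a}})"
    unfolding s10_def
  proof (rule test_connected_spec)
    show "regs n k s9" "matrix_rep n (s9 9) (H - {{v, a}})" using l9 by (auto simp: loaded_def)
    show "simple_graph {..<n} (H - {{v, a}})" using simple_graph_subset[OF sg] by blast
    show "0 < n" using lt by simp
  qed
  have run: "run expand_two s = (if s9 2 0 - s9 15 0 \<noteq> 0 then run push s9
      else if s10 14 0 \<noteq> 0 then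
        run push (run (set_leaf 11) (run (set_mark 11 1) (run (set_edge 10 11 1) (run push s10))))
      else run push (run (set_mark 11 1) (run (set_edge 10 11 1) s10)))"
    unfolding expand_two_def run.simps defs by simp
  have both: "loaded n k (run (set_mark 11 1) (run (set_edge 10 11 1) u)) ds (H, insert a (insert b X), i, None)"
    if u: "loaded n k u ds ?cb" "u 10 0 = v" "u 11 0 = a" for u ds
  proof -
    have "loaded n k (run (set_edge 10 11 1) u) ds (H, insert b X, i, None)"
      by (rule loaded_insert) (use u lt edges in simp_all)
    from loaded_mark[OF this, of 11] show ?thesis using u lt by (simp add: run_frame)
  qed
  show ?thesis
  proof (cases q)
    case (Some w)
    then have "w < n" using ld by (auto simp: loaded_def)
    then have "run expand_two s = run push s9" using run s9n s15 Some by simp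
    then show ?thesis using loaded_push[OF l9] Some by (simp add: loaded_def)
  next
    case None
    show ?thesis
    proof (cases "connected_graph {..<n} (H - {{v, a}})")
      case True
      let ?u = "run push s10"
      have lu: "loaded n k ?u (?cb # ?ca # cs) ?cb" by (rule loaded_push[OF l10])
      have u: "?u 10 0 = v" "?u 11 0 = a" using r2 by (simp_all add: run_frame)
      let ?w = "run (set_mark 11 1) (run (set_edge 10 11 1) ?u)"
      have "?w 11 0 = a" using u by (simp add: run_frame)
      then have "loaded n k (run (set_leaf 11) ?w) (?cb # ?ca # cs) (H, insert a (insert b X), i, Some a)"
        using loaded_leaf[OF both[OF lu u], of 11] lt by simp
      from loaded_push[OF this] show ?thesis
        using run s9n s15 None True conn by (simp add: loaded_def)
    next
      case False
      have "loaded n k (run (set_mark 11 1) (run (set_edge 10 11 1) s10)) (?ca # cs) (H, insert a (insert b X), i, None)"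
        by (rule both[OF l10]) (use r2 in simp_all)
      from loaded_push[OF this] show ?thesis
        using run s9n s15 None False conn by (simp add: loaded_def)
    qed
  qed
qed

lemma step_spec:
  assumes r: "regs n k s" and st: "stack_rep n s ((H, X, i, q) # cs)" and sg: "simple_graph {..<n} H"
  shows "k \<le> i \<Longrightarrow> stack_rep n (run step s) cs \<and> run step s 8 0 = 1"
    and "i < k \<Longrightarrow> (\<exists>ds. branch {..<n} (H, X, i, q) ds \<and> stack_rep n (run step s) (ds @ cs)) \<and>
      run step s 8 = s 8"
proof -
  let ?c = "(H, X, i, q)"
  define s1 where "s1 = run pop s"
  have l1: "loaded n k s1 cs ?c"
    using pop_spec[OF r st] regs_run[OF r, of pop] by (simp add: s1_def loaded_def)
  have s1i: "s1 9 (n * n + n) = i" using l1 by (simp add: loaded_def)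
  have s18: "s1 8 = s 8" by (simp add: s1_def run_frame)
  note r1 = loaded_regs[OF l1]
  let ?p = "Then find_edge (Cond (Minus (reg 2) (reg 10))
       (Then find_second (Then (Assign 9 count_addr (Plus (Read 9 count_addr) (Const 1)))
         (Cond (Minus (reg 2) (reg 12)) expand_two expand_one)))
       Nop)"
  have run: "run step s = (if i < k then run ?p s1 else set_reg 8 1 s1)"
    unfolding step_def run.simps s1_def[symmetric] using r1 s1i by simp
  {
    assume "k \<le> i"
    then have "run step s = set_reg 8 1 s1" using run by simp
    then show "stack_rep n (run step s) cs \<and> run step s 8 0 = 1"
      using l1 by (simp add: loaded_def stack_rep_def)
  }
  {
    assume ik: "i < k"
    define s2 where "s2 = run find_edge s1"
    define s3 where "s3 = run find_second s2"
    define s4 where "s4 = run (Assign 9 count_addr (Plus (Read 9 count_addr) (Const 1))) s3"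
    have rs: "run step s = (if s2 10 0 < n then
        (if s3 12 0 < n then run expand_two s4 else run expand_one s4) else s2)"
    proof -
      have "s2 2 0 = n" "s4 2 0 = n" "s4 12 0 = s3 12 0"
        using r1 by (simp_all add: s2_def s3_def s4_def run_frame)
      then show ?thesis
        unfolding run using ik by (simp add: s2_def s3_def s4_def del: run.simps(2))
    qed
    have f8: "run step s 8 = s 8"
    proof -
      have "8 \<notin> assigned ?p" by (simp add: expand_two_def expand_one_def)
      then have "run ?p s1 8 = s1 8" by (rule run_frame)
      then show ?thesis using run ik s18 by simp
    qed
    have l2: "loaded n k s2 cs ?c" unfolding s2_def by (rule loaded_run[OF l1]) simp
    have l3: "loaded n k s3 cs ?c" unfolding s3_def by (rule loaded_run[OF l2]) simp
    have l4: "loaded n k s4 cs (H, X, Suc i, q)" unfolding s4_def by (rule loaded_count[OF l3])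
    have c1: "config_rep n (s1 9) ?c" and rg1: "regs n k s1" using l1 by (auto simp: loaded_def)
    have c2: "config_rep n (s2 9) ?c" and rg2: "regs n k s2" using l2 by (auto simp: loaded_def)
    define v where "v = s2 10 0"
    define a where "a = s2 11 0"
    define b where "b = s3 12 0"
    consider (dead) "v = n" "\<forall>v<n. \<forall>a<n. \<not> can_grow ?c v a"
      | (grow) "v < n" "a < n" "can_grow ?c v a"
      using find_edge_spec[OF rg1 c1] unfolding s2_def v_def a_def by blast
    then have "\<exists>ds. branch {..<n} ?c ds \<and> stack_rep n (run step s) (ds @ cs)"
    proof cases
      case dead
      have "branch {..<n} ?c []"
      proof (rule branch.dead)
        fix x y assume xy: "x \<in> X" "y \<notin> X" "{x, y} \<in> H"
        then have "\<not> can_grow ?c x y" using dead simple_graph_edge[OF sg xy(3)] by simp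
        then show "q \<noteq> None \<and> q \<noteq> Some x" using xy by (simp add: can_grow_def)
      qed
      moreover have "run step s = s2" using rs dead by (simp add: v_def)
      ultimately show ?thesis using l2 by (intro exI[of _ "[]"]) (simp add: loaded_def)
    next
      case grow
      then have g: "v \<in> X" "a \<notin> X" "{v, a} \<in> H" "q = None \<or> q = Some v" by (auto simp: can_grow_def)
      have reg4: "s4 10 0 = v" "s4 11 0 = a" "s4 12 0 = b"
        by (simp_all add: s4_def s3_def v_def a_def b_def run_frame)
      consider (one) "b = n" "\<forall>y<n. y \<notin> X \<and> {v, y} \<in> H \<longrightarrow> y = a"
        | (two) "b < n" "b \<notin> X" "{v, b} \<in> H" "b \<noteq> a"
        using find_second_spec[OF rg2 c2, of v] grow(1) unfolding s3_def v_def a_def b_def by blast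
      then show ?thesis
      proof cases
        case one
        have "branch {..<n} ?c [(H, insert a X, Suc i, None)]"
          by (rule branch.one[OF g]) (use one(2) simple_graph_edge[OF sg] in blast)
        moreover have "run step s = run expand_one s4" using rs grow(1) one(1) by (simp add: v_def b_def)
        ultimately show ?thesis
          using expand_one_spec[OF l4] reg4(2) grow(2) by (intro exI[of _ "[(H, insert a X, Suc i, None)]"]) simp
      next
        case two
        have re: "run step s = run expand_two s4" using rs grow(1) two(1) by (simp add: v_def b_def)
        note ex = expand_two_spec[OF l4 reg4 grow(1,2) two(1) g(3) two(3) g(2) two(2) sg, folded re]
        show ?thesis
        proof (cases "q = None")
          case True
          show ?thesis
          proof (cases "connected_graph {..<n} (H - {{v, a}})")
            case conn: True
            have "stack_rep n (run step s) ([(H, insert a (insert b X), Suc i, Some a),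
                (H - {{v, a}}, insert b X, Suc i, None), (H - {{v, b}}, insert a X, Suc i, None)] @ cs)"
              using ex unfolding True by (simp only: conn if_True if_False not_True_eq_False simp_thms)
            with branch.free[OF g(1,2) two(2) not_sym[OF two(4)] g(3) two(3) True conn, of i]
            show ?thesis by blast
          next
            case conn: False
            have "stack_rep n (run step s) ([(H, insert a (insert b X), Suc i, None),
                (H - {{v, b}}, insert a X, Suc i, None)] @ cs)"
              using ex unfolding True by (simp only: conn if_True if_False not_True_eq_False simp_thms)
            with branch.forced[OF g(1,2) two(2) not_sym[OF two(4)] g(3) two(3) True conn, of i]
            show ?thesis by blast
          qed
        next
          case False
          then have q: "q = Some v" using g(4) by blast
          have "stack_rep n (run step s) ([(H - {{v, a}}, insert b X, Suc i, None),
              (H - {{v, b}}, insert a X, Suc i, None)] @ cs)"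
            using ex False by (simp only: if_True simp_thms)
          with branch.restricted[OF g(1,2) two(2) not_sym[OF two(4)] g(3) two(3) q, of "{..<n}" i]
          show ?thesis by blast
        qed
      qed
    qed
    then show "(\<exists>ds. branch {..<n} ?c ds \<and> stack_rep n (run step s) (ds @ cs)) \<and> run step s 8 = s 8"
      using f8 by blast
  }
qed

section \<open>The invariant of the main loop\<close>

text \<open>The variant \<open>N\<close> is the total size of the search trees on the stack.
  Connectivity is recorded because it turns a tree with \<open>k\<close> internal vertices into a
  spanning tree, and \<open>s 8 0 \<le> 1\<close> makes the register a literal answer.\<close>

definition search_inv :: "nat \<Rightarrow> nat set set \<Rightarrow> nat \<Rightarrow> state \<Rightarrow> nat \<Rightarrow> bool" where
  "search_inv n E k s N \<longleftrightarrow> (\<exists>cs. regs n k s \<and> stack_rep n s cs \<and>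
     (connected_graph {..<n} E \<or> cs = []) \<and> (\<forall>c\<in>set cs. config_valid {..<n} E c) \<and>
     (has_internal_spanning_tree {..<n} E k \<longleftrightarrow> s 8 0 \<noteq> 0 \<or> (\<exists>c\<in>set cs. config_solvable {..<n} k c)) \<and>
     s 8 0 \<le> 1 \<and> N = (\<Sum>c\<leftarrow>cs. config_size k c))"

lemma config_size_pos: "0 < config_size k c"
proof (cases "(k, c)" rule: config_size.cases)
  case (1 k' H X i)
  have "0 < search_size m" for m by (induction m rule: search_size.induct) auto
  then show ?thesis using 1 by simp
next
  case (2 k' H X i v)
  then show ?thesis by (auto split: nat.split)
qed

text \<open>Soundness comes from validity, completeness from \<open>branch_complete\<close>, the
  decrease of \<open>N\<close> from \<open>branch_size\<close>. A finished configuration takes its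
  own positive size with it.\<close>

lemma step_inv:
  assumes sg: "simple_graph {..<n} E" and sc: "subcubic {..<n} E"
    and inv: "search_inv n E k s N" and ne: "s 4 0 \<noteq> 0"
  shows "\<exists>N'<N. search_inv n E k (run step s) N'"
proof -
  let ?V = "{..<n}" and ?has = "has_internal_spanning_tree {..<n} E k" and ?t = "run step s"
  obtain cs' where r: "regs n k s" and st': "stack_rep n s cs'" and con': "connected_graph ?V E \<or> cs' = []"
    and val': "\<forall>c\<in>set cs'. config_valid ?V E c"
    and has': "?has \<longleftrightarrow> s 8 0 \<noteq> 0 \<or> (\<exists>c\<in>set cs'. config_solvable ?V k c)"
    and s8: "s 8 0 \<le> 1" and N: "N = (\<Sum>c\<leftarrow>cs'. config_size k c)"
    using inv unfolding search_inv_def by blast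
  have "cs' \<noteq> []" using st' ne by (auto simp: stack_rep_def)
  then obtain H X i q cs where cs': "cs' = (H, X, i, q) # cs" by (cases cs') auto
  have con: "connected_graph ?V E" using con' cs' by simp
  have val: "config_valid ?V E (H, X, i, q)" "\<forall>c\<in>set cs. config_valid ?V E c" using val' cs' by auto
  have HE: "H \<subseteq> E" using val by auto
  note spec = step_spec[OF r st'[unfolded cs'] simple_graph_subset[OF sg HE]]
  have rt: "regs n k ?t"
    by (rule regs_run[OF r]) (simp add: step_def expand_two_def expand_one_def)
  show ?thesis
  proof (cases "i < k")
    case False
    then have t: "stack_rep n ?t cs" "?t 8 0 = 1" using spec(1) by auto
    have "?has" using config_valid_reached[OF sg con val(1)] False by simp
    then have "search_inv n E k ?t (\<Sum>c\<leftarrow>cs. config_size k c)"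
      unfolding search_inv_def using t rt con val(2) by (intro exI[of _ cs]) simp
    then show ?thesis using N cs' config_size_pos[of k "(H, X, i, q)"]
      by (intro exI[of _ "\<Sum>c\<leftarrow>cs. config_size k c"]) simp
  next
    case True
    then obtain ds where ds: "branch ?V (H, X, i, q) ds" "stack_rep n ?t (ds @ cs)" and t8: "?t 8 = s 8"
      using spec(2) by blast
    have vd: "config_valid ?V E c" if "c \<in> set ds" for c
      by (rule branch_valid[OF sg sc HE ds(1) val(1) that])
    have sound: "?has" if "c \<in> set ds" "config_solvable ?V k c" for c
    proof -
      obtain H' X' i' q' where c: "c = (H', X', i', q')" by (cases c)
      have "H' \<subseteq> E" using vd[OF that(1)] c by simp
      then show ?thesis using config_solvable_sound[of H' E ?V k X' i' q'] that(2) c by simp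
    qed
    have complete: "\<exists>c\<in>set ds. config_solvable ?V k c" if "config_solvable ?V k (H, X, i, q)"
      by (rule branch_complete[OF sg sc HE ds(1) that True])
    have "?has \<longleftrightarrow> ?t 8 0 \<noteq> 0 \<or> (\<exists>c\<in>set (ds @ cs). config_solvable ?V k c)"
      using has' sound complete t8 cs' by auto
    moreover have "Suc (\<Sum>c\<leftarrow>ds. config_size k c) \<le> config_size k (H, X, i, q)"
      by (rule branch_size[OF ds(1) True])
    ultimately show ?thesis
      unfolding search_inv_def using ds(2) rt con val(2) vd t8 s8 N cs'
      by (intro exI[of _ "\<Sum>c\<leftarrow>ds @ cs. config_size k c"] conjI exI[of _ "ds @ cs"]) auto
  qed
qed

section \<open>Boundary cases and initialisation\<close>

lemma has_internal_connected:
  assumes "has_internal_spanning_tree V E k"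
  shows "connected_graph V E"
proof -
  obtain F where F: "F \<subseteq> E" "tree V F"
    using assms by (auto simp: has_internal_spanning_tree_def spanning_tree_def)
  then show ?thesis
    using reach_mono[OF _ F(1)] by (simp add: tree_iff_bridged connected_graph_reach)
qed

lemma has_internal_zero:
  assumes "simple_graph V E" "connected_graph V E"
  shows "has_internal_spanning_tree V E 0"
proof -
  obtain r where "r \<in> V" using assms(2) by (auto simp: connected_graph_def)
  then have "\<exists>F. spanning_tree V E F \<and> {} \<subseteq> F"
    by (intro tree_extends_to_spanning_tree[OF tree_singleton _ assms]) auto
  then show ?thesis by (auto simp: has_internal_spanning_tree_def)
qed

lemma has_internal_singleton: "has_internal_spanning_tree {r} E k \<Longrightarrow> k = 0"
proof -
  assume "has_internal_spanning_tree {r} E k"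
  then obtain F where F: "simple_graph {r} F" "k \<le> card (internal_vertices {r} F)"
    by (auto simp: has_internal_spanning_tree_def spanning_tree_def tree_def)
  have "e \<notin> F" for e
  proof
    assume "e \<in> F"
    then have "e \<subseteq> {r}" "card e = 2" using F(1) by (auto simp: simple_graph_def)
    then show False using card_mono[of "{r}" e] by simp
  qed
  then have "internal_vertices {r} F = {}" by (auto simp: internal_vertices_def degree_def)
  then show ?thesis using F by simp
qed

text \<open>Justifies the immediate rejection of \<open>k > n\<close>.\<close>

lemma has_internal_le: "has_internal_spanning_tree {..<n} E k \<Longrightarrow> k \<le> n"
proof -
  assume "has_internal_spanning_tree {..<n} E k"
  then obtain F where "k \<le> card (internal_vertices {..<n} F)"
    by (auto simp: has_internal_spanning_tree_def)
  also have "\<dots> \<le> card {..<n}" by (rule card_mono) (auto simp: internal_vertices_def)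
  finally show ?thesis by simp
qed

lemma loaded_set_reg:
  "loaded n k s cs c \<Longrightarrow> x \<notin> {2, 3, 4, 5, 6, 7, 9} \<Longrightarrow> loaded n k (set_reg x v s) cs c"
  by (simp add: loaded_def regs_def stack_rep_def)

lemma start_spec:
  assumes ld: "loaded n k s cs (E, {0}, 0, None)" and y: "s 16 0 = y" "y < n" "y \<noteq> 0"
  shows "loaded n k (run start s) (start_config E 0 y # cs) (E, {0}, 0, None)"
proof -
  have "loaded n k (run (set_mark 16 1) s) cs (start_config E 0 y)"
    using loaded_mark[OF ld, of 16] y by (simp add: start_config_def insert_commute)
  from loaded_push[OF this]
  have l: "loaded n k (run push (run (set_mark 16 1) s)) (start_config E 0 y # cs) (E, insert y {0}, 0, None)"
    by (simp add: start_config_def insert_commute)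
  have "run push (run (set_mark 16 1) s) 16 0 = y" using y by (simp add: run_frame)
  then show ?thesis
    using loaded_unmark[of n k _ "start_config E 0 y # cs" E 16 "{0}" 0 None] l y
    unfolding start_def run.simps by simp
qed

text \<open>At most \<open>n\<close> configurations are pushed, one for each neighbour of vertex 0,
  and each has size \<open>search_size k\<close>. This is the origin of the factor
  \<open>n\<close>.\<close>

lemma init_spec:
  assumes r: "regs n k s" and empty: "s 4 0 = 0" "s 8 0 = 0" and E: "matrix_rep n (s 1) E"
    and sg: "simple_graph {..<n} E"
  shows "\<exists>N. search_inv n E k (run init s) N \<and> N \<le> n * search_size k"
proof -
  let ?V = "{..<n}"
  let ?p1 = "Assign 9 (reg 17) (Read 1 (reg 17))" and ?p2 = "Assign 9 (mark_addr (reg 16)) (Const 0)"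
    and ?p6 = "Cond (Read 9 (reg 16)) start Nop"
  define s1 where "s1 = run (For 17 6 ?p1) s"
  define s2 where "s2 = run (For 16 2 ?p2) s1"
  define s3 where "s3 = run (Assign 9 count_addr (Const 0)) s2"
  define s4 where "s4 = run (set_leaf 2) s3"
  define s5 where "s5 = run test_connected s4"
  have rg: "s 2 0 = n" "s 3 0 = k" "s 6 0 = n * n" "s 7 0 = n * n + n + 2" using r by (auto simp: regs_def)
  define P1 where "P1 j t \<longleftrightarrow> (\<forall>x. x \<notin> {9, 17} \<longrightarrow> t x = s x) \<and> (\<forall>z<j. t 9 z = s 1 z)" for j :: nat and t :: state
  have "P1 (n * n) (iter (run ?p1) 17 (n * n) s)"
    by (rule iter_induct[where P = P1]) (auto simp: P1_def less_Suc_eq)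
  then have P1: "P1 (n * n) s1" by (simp add: s1_def rg)
  then have m1: "matrix_rep n (s1 9) E" using E cell_bound[of _ n] by (auto simp: P1_def matrix_rep_def)
  have f1: "s1 x = s x" if "x \<notin> {9, 17}" for x using P1 that by (simp add: P1_def)
  define P2 where "P2 j t \<longleftrightarrow> (\<forall>x. x \<notin> {9, 16} \<longrightarrow> t x = s1 x) \<and> (\<forall>z<n * n. t 9 z = s1 9 z) \<and> (\<forall>x<j. t 9 (n * n + x) = 0)"
    for j :: nat and t :: state
  have "P2 n (iter (run ?p2) 16 n s1)"
    by (rule iter_induct[where P = P2]) (auto simp: P2_def less_Suc_eq f1 rg)
  then have P2: "P2 n s2" using f1 rg by (simp add: s2_def)
  have m2: "matrix_rep n (s2 9) E"
    using P2 m1 cell_bound[of _ n] by (simp add: P2_def matrix_rep_def)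
  have f2: "s2 x = s x" if "x \<notin> {9, 16, 17}" for x using P2 f1 that by (simp add: P2_def)
  have f4: "s4 x = s x" if "x \<notin> {9, 16, 17}" for x using f2 that by (simp add: s4_def s3_def run_frame)
  have s4: "s4 = s2(9 := (s2 9)(n * n + n := 0, n * n + n + 1 := n))"
    using f2 rg by (simp add: s4_def s3_def set_leaf_def)
  have "config_rep n (s4 9) (E, {}, 0, None)"
    using matrix_rep_upd[OF matrix_rep_upd[OF m2, of "n * n + n" 0], of "n * n + n + 1" n] P2
    by (simp add: s4 P2_def)
  moreover have "regs n k s4" using f4 rg by (simp add: regs_def)
  moreover have "stack_rep n s4 []" using f4 empty by (simp add: stack_rep_def)
  ultimately have l4: "loaded n k s4 [] (E, {}, 0, None)" by (simp add: loaded_def)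
  have l5: "loaded n k s5 [] (E, {}, 0, None)" unfolding s5_def by (rule loaded_run[OF l4]) simp
  have s58: "s5 8 0 = 0" using f4 empty by (simp add: s5_def run_frame)
  have s5n: "s5 2 0 = n" "s5 3 0 = k" using loaded_regs[OF l5] by auto
  have conn: "s5 14 0 \<noteq> 0 \<longleftrightarrow> connected_graph ?V E" if "0 < n"
    unfolding s5_def by (rule test_connected_spec[OF _ _ sg that]) (use l4 in \<open>auto simp: loaded_def\<close>)
  have ri: "run init s = (if n * s5 14 0 \<noteq> 0 then
      run (For 16 2 ?p6) (run (Assign 9 (mark_addr (Const 0)) (Const 1)) (run (Cond (reg 3) Nop (Assign 8 (Const 0) (Const 1))) s5))
      else s5)"
    unfolding init_def run.simps(3) s1_def[symmetric] s2_def[symmetric] s3_def[symmetric] s4_def[symmetric]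
      s5_def[symmetric]
    using s5n by (simp del: run.simps(5))
  show ?thesis
  proof (cases "0 < n \<and> connected_graph ?V E")
    case False
    then have "\<not> connected_graph ?V E" by (auto simp: connected_graph_def)
    then have nh: "\<not> has_internal_spanning_tree ?V E k" using has_internal_connected by blast
    have "run init s = s5" using ri False conn by auto
    then have "search_inv n E k (run init s) 0"
      unfolding search_inv_def using l5 nh s58 by (intro exI[of _ "[]"]) (simp add: loaded_def)
    then show ?thesis by blast
  next
    case True
    then have n: "0 < n" and con: "connected_graph ?V E" by auto
    define s6 where "s6 = run (Cond (reg 3) Nop (Assign 8 (Const 0) (Const 1))) s5"
    define s7 where "s7 = run (Assign 9 (mark_addr (Const 0)) (Const 1)) s6"
    have s6: "s6 = (if k = 0 then set_reg 8 1 s5 else s5)" using s5n by (simp add: s6_def)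
    have l6: "loaded n k s6 [] (E, {}, 0, None)" using l5 loaded_set_reg[OF l5, of 8 1] unfolding s6 by (cases "k = 0") simp_all
    have s68: "s6 8 0 = of_bool (k = 0)" using s58 by (simp add: s6)
    have s7: "s7 = s6(9 := (s6 9)(n * n + 0 := 1))" using loaded_regs[OF l6] by (simp add: s7_def)
    have "config_rep n (s6 9) (E, {}, 0, None)" using l6 by (simp add: loaded_def)
    then have l7: "loaded n k s7 [] (E, {0}, 0, None)"
      unfolding s7 using loaded_array[OF l6 config_rep_mark[of n "s6 9" E "{}" 0 None 0]] n by blast
    have run: "run init s = iter (run ?p6) 16 n s7"
      using ri True conn loaded_regs[OF l7] by (simp add: s6_def s7_def)
    define P where "P j t \<longleftrightarrow> (\<exists>cs. loaded n k t cs (E, {0}, 0, None) \<and> length cs \<le> j \<and> t 8 = s7 8 \<and>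
      set cs = start_config E 0 ` {y. y < j \<and> {0, y} \<in> E})" for j :: nat and t :: state
    have "P n (iter (run ?p6) 16 n s7)"
    proof (rule iter_induct[where P = P])
      show "P 0 (set_reg 16 0 s7)"
        unfolding P_def using loaded_set_reg[OF l7, of 16 0] by (intro exI[of _ "[]"]) simp
    next
      fix j u assume j: "j < n" and u: "P j u" "u 16 0 = j"
      obtain cs where cs: "loaded n k u cs (E, {0}, 0, None)" "length cs \<le> j" "u 8 = s7 8"
        "set cs = start_config E 0 ` {y. y < j \<and> {0, y} \<in> E}" using u(1) unfolding P_def by blast
      have "matrix_rep n (u 9) E" using cs(1) by (simp add: loaded_def)
      then have "u 9 (0 * n + j) \<noteq> 0 \<longleftrightarrow> {0, j} \<in> E" using n j unfolding matrix_rep_def by blast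
      then have edge: "u 9 j \<noteq> 0 \<longleftrightarrow> {0, j} \<in> E" by simp
      show "P (Suc j) (set_reg 16 (Suc j) (run ?p6 u))"
      proof (cases "{0, j} \<in> E")
        case True
        then have "j \<noteq> 0" using simple_graph_edge[OF sg True] by simp
        have e: "run ?p6 u = run start u" using edge True u(2) by simp
        have l: "loaded n k (run start u) (start_config E 0 j # cs) (E, {0}, 0, None)"
          by (rule start_spec[OF cs(1) u(2) j \<open>j \<noteq> 0\<close>])
        have "8 \<notin> assigned start" by (simp add: start_def)
        then have "run start u 8 = s7 8" using cs(3) by (simp add: run_frame)
        moreover have "{y. y < Suc j \<and> {0, y} \<in> E} = insert j {y. y < j \<and> {0, y} \<in> E}"
          using True by (auto simp: less_Suc_eq)
        ultimately show ?thesis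
          unfolding P_def e using loaded_set_reg[OF l, of 16 "Suc j"] cs
          by (intro exI[of _ "start_config E 0 j # cs"]) simp
      next
        case False
        have e: "run ?p6 u = u" using edge False u(2) by simp
        have "{y. y < Suc j \<and> {0, y} \<in> E} = {y. y < j \<and> {0, y} \<in> E}"
          using False by (auto simp: less_Suc_eq)
        then show ?thesis
          unfolding P_def e using loaded_set_reg[OF cs(1), of 16 "Suc j"] cs
          by (intro exI[of _ cs]) simp
      qed
    qed
    then obtain cs where cs: "loaded n k (run init s) cs (E, {0}, 0, None)" "length cs \<le> n"
      "run init s 8 = s7 8" "set cs = start_config E 0 ` {y. y < n \<and> {0, y} \<in> E}"
      unfolding P_def run by blast
    have ans: "run init s 8 0 = of_bool (k = 0)" using cs(3) s68 by (simp add: s7)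
    have val: "config_valid ?V E c" if "c \<in> set cs" for c
      using start_config_valid[OF sg] that cs(4) by auto
    have sound: "has_internal_spanning_tree ?V E k" if "c \<in> set cs" "config_solvable ?V k c" for c
      using that cs(4) config_solvable_sound[of E E ?V k] by (auto simp: start_config_def)
    have complete: "k = 0 \<or> (\<exists>c\<in>set cs. config_solvable ?V k c)" if has: "has_internal_spanning_tree ?V E k"
    proof (cases "?V = {0}")
      \<comment> \<open>A single vertex has no neighbour, hence no starting configuration; only
        \<open>k = 0\<close> is possible, and its answer is set separately.\<close>
      case True
      then show ?thesis using has has_internal_singleton by metis
    next
      case False
      have "0 \<in> ?V" using n by simp
      from start_config_solvable[OF sg this False has] obtain y where
        y: "{0, y} \<in> E" "config_solvable ?V k (start_config E 0 y)" by blast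
      then have "y < n" using simple_graph_edge[OF sg y(1)] by simp
      then show ?thesis using y cs(4) by blast
    qed
    have zero: "has_internal_spanning_tree ?V E k" if "k = 0"
      using has_internal_zero[OF sg con] that by simp
    have "has_internal_spanning_tree ?V E k \<longleftrightarrow> run init s 8 0 \<noteq> 0 \<or> (\<exists>c\<in>set cs. config_solvable ?V k c)"
      using complete sound zero ans by auto
    then have "search_inv n E k (run init s) (\<Sum>c\<leftarrow>cs. config_size k c)"
      unfolding search_inv_def using cs(1) con val ans by (intro exI[of _ cs]) (simp add: loaded_def)
    moreover have "(\<Sum>c\<leftarrow>cs. config_size k c) \<le> n * search_size k"
    proof -
      have "(\<Sum>c\<leftarrow>cs. config_size k c) \<le> (\<Sum>c\<leftarrow>cs. search_size k)"
        by (rule sum_list_mono) (use cs(4) in \<open>auto simp: start_config_def\<close>)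
      also have "\<dots> = length cs * search_size k" by (simp add: sum_list_triv)
      finally show ?thesis using mult_le_mono1[OF cs(2)] by (rule le_trans)
    qed
    ultimately show ?thesis by blast
  qed
qed

section \<open>Running time\<close>

text \<open>After the comparison of \<open>k\<close> with \<open>n\<close> every number can be
  bounded in terms of \<open>n\<close>. Registers 6 and 7 are set outside the loop language, whose
  assignments do not produce values of this size.\<close>

definition solver :: com where
  "solver = If (Minus (Read 0 (Const 1)) (Read 0 (Const 0)))
     (Write 0 (Const 0) (Const 0))
     (Seq (Write 2 (Const 0) (Read 0 (Const 0)))
     (Seq (Write 3 (Const 0) (Read 0 (Const 1)))
     (Seq (Write 6 (Const 0) (Times (reg 2) (reg 2)))
     (Seq (Write 7 (Const 0) (Plus (reg 6) (Plus (reg 2) (Const 2))))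
     (Seq (compile init)
     (Seq (While (reg 4) (compile step))
          (Write 0 (Const 0) (reg 8))))))))"

lemma write_reg_exec:
  assumes "bounded s B" "aval b s = v"
  shows "\<exists>t. exec (Write x (Const 0) b) s t (set_reg x v s) \<and>
    t \<le> (charge (Const 0) + charge b) * (len B)\<^sup>2"
proof -
  have "acost (Const 0) s + acost b s + len (aval (Const 0) s) + len (aval b s)
      \<le> (charge (Const 0) + charge b) * (len B)\<^sup>2"
    using charge_le[OF assms(1), of "Const 0"] charge_le[OF assms(1), of b]
    unfolding add_mult_distrib by linarith
  then show ?thesis using exec.Write[of x "Const 0" b s] assms(2) by auto
qed

lemma instance_bounded: "bounded (instance_state n E k) (n * n + n + 2 + k)"
  by (auto simp: bounded_def instance_state_def)

lemma instance_matrix: "matrix_rep n (instance_state n E k 1) E"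
proof -
  have "instance_state n E k 1 (x * n + y) \<noteq> 0 \<longleftrightarrow> {x, y} \<in> E" if "x < n" "y < n" for x y
  proof -
    have "(\<exists>i<n. \<exists>j<n. x * n + y = i * n + j \<and> {i, j} \<in> E) \<longleftrightarrow> {x, y} \<in> E"
      using that cell_inj by metis
    then show ?thesis by (simp add: instance_state_def)
  qed
  then show ?thesis by (simp add: matrix_rep_def)
qed

lemma solver_large_exec:
  assumes "n < k"
  shows "\<exists>t s'. exec solver (instance_state n E k) t s' \<and> s' 0 0 = 0 \<and>
    t \<le> (charge (Minus (Read 0 (Const 1)) (Read 0 (Const 0))) + 2 * charge (Const 0)) *
      (len (n * n + n + 2 + k))\<^sup>2"
proof -
  let ?s = "instance_state n E k" and ?b = "Minus (Read 0 (Const 1)) (Read 0 (Const 0))"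
  have nz: "aval ?b ?s \<noteq> 0" using assms by (simp add: instance_state_def)
  obtain t where t: "exec (Write 0 (Const 0) (Const 0)) ?s t (set_reg 0 0 ?s)"
    "t \<le> (charge (Const 0) + charge (Const 0)) * (len (n * n + n + 2 + k))\<^sup>2"
    using write_reg_exec[OF instance_bounded[of n E k] aval.simps(1), of 0 0] by blast
  have c: "acost ?b ?s + len (aval ?b ?s) \<le> charge ?b * (len (n * n + n + 2 + k))\<^sup>2"
    by (rule charge_le[OF instance_bounded])
  have "exec solver ?s (acost ?b ?s + len (aval ?b ?s) + t) (set_reg 0 0 ?s)"
    unfolding solver_def by (rule exec.IfTrue[OF nz t(1)])
  moreover have "acost ?b ?s + len (aval ?b ?s) + t \<le>
      (charge ?b + 2 * charge (Const 0)) * (len (n * n + n + 2 + k))\<^sup>2"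
    using add_le_mono[OF c t(2)] by (simp add: algebra_simps)
  ultimately show ?thesis by (intro exI[of _ "acost ?b ?s + len (aval ?b ?s) + t"] exI) auto
qed

definition solver_overhead :: nat where
  "solver_overhead = charge (Minus (Read 0 (Const 1)) (Read 0 (Const 0))) +
    (charge (Const 0) + charge (Read 0 (Const 0))) + (charge (Const 0) + charge (Read 0 (Const 1))) +
    (charge (Const 0) + charge (Times (reg 2) (reg 2))) +
    (charge (Const 0) + charge (Plus (reg 6) (Plus (reg 2) (Const 2)))) +
    (charge (Const 0) + charge (reg 8))"

lemma solver_exec:
  assumes sg: "simple_graph {..<n} E" and sc: "subcubic {..<n} E" and kn: "k \<le> n"
  defines "M \<equiv> n * n + n + 2"
  shows "\<exists>N t s' B'. exec solver (instance_state n E k) t s' \<and> N \<le> n * search_size k \<and>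
    s' 0 0 = (if has_internal_spanning_tree {..<n} E k then 1 else 0) \<and>
    B' = M + k + writes init M + N * writes step M \<and>
    t \<le> solver_overhead * (len B')\<^sup>2 + run_time init M (len B') +
      Suc N * (charge (reg 4) * (len B')\<^sup>2 + run_time step M (len B'))"
proof -
  let ?b = "Minus (Read 0 (Const 1)) (Read 0 (Const 0))"
  define s0 where "s0 = instance_state n E k"
  define s1 where "s1 = set_reg 2 n s0"
  define s2 where "s2 = set_reg 3 k s1"
  define s3 where "s3 = set_reg 6 (n * n) s2"
  define s4 where "s4 = set_reg 7 M s3"
  define B where "B = M + k"
  have b0: "bounded s0 B" using instance_bounded[of n E k] by (simp add: s0_def B_def M_def)
  have b1: "bounded s1 B" unfolding s1_def by (rule bounded_set_reg[OF b0]) (simp add: B_def M_def)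
  have b2: "bounded s2 B" unfolding s2_def by (rule bounded_set_reg[OF b1]) (simp add: B_def M_def)
  have b3: "bounded s3 B" unfolding s3_def by (rule bounded_set_reg[OF b2]) (simp add: B_def M_def)
  have b4: "bounded s4 B" unfolding s4_def by (rule bounded_set_reg[OF b3]) (simp add: B_def M_def)
  have v: "s0 0 0 = n" "s0 0 (Suc 0) = k" by (auto simp: s0_def instance_state_def)
  have rg: "regs n k s4" by (simp add: regs_def s1_def s2_def s3_def s4_def M_def)
  have z: "s4 4 0 = 0" "s4 8 0 = 0"
    by (simp_all add: s0_def s1_def s2_def s3_def s4_def instance_state_def)
  have m: "matrix_rep n (s4 1) E"
    using instance_matrix[of n E k] by (simp add: s0_def s1_def s2_def s3_def s4_def)
  obtain N where inv: "search_inv n E k (run init s4) N" and N: "N \<le> n * search_size k"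
    using init_spec[OF rg z m sg] by blast
  \<comment> \<open>The initial values, their growth during \<open>init\<close>, and their growth in
    at most \<open>N\<close> rounds.\<close>
  define B' where "B' = B + writes init M + N * writes step M"
  define L where "L = len B'"
  have rM: "\<forall>r\<in>{2, 6, 7}. s4 r 0 \<le> M" using rg by (auto simp: regs_def M_def)
  have wi: "B + writes init M \<le> B'" and bB: "B \<le> B'" by (simp_all add: B'_def)
  have c0: "acost ?b s0 + len (aval ?b s0) \<le> charge ?b * L\<^sup>2"
    unfolding L_def by (rule charge_le[OF bounded_mono[OF b0 bB]])
  have a1: "aval (Read 0 (Const 0)) s0 = n" and a2: "aval (Read 0 (Const 1)) s1 = k"
    and a3: "aval (Times (reg 2) (reg 2)) s2 = n * n"
    and a4: "aval (Plus (reg 6) (Plus (reg 2) (Const 2))) s3 = M"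
    by (simp_all add: v s1_def s2_def s3_def M_def)
  obtain t1 where t1: "exec (Write 2 (Const 0) (Read 0 (Const 0))) s0 t1 s1"
    "t1 \<le> (charge (Const 0) + charge (Read 0 (Const 0))) * L\<^sup>2"
    using write_reg_exec[OF bounded_mono[OF b0 bB] a1, of 2] unfolding L_def s1_def by blast
  obtain t2 where t2: "exec (Write 3 (Const 0) (Read 0 (Const 1))) s1 t2 s2"
    "t2 \<le> (charge (Const 0) + charge (Read 0 (Const 1))) * L\<^sup>2"
    using write_reg_exec[OF bounded_mono[OF b1 bB] a2, of 3] unfolding L_def s2_def by blast
  obtain t3 where t3: "exec (Write 6 (Const 0) (Times (reg 2) (reg 2))) s2 t3 s3"
    "t3 \<le> (charge (Const 0) + charge (Times (reg 2) (reg 2))) * L\<^sup>2"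
    using write_reg_exec[OF bounded_mono[OF b2 bB] a3, of 6] unfolding L_def s3_def by blast
  obtain t4 where t4: "exec (Write 7 (Const 0) (Plus (reg 6) (Plus (reg 2) (Const 2)))) s3 t4 s4"
    "t4 \<le> (charge (Const 0) + charge (Plus (reg 6) (Plus (reg 2) (Const 2)))) * L\<^sup>2"
    using write_reg_exec[OF bounded_mono[OF b3 bB] a4, of 7] unfolding L_def s4_def by blast
  obtain t5 where t5: "exec (compile init) s4 t5 (run init s4)" "t5 \<le> run_time init M L"
    using compile_exec[OF init_syntax(1,2) b4 _ wi] rM init_syntax(3) unfolding L_def by blast
  have b5: "bounded (run init s4) (B + writes init M)"
    using run_bounded[OF init_syntax(1,2) b4] rM init_syntax(3) by blast
  have "regs n k (run init s4)" using inv by (auto simp: search_inv_def)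
  then have rM5: "\<forall>r\<in>bounds step. run init s4 r 0 \<le> M"
    using step_syntax(3) by (auto simp: regs_def M_def)
  obtain t6 s' N' where t6: "exec (While (reg 4) (compile step)) (run init s4) t6 s'"
    and inv': "search_inv n E k s' N'" and s4': "aval (reg 4) s' = 0" and bs': "bounded s' B'"
    and t6b: "t6 \<le> Suc N * (charge (reg 4) * L\<^sup>2 + run_time step M L)"
    using while_exec[OF step_syntax(1,2) step_inv[OF sg sc] inv b5 rM5, of "reg 4" B']
    unfolding L_def B'_def by auto
  obtain t7 where t7: "exec (Write 0 (Const 0) (reg 8)) s' t7 (set_reg 0 (s' 8 0) s')"
    "t7 \<le> (charge (Const 0) + charge (reg 8)) * L\<^sup>2"
    using write_reg_exec[OF bs', of "reg 8" "s' 8 0" 0] unfolding L_def by auto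
  have z0: "aval ?b s0 = 0" using kn v by simp
  define t where "t = acost ?b s0 + len (aval ?b s0) + (t1 + (t2 + (t3 + (t4 + (t5 + (t6 + t7))))))"
  have ex: "exec solver s0 t (set_reg 0 (s' 8 0) s')"
    unfolding solver_def t_def
    by (rule exec.IfFalse[OF z0 exec.Seq[OF t1(1) exec.Seq[OF t2(1) exec.Seq[OF t3(1) exec.Seq[OF t4(1)
      exec.Seq[OF t5(1) exec.Seq[OF t6 t7(1)]]]]]]])
  have ans: "s' 8 0 = (if has_internal_spanning_tree {..<n} E k then 1 else 0)"
  proof -
    obtain cs where "stack_rep n s' cs" "s' 8 0 \<le> 1"
      "has_internal_spanning_tree {..<n} E k \<longleftrightarrow> s' 8 0 \<noteq> 0 \<or> (\<exists>c\<in>set cs. config_solvable {..<n} k c)"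
      using inv' unfolding search_inv_def by blast
    moreover have "cs = []" using \<open>stack_rep n s' cs\<close> s4' by (simp add: stack_rep_def)
    ultimately show ?thesis by auto
  qed
  have "t \<le> solver_overhead * L\<^sup>2 + run_time init M L + Suc N * (charge (reg 4) * L\<^sup>2 + run_time step M L)"
    using c0 t1(2) t2(2) t3(2) t4(2) t5(2) t6b t7(2) unfolding t_def solver_overhead_def add_mult_distrib
    by linarith
  then show ?thesis
    using ex N ans unfolding L_def s0_def
    by (intro exI[of _ N] exI[of _ t] exI[of _ "set_reg 0 (s' 8 0) s'"] exI[of _ B'] conjI)
      (simp_all add: B'_def B_def)
qed

section \<open>From the number of rounds to the time bound\<close>

text \<open>A crude bound that serves to estimate binary lengths, where the base of the power
  affects only a constant.\<close>

lemma search_size_le: "search_size m \<le> 2 * 3 ^ m"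
proof (induction m rule: search_size.induct)
  case (3 m)
  have "search_size (Suc (Suc m)) = 2 + 2 * search_size (Suc m) + 2 * search_size m"
    "(1::nat) \<le> 3 ^ m" "(3::nat) ^ Suc m = 3 * 3 ^ m" "(3::nat) ^ Suc (Suc m) = 9 * 3 ^ m" by simp_all
  then show ?case using 3 by linarith
qed auto

lemma len_power: "len (x ^ d) \<le> d * len x + 1"
proof (induction d)
  case 0
  show ?case using len_le_iff[of 1 1] by simp
next
  case (Suc d)
  then show ?case using len_mult[of x "x ^ d"] by simp
qed

text \<open>The number of rounds is exponential in \<open>n\<close>, so the values it bounds have a
  length linear in \<open>M\<close>. The assumption \<open>k \<le> n\<close> keeps \<open>k\<close>
  out of the result.\<close>

lemma cap_len_linear:
  fixes A e :: nat
  assumes kn: "k \<le> n" and N: "N \<le> n * search_size k" and B: "B \<le> A * (M + 1) ^ e * Suc N"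
    and M: "n + 1 \<le> M"
  shows "len B \<le> (len A + 2 * e + 9) * (M + 1)"
proof -
  have "search_size k \<le> 2 * 3 ^ n"
    by (rule le_trans[OF search_size_le mult_le_mono2[OF power_increasing[OF kn]]]) simp
  then have "N \<le> n * (2 * 3 ^ n)" using N using le_trans[OF _ mult_le_mono2] by blast
  then have "Suc N \<le> 2 * (M * 3 ^ n)"
  proof -
    have "(n + 1) * 3 ^ n \<le> M * 3 ^ n" using M by (intro mult_le_mono1)
    moreover have "1 \<le> (3::nat) ^ n" by simp
    ultimately have "n * 3 ^ n + 1 \<le> M * 3 ^ n" unfolding add_mult_distrib by linarith
    then show ?thesis using \<open>N \<le> n * (2 * 3 ^ n)\<close> by simp
  qed
  then have "B \<le> A * (M + 1) ^ e * (2 * (M * 3 ^ n))" using B using le_trans[OF _ mult_le_mono2] by blast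
  then have "len B \<le> len (A * (M + 1) ^ e * (2 * (M * 3 ^ n)))" by (rule len_mono)
  also have "\<dots> \<le> (len A + len ((M + 1) ^ e)) + (len 2 + (len M + len (3 ^ n)))"
    using len_mult[of "A * (M + 1) ^ e" "2 * (M * 3 ^ n)"] len_mult[of A "(M + 1) ^ e"]
      len_mult[of 2 "M * 3 ^ n"] len_mult[of M "3 ^ n"] by linarith
  also have "\<dots> \<le> (len A + (e * (M + 2) + 1)) + (2 + (Suc M + (n * 2 + 1)))"
  proof -
    have "len 2 \<le> 2" "len 3 \<le> 2" using len_le_iff[of 2 2] len_le_iff[of 2 3] by simp_all
    moreover have "e * len (M + 1) \<le> e * (M + 2)" using len_le_Suc[of "M + 1"] by (intro mult_le_mono2) simp
    moreover have "n * len 3 \<le> n * 2" using \<open>len 3 \<le> 2\<close> by (intro mult_le_mono2)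
    ultimately show ?thesis
      using len_power[of "M + 1" e] len_power[of 3 n] len_le_Suc[of M] by linarith
  qed
  \<comment> \<open>Here \<open>e * (M + 2)\<close> is at most \<open>2 * e * (M + 1)\<close>, and
    the 9 leaves room for \<open>M + 2 * n + 5\<close>.\<close>
  also have "\<dots> \<le> (len A + 2 * e + 9) * (M + 1)"
    using M by (simp add: algebra_simps)
  finally show ?thesis .
qed

text \<open>The factor \<open>Suc N\<close> is kept apart, being the only exponential one. The
  square of \<open>L \<le> J * (M + 1)\<close> adds 2 to the exponent.\<close>

lemma solver_time_polynomial:
  "\<exists>K D. \<forall>n k N. k \<le> n \<longrightarrow> N \<le> n * search_size k \<longrightarrow>
    (let M = n * n + n + 2; L = len (M + k + writes init M + N * writes step M) in
      solver_overhead * L\<^sup>2 + run_time init M L + Suc N * (charge (reg 4) * L\<^sup>2 + run_time step M L)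
        \<le> K * (M + 1) ^ D * Suc N)"
proof -
  obtain C d where C: "\<And>m L. 1 \<le> L \<Longrightarrow> run_time init m L \<le> C * (m + 1) ^ d * L\<^sup>2"
    using run_time_polynomial by blast
  obtain C' d' where C': "\<And>m L. 1 \<le> L \<Longrightarrow> run_time step m L \<le> C' * (m + 1) ^ d' * L\<^sup>2"
    using run_time_polynomial by blast
  obtain W e where W: "\<And>m. writes init m \<le> W * (m + 1) ^ e" using writes_polynomial by blast
  obtain W' e' where W': "\<And>m. writes step m \<le> W' * (m + 1) ^ e'" using writes_polynomial by blast
  define A where "A = 2 + W + W'"
  define f where "f = 1 + e + e'"
  define J where "J = len A + 2 * f + 9"
  define Q where "Q = solver_overhead + C + charge (reg 4) + C'"
  have "(let M = n * n + n + 2; L = len (M + k + writes init M + N * writes step M) in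
      solver_overhead * L\<^sup>2 + run_time init M L + Suc N * (charge (reg 4) * L\<^sup>2 + run_time step M L)
        \<le> (Q * J\<^sup>2) * (M + 1) ^ (d + d' + 2) * Suc N)" if kn: "k \<le> n" and N: "N \<le> n * search_size k" for n k N
  proof -
    define M where "M = n * n + n + 2"
    define B where "B = M + k + writes init M + N * writes step M"
    define L where "L = len B"
    have le: "X * (M + 1) ^ a \<le> X * (M + 1) ^ b" if "a \<le> b" for X a b
      by (intro mult_le_mono2 power_increasing) (use that in auto)
    have M: "n + 1 \<le> M" by (simp add: M_def)
    have "M + k \<le> 2 * (M + 1) ^ f"
      using kn M power_increasing[of 1 f "M + 1"] by (simp add: f_def)
    moreover have "writes init M \<le> W * (M + 1) ^ f"
      by (rule le_trans[OF W le]) (simp add: f_def)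
    moreover have "writes step M \<le> W' * (M + 1) ^ f"
      by (rule le_trans[OF W' le]) (simp add: f_def)
    then have "N * writes step M \<le> N * (W' * (M + 1) ^ f)" by (rule mult_le_mono2)
    ultimately have "B \<le> 2 * (M + 1) ^ f + W * (M + 1) ^ f + N * (W' * (M + 1) ^ f)"
      unfolding B_def by linarith
    also have "\<dots> \<le> A * (M + 1) ^ f * Suc N" by (simp add: A_def algebra_simps)
    finally have LJ: "L \<le> J * (M + 1)"
      unfolding L_def J_def by (rule cap_len_linear[OF kn N _ M])
    have L1: "1 \<le> L" unfolding L_def by (rule len_pos)
    let ?p = "(M + 1) ^ (d + d')"
    have "run_time init M L \<le> C * ?p * L\<^sup>2"
      by (rule le_trans[OF C[OF L1] mult_le_mono1[OF le]]) simp
    moreover have "run_time step M L \<le> C' * ?p * L\<^sup>2"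
      by (rule le_trans[OF C'[OF L1] mult_le_mono1[OF le]]) simp
    moreover have z: "X * L\<^sup>2 \<le> X * ?p * L\<^sup>2" for X
    proof -
      have "1 \<le> ?p" by (rule one_le_power) simp
      then have "X * 1 * L\<^sup>2 \<le> X * ?p * L\<^sup>2" by (intro mult_le_mono1 mult_le_mono2)
      then show ?thesis by (simp only: mult_1_right)
    qed
    ultimately have "solver_overhead * L\<^sup>2 + run_time init M L +
        Suc N * (charge (reg 4) * L\<^sup>2 + run_time step M L) \<le>
      (solver_overhead * ?p * L\<^sup>2 + C * ?p * L\<^sup>2) + Suc N * (charge (reg 4) * ?p * L\<^sup>2 + C' * ?p * L\<^sup>2)"
      by (intro add_mono mult_le_mono2) auto
    also have "\<dots> \<le> Suc N * (solver_overhead * ?p * L\<^sup>2 + C * ?p * L\<^sup>2) +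
        Suc N * (charge (reg 4) * ?p * L\<^sup>2 + C' * ?p * L\<^sup>2)" by simp
    also have "\<dots> = Q * ?p * L\<^sup>2 * Suc N" by (simp add: Q_def algebra_simps)
    also have "\<dots> \<le> Q * ?p * (J * (M + 1))\<^sup>2 * Suc N"
      by (intro mult_le_mono1 mult_le_mono2 power_mono[OF LJ]) simp
    also have "\<dots> = (Q * J\<^sup>2) * (M + 1) ^ (d + d' + 2) * Suc N"
      by (simp add: power_mult_distrib power_add power2_eq_square algebra_simps)
    finally show ?thesis by (simp add: M_def B_def L_def Let_def)
  qed
  then show ?thesis by blast
qed

lemma Suc_iterations_le:
  assumes "N \<le> n * search_size k"
  shows "real (Suc N) \<le> 2 * real (n + 1) * 2.7321 ^ k"
proof -
  have s: "real (search_size k) \<le> 2 * 2.7321 ^ k" using search_size_bound[of k] by simp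
  have "real N \<le> real n * real (search_size k)"
    using assms by (metis of_nat_le_iff of_nat_mult)
  also have "\<dots> \<le> real n * (2 * 2.7321 ^ k)" by (intro mult_left_mono s) simp
  finally have "real N \<le> real n * (2 * 2.7321 ^ k)" .
  moreover have "1 \<le> (2.7321::real) ^ k" by (rule one_le_power) simp
  ultimately have "real (Suc N) \<le> real n * (2 * 2.7321 ^ k) + 2 * 2.7321 ^ k"
    unfolding of_nat_Suc by linarith
  also have "\<dots> = 2 * real (n + 1) * 2.7321 ^ k" by (simp add: distrib_right)
  finally show ?thesis .
qed

text \<open>Pays for an oversized \<open>k\<close>: the cost of reading it disappears in the
  exponential factor.\<close>

lemma len_square_le_exp: "(real (len k))\<^sup>2 \<le> 4 * 2.7321 ^ k"
proof -
  have "(k + 1)\<^sup>2 \<le> 4 * 2 ^ k"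
  proof (induction k)
    case (Suc k)
    show ?case
    proof (cases "k \<le> 1")
      case True
      then have "k = 0 \<or> k = 1" by auto
      then show ?thesis by (auto simp: power2_eq_square)
    next
      case False
      then have "2 * 2 \<le> k * k" by (intro mult_le_mono) auto
      then have "(Suc k + 1)\<^sup>2 \<le> 2 * (k + 1)\<^sup>2" by (simp add: power2_eq_square algebra_simps)
      then show ?thesis using Suc by simp
    qed
  qed simp
  then have "real ((k + 1)\<^sup>2) \<le> real (4 * 2 ^ k)" by (rule of_nat_mono)
  then have "(real k + 1)\<^sup>2 \<le> 4 * 2 ^ k" by (simp add: algebra_simps)
  moreover have "(real (len k))\<^sup>2 \<le> (real k + 1)\<^sup>2"
    using len_le_Suc[of k] by (intro power_mono) auto
  moreover have "(2::real) ^ k \<le> 2.7321 ^ k" by (rule power_mono) auto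
  ultimately show ?thesis by linarith
qed

theorem theorem2:
  shows "\<exists>(p :: com) (f :: nat \<Rightarrow> real) (d :: nat).
    f \<in> O(\<lambda>n. real n ^ d) \<and>
    (\<forall>(n :: nat) (E :: nat set set) (k :: nat).
       simple_graph {..<n} E \<and> subcubic {..<n} E \<longrightarrow>
       answers_within p (instance_state n E k)
         (has_internal_spanning_tree {..<n} E k) (2.7321 ^ k * f n))"
proof -
  obtain K D where KD: "\<And>n k N. k \<le> n \<Longrightarrow> N \<le> n * search_size k \<Longrightarrow>
    (let M = n * n + n + 2; L = len (M + k + writes init M + N * writes step M) in
      solver_overhead * L\<^sup>2 + run_time init M L + Suc N * (charge (reg 4) * L\<^sup>2 + run_time step M L)
        \<le> K * (M + 1) ^ D * Suc N)"
    using solver_time_polynomial by blast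
  define J where "J = charge (Minus (Read 0 (Const 1)) (Read 0 (Const 0))) + 2 * charge (Const 0)"
  define m where "m n = n * n + n + (3::nat)" for n
  \<comment> \<open>\<open>2 * K\<close> and one more power of \<open>m n\<close> come from
    \<open>Suc_iterations_le\<close>. The case \<open>k > n\<close> contributes
    \<open>16 * J\<close> and the power 2: a factor 4 from squaring
    \<open>2 * (m n * len k)\<close>, another 4 from \<open>len_square_le_exp\<close>.\<close>
  define f where "f n = real (2 * K + 16 * J) * real (m n) ^ (D + 2)" for n
  have m1: "1 \<le> m n" "n + 1 \<le> m n" for n by (auto simp: m_def)
  have large: "answers_within solver (instance_state n E k) (has_internal_spanning_tree {..<n} E k) (2.7321 ^ k * f n)"
    if kn: "n < k" for n E k
  proof -
    let ?M = "n * n + n + 2"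
    obtain t s' where t: "exec solver (instance_state n E k) t s'" "s' 0 0 = 0" "t \<le> J * (len (?M + k))\<^sup>2"
      using solver_large_exec[OF kn] unfolding J_def by blast
    have no: "\<not> has_internal_spanning_tree {..<n} E k" using has_internal_le kn by (meson not_le)
    have "len (?M + k) \<le> len ?M + len k" by (rule len_add)
    \<comment> \<open>Passing from the sum of the lengths to a product separates \<open>n\<close>
      from \<open>k\<close>.\<close>
    also have "\<dots> \<le> len ?M * len k + len ?M * len k"
      using len_pos[of ?M] len_pos[of k] by (intro add_mono) auto
    also have "\<dots> \<le> 2 * (m n * len k)"
    proof -
      have "len ?M \<le> m n" using len_le_Suc[of ?M] by (simp add: m_def)
      then have "len ?M * len k \<le> m n * len k" by (rule mult_le_mono1)
      then show ?thesis by linarith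
    qed
    finally have "len (?M + k) \<le> 2 * (m n * len k)" .
    then have "(len (?M + k))\<^sup>2 \<le> (2 * (m n * len k))\<^sup>2" by (rule power_mono) simp
    then have "J * (len (?M + k))\<^sup>2 \<le> J * (2 * (m n * len k))\<^sup>2" by (rule mult_le_mono2)
    then have "real t \<le> real (J * (2 * (m n * len k))\<^sup>2)" by (intro of_nat_mono le_trans[OF t(3)])
    also have "\<dots> = 4 * real J * real (m n) ^ 2 * (real (len k))\<^sup>2" by (simp add: power_mult_distrib)
    also have "\<dots> \<le> 4 * real J * real (m n) ^ 2 * (4 * 2.7321 ^ k)"
      by (intro mult_left_mono len_square_le_exp) simp
    also have "\<dots> = 2.7321 ^ k * (16 * real J * real (m n) ^ 2)" by simp
    also have "\<dots> \<le> 2.7321 ^ k * f n"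
      unfolding f_def using m1(1)[of n]
      by (intro mult_left_mono mult_mono power_increasing) auto
    finally show ?thesis using t(1,2) no unfolding answers_within_def by auto
  qed
  have small: "answers_within solver (instance_state n E k) (has_internal_spanning_tree {..<n} E k) (2.7321 ^ k * f n)"
    if sg: "simple_graph {..<n} E" and sc: "subcubic {..<n} E" and kn: "k \<le> n" for n E k
  proof -
    let ?M = "n * n + n + 2"
    obtain N t s' B' where t: "exec solver (instance_state n E k) t s'" and N: "N \<le> n * search_size k"
      and ans: "s' 0 0 = (if has_internal_spanning_tree {..<n} E k then 1 else 0)"
      and B': "B' = ?M + k + writes init ?M + N * writes step ?M"
      and tb: "t \<le> solver_overhead * (len B')\<^sup>2 + run_time init ?M (len B') +
        Suc N * (charge (reg 4) * (len B')\<^sup>2 + run_time step ?M (len B'))"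
      using solver_exec[OF sg sc kn] by blast
    have "t \<le> K * (?M + 1) ^ D * Suc N"
      using KD[OF kn N, unfolded Let_def, folded B'] tb by (rule order_trans[rotated])
    also have "?M + 1 = m n" by (simp add: m_def)
    finally have "real t \<le> real (K * m n ^ D * Suc N)" by (rule of_nat_mono)
    also have "\<dots> = real K * real (m n) ^ D * real (Suc N)" by (simp only: of_nat_mult of_nat_power)
    also have "\<dots> \<le> real K * real (m n) ^ D * (2 * real (n + 1) * 2.7321 ^ k)"
      by (intro mult_left_mono Suc_iterations_le[OF N]) simp
    also have "\<dots> \<le> real K * real (m n) ^ D * (2 * real (m n) * 2.7321 ^ k)"
      using m1(2)[of n] by (intro mult_left_mono mult_right_mono) auto
    also have "\<dots> = 2.7321 ^ k * (2 * real K * real (m n) ^ Suc D)" by simp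
    also have "\<dots> \<le> 2.7321 ^ k * f n"
      unfolding f_def using m1(1)[of n]
      by (intro mult_left_mono mult_mono power_increasing) auto
    finally show ?thesis using t ans unfolding answers_within_def by blast
  qed
  \<comment> \<open>The exponent doubles because \<open>m n\<close> is quadratic in
    \<open>n\<close>.\<close>
  have "f \<in> O(\<lambda>n. real n ^ (2 * (D + 2)))"
  proof (rule bigoI)
    show "\<forall>\<^sub>F n in at_top. norm (f n) \<le> real (2 * K + 16 * J) * 5 ^ (D + 2) * norm (real n ^ (2 * (D + 2)))"
      using eventually_ge_at_top[of 1]
    proof eventually_elim
      case (elim n)
      have "n \<le> n * n" "3 \<le> 3 * (n * n)" using elim by auto
      then have "m n \<le> 5 * n ^ 2" unfolding m_def power2_eq_square by linarith
      then have "real (m n) \<le> 5 * real n ^ 2" by (metis of_nat_le_iff of_nat_mult of_nat_numeral of_nat_power)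
      then have "real (m n) ^ (D + 2) \<le> (5 * real n ^ 2) ^ (D + 2)" by (rule power_mono) simp
      also have "\<dots> = 5 ^ (D + 2) * real n ^ (2 * (D + 2))"
        by (simp only: power_mult_distrib power_mult)
      finally have "f n \<le> real (2 * K + 16 * J) * (5 ^ (D + 2) * real n ^ (2 * (D + 2)))"
        unfolding f_def by (rule mult_left_mono) simp
      moreover have "0 \<le> f n" by (simp add: f_def)
      ultimately show ?case by (simp add: mult.assoc)
    qed
  qed
  moreover have "answers_within solver (instance_state n E k) (has_internal_spanning_tree {..<n} E k) (2.7321 ^ k * f n)"
    if "simple_graph {..<n} E \<and> subcubic {..<n} E" for n E k
    using large[of n k E] small[of n E k] that by (cases "n < k") auto
  ultimately show ?thesis by blast
qed

end
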